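(* Let $N\ge1$, $s\in(0,1)$, $a>0$, $x_0\in\mathbb{R}^N$, and let $f$ be a locally Lipschitz function such that $f(t)$ is non-increasing for nonnegative and small values of $t$. Assume that there exists a bounded weak solution $u$ of \[ \begin{cases} (-\Delta)^s u=f(u) & \text{in } \mathbb{R}^N\setminus\{x_0\},\\ u(x_0)=a, \end{cases} \] where $u$ denotes the continuous representative on $\mathbb{R}^N$, and that \[ 0\le u\le a\ \text{ in } \mathbb{R}^N\setminus\{x_0\},\qquad u(x)\to0\ \text{ as } |x|\to+\infty. \] Then $u$ is radially symmetric and radially decreasing with respect to $x_0$.
   Context: The fractional Laplacian is $(-\Delta)^s u(x)=c_{N,s}\,\mathrm{P.V.}\int_{\mathbb{R}^N}\frac{u(x)-u(y)}{|x-y|^{N+2s}}\,dy$, with $c_{N,s}>0$ a normalization constant. Set $\mathcal{E}(u,v)=\frac{c_{N,s}}{2}\int_{\mathbb{R}^{2N}}\frac{(u(x)-u(y))(v(x)-v(y))}{|x-y|^{N+2s}}\,dx\,dy$, and let $\mathcal{D}^s(\mathbb{R}^N)$ be the completion of $\mathcal{C}^\infty_c(\mathbb{R}^N)$ with respect to the norm induced by $\mathcal{E}$. A weak solution of $(-\Delta)^s w=g$ in an open set $U$ is a function $w\in\mathcal{D}^s(\mathbb{R}^N)$ with $\mathcal{E}(w,\varphi)=\int_U g\varphi\,dx$ for every $\varphi\in\mathcal{C}_c^\infty(U)$; here $g=f(u)$. "$f(t)$ is non-increasing for nonnegative and small values of $t$" means that there is $t_0>0$ such that $f$ is non-increasing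 on $[0,t_0]$. "Radially decreasing with respect to $x_0$" means that $u$ is a strictly decreasing function of $|x-x_0|$. *)

theory Defs
  imports "HOL-Analysis.Analysis"
begin

fun Ck :: "nat \<Rightarrow> ('a::euclidean_space \<Rightarrow> real) \<Rightarrow> bool" where
  "Ck 0 f \<longleftrightarrow> continuous_on UNIV f"
| "Ck (Suc k) f \<longleftrightarrow> f differentiable_on UNIV \<and> (\<forall>v. Ck k (\<lambda>x. frechet_derivative f (at x) v))"

definition Cc_infinity :: "'a::euclidean_space set \<Rightarrow> ('a \<Rightarrow> real) set" where
  "Cc_infinity U = {\<phi>. (\<forall>k. Ck k \<phi>) \<and> compact (closure {x. \<phi> x \<noteq> 0}) \<and> closure {x. \<phi> x \<noteq> 0} \<subseteq> U}"

text \<open>The parameter \<open>c\<close> is the normalization constant of the fractional Laplacian of order \<open>s\<close>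
  in dimension \<open>DIM('a)\<close>. On the diagonal, a null set, the integrand is \<open>0 / 0 = 0\<close>.\<close>

definition energy :: "real \<Rightarrow> real \<Rightarrow> ('a::euclidean_space \<Rightarrow> real) \<Rightarrow> ('a \<Rightarrow> real) \<Rightarrow> real" where
  "energy c s u v = c / 2 * (LINT (x, y)|lborel.
     (u x - u y) * (v x - v y) / norm (x - y) powr (real DIM('a) + 2 * s))"

definition energy_norm :: "real \<Rightarrow> real \<Rightarrow> ('a::euclidean_space \<Rightarrow> real) \<Rightarrow> real" where
  "energy_norm c s u = sqrt (energy c s u u)"

text \<open>The completion of \<open>Cc_infinity UNIV\<close> under \<open>energy_norm\<close>, realized by functions: its members
  are the measurable almost-everywhere limits of Cauchy sequences of test functions.  Requiring
  almost-everywhere convergence, and not only convergence in the norm, excludes nonzero constants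
  if \<open>DIM('a) > 2 * s\<close>.  If \<open>DIM('a) \<le> 2 * s\<close> the abstract completion only determines
  functions up to additive constants, and all their representatives are members here.\<close>

definition Ds_space :: "real \<Rightarrow> real \<Rightarrow> ('a::euclidean_space \<Rightarrow> real) set" where
  "Ds_space c s = {w \<in> borel_measurable lborel. \<exists>\<phi>.
     (\<forall>n. \<phi> n \<in> Cc_infinity UNIV) \<and>
     (\<forall>\<epsilon>>0. \<exists>M. \<forall>m\<ge>M. \<forall>n\<ge>M. energy_norm c s (\<lambda>x. \<phi> m x - \<phi> n x) < \<epsilon>) \<and>
     (AE x in lborel. (\<lambda>n. \<phi> n x) \<longlonglongrightarrow> w x)}"

text \<open>The integrability requirement only rules out the default value \<open>0\<close> of undefined integrals.\<close>

definition weak_solution ::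
  "real \<Rightarrow> real \<Rightarrow> 'a::euclidean_space set \<Rightarrow> ('a \<Rightarrow> real) \<Rightarrow> ('a \<Rightarrow> real) \<Rightarrow> bool" where
  "weak_solution c s U g w \<longleftrightarrow> w \<in> Ds_space c s \<and>
     (\<forall>\<phi>\<in>Cc_infinity U. set_integrable lborel U (\<lambda>x. g x * \<phi> x) \<and>
        energy c s w \<phi> = (LINT x:U|lborel. g x * \<phi> x))"

definition locally_lipschitz :: "(real \<Rightarrow> real) \<Rightarrow> bool" where
  "locally_lipschitz f \<longleftrightarrow> (\<forall>t. \<exists>r>0. \<exists>L. L-lipschitz_on (cball t r) f)"

definition radially_symmetric :: "'a::euclidean_space \<Rightarrow> ('a \<Rightarrow> real) \<Rightarrow> bool" where
  "radially_symmetric x\<^sub>0 u \<longleftrightarrow> (\<forall>x y. norm (x - x\<^sub>0) = norm (y - x\<^sub>0) \<longrightarrow> u x = u y)"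

definition radially_decreasing :: "'a::euclidean_space \<Rightarrow> ('a \<Rightarrow> real) \<Rightarrow> bool" where
  "radially_decreasing x\<^sub>0 u \<longleftrightarrow>
     (\<exists>h. strict_antimono_on {0..} h \<and> (\<forall>x. u x = h (norm (x - x\<^sub>0))))"

end

theory Submission
  imports Defs
begin

text \<open>The proof is the method of moving planes, run on mollifications of \<open>u\<close> so that the operator can
be evaluated at single points.

Fix a unit vector \<open>e\<close> and a level \<open>l\<close>. Let \<open>R\<close> be the reflection in the hyperplane \<open>x \<bullet> e = l\<close>, let
\<open>\<Sigma>\<close> be the half-space \<open>x \<bullet> e < l\<close>, and put \<open>w = u \<circ> R - u\<close>. As long as \<open>l \<le> x\<^sub>0 \<bullet> e\<close>, the point \<open>x\<^sub>0\<close> is not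
in \<open>\<Sigma>\<close>, and the only point of \<open>\<Sigma>\<close> at which the equation for \<open>w\<close> is not available is \<open>R x\<^sub>0\<close>. There
\<open>w = a - u (R x\<^sub>0) \<ge> 0\<close> because \<open>u\<close> has its maximum \<open>a\<close> at \<open>x\<^sub>0\<close>, so a negative minimum of \<open>w\<close> never sits at
the puncture. The claim is that \<open>w \<ge> 0\<close> on \<open>\<Sigma>\<close> for every such plane (\<open>moving_planes\<close>). Planes through
\<open>x\<^sub>0\<close>, used for \<open>e\<close> and for \<open>- e\<close>, then make \<open>u\<close> symmetric in every hyperplane through \<open>x\<^sub>0\<close>, hence
radial; planes with \<open>l < x\<^sub>0 \<bullet> e\<close> give monotonicity along rays.

Everything rests on an inequality at minimum points. Write \<open>K h = norm h powr - (N + 2 * s)\<close>. If \<open>w\<close> has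
its minimum over \<open>\<Sigma>\<close> at \<open>p\<close>, then folding the complement of \<open>\<Sigma>\<close> onto \<open>\<Sigma>\<close> shows that the operator at \<open>p\<close>,
divided by \<open>c\<close>, is the integral over \<open>y\<close> in \<open>\<Sigma>\<close> of
\<open>2 * w p * K (R y - p) - (w y - w p) * (K (y - p) - K (R y - p))\<close>.
If \<open>w p < 0\<close>, both terms are nonpositive, while the equation makes the operator equal to
\<open>f (u (R p)) - f (u p)\<close>. Three conclusions follow. Since \<open>u (R p) < u p\<close> and \<open>f\<close> is nonincreasing on \<open>[0, t\<^sub>0]\<close>,
necessarily \<open>u p > t\<^sub>0\<close>; as \<open>u\<close> decays, negative minima lie in a fixed ball and planes far away are
good. The first term is at most a negative multiple of \<open>- w p * d powr - (2 * s)\<close>, where \<open>d\<close> is the distance of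
\<open>p\<close> from the plane; as \<open>f\<close> is Lipschitz, minima of bad planes cannot run into the limit plane. Finally,
if the minima \<open>w p\<close> tend to \<open>0\<close>, the second term forces \<open>w = 0\<close> on the limit half-space
(\<open>symmetric_at_stopping_plane\<close>).

So a first bad position would be a symmetry plane with \<open>l < x\<^sub>0 \<bullet> e\<close>. Then \<open>u\<close> would equal its maximum \<open>a\<close>
also at the mirror image of \<open>x\<^sub>0\<close>, and the strong maximum principle would make nearby parallel
planes symmetry planes as well. Two parallel symmetry planes make \<open>u\<close> periodic, contrary to decay and
\<open>u x\<^sub>0 = a > 0\<close>. The same argument upgrades monotonicity along rays to strict monotonicity.

No derivative of \<open>u\<close> is at hand, so the inequality is proved by mollification
(\<open>touching_inequality\<close>). Testing the weak equation with a translated mollifier says that the operator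
with its kernel truncated near the origin, applied to the mollification of \<open>u\<close>, converges pointwise to the
mollification of \<open>f \<circ> u\<close> (\<open>energy_eq_limit_tlap\<close>). This needs the energy integrand of \<open>u\<close> and the test
function to be integrable, which follows from Fatou's lemma for members of \<open>Ds_space\<close>. The mollified \<open>w\<close>
has a minimum of its own, the inequality holds there, and the limit of these minimum points is the
required point \<open>p\<close>. In the strong maximum principle the minimum is \<open>0\<close> and need not be isolated; subtracting a
small antisymmetrized cap of a paraboloid isolates it at a small cost, because such a cap is
semiconvex and its truncated operators are bounded above.\<close>

section \<open>Invariance of Lebesgue measure\<close>

lemma integral_lborel_measure_preserving:
  fixes f :: "'a::euclidean_space \<Rightarrow> real"
  assumes g: "g \<in> borel_measurable borel" "distr lborel borel g = (lborel :: 'a measure)"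
    and f: "f \<in> borel_measurable borel"
  shows "(LINT x|lborel. f (g x)) = (LINT x|lborel. f x)"
    and "integrable lborel (\<lambda>x. f (g x)) \<longleftrightarrow> integrable lborel f"
proof -
  have g': "g \<in> lborel \<rightarrow>\<^sub>M borel" using g(1) by simp
  show "(LINT x|lborel. f (g x)) = (LINT x|lborel. f x)"
    using integral_distr[OF g' f] g(2) by simp
  show "integrable lborel (\<lambda>x. f (g x)) \<longleftrightarrow> integrable lborel f"
    using integrable_distr_eq[OF g' f] g(2) by simp
qed

lemma nn_integral_lborel_measure_preserving:
  fixes f :: "'a::euclidean_space \<Rightarrow> ennreal"
  assumes "g \<in> borel_measurable borel" "distr lborel borel g = (lborel :: 'a measure)"
    and "f \<in> borel_measurable borel"
  shows "(\<integral>\<^sup>+x. f (g x) \<partial>lborel) = (\<integral>\<^sup>+x. f x \<partial>lborel)"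
  using nn_integral_distr[of g lborel borel f] assms by simp

lemma lborel_distr_reflect_point:
  "distr lborel borel (\<lambda>x. c - x) = (lborel :: 'a::euclidean_space measure)"
  by (subst lborel_affine[of "-1" c], simp_all add: density_1)

text \<open>Uniqueness of Haar measure in miniature. For the unit ball \<open>B\<close>, the integral of
\<open>indicator A (T x) * indicator B (y - T x)\<close> over all \<open>x\<close> and \<open>y\<close> is \<open>emeasure lborel (T -` A) * emeasure lborel B\<close>;
the substitution \<open>x = T y - t\<close> turns it into \<open>emeasure lborel A * emeasure lborel B\<close>, because \<open>T\<close> preserves \<open>B\<close>.\<close>

lemma lborel_distr_isometric_involution:
  fixes T :: "'a::euclidean_space \<Rightarrow> 'a"
  assumes lin: "linear T" and iso: "\<And>x. norm (T x) = norm x" and inv: "\<And>x. T (T x) = x"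
  shows "distr lborel borel T = lborel"
proof (rule measure_eqI)
  have T_meas[measurable]: "T \<in> borel_measurable borel"
    using lin by (intro borel_measurable_continuous_onI linear_continuous_on linear_conv_bounded_linear[THEN iffD1])
  fix A assume "A \<in> sets (distr lborel borel T)"
  then have A[measurable]: "A \<in> sets borel" by simp
  define B where "B = (cball 0 1 :: 'a set)"
  have B[measurable]: "B \<in> sets borel" by (simp add: B_def)
  have refl_pt: "(\<lambda>x. c - x) \<in> borel_measurable borel" for c :: 'a by measurable
  have plus: "((+) c) \<in> borel_measurable borel" for c :: 'a by measurable
  have Tdiff: "T (T y - t) = y - T t" for y t
    using linear_diff[OF lin] inv by simp
  have shift: "(\<integral>\<^sup>+y. indicator S (y - c) \<partial>lborel) = emeasure lborel S" if "S \<in> sets borel" for S and c :: 'a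
    using nn_integral_lborel_measure_preserving[OF plus lborel_distr_plus, of "indicator S" "- c"] that
    by simp
  have volB: "emeasure lborel B \<noteq> 0" "emeasure lborel B \<noteq> \<infinity>"
    using unit_ball_vol_pos[of "real DIM('a)"] by (auto simp: B_def emeasure_cball simp del: unit_ball_vol_pos)
  have "emeasure (distr lborel borel T) A * emeasure lborel B
      = (\<integral>\<^sup>+x. indicator A (T x) \<partial>lborel) * (\<integral>\<^sup>+y. indicator B y \<partial>lborel)"
    by (simp add: nn_integral_distr flip: nn_integral_indicator)
  also have "\<dots> = (\<integral>\<^sup>+x. indicator A (T x) * (\<integral>\<^sup>+y. indicator B (y - T x) \<partial>lborel) \<partial>lborel)"
    by (simp add: nn_integral_multc shift)
  also have "\<dots> = (\<integral>\<^sup>+x. (\<integral>\<^sup>+y. indicator A (T x) * indicator B (y - T x) \<partial>lborel) \<partial>lborel)"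
    by (simp add: nn_integral_cmult)
  also have "\<dots> = (\<integral>\<^sup>+y. (\<integral>\<^sup>+x. indicator A (T x) * indicator B (y - T x) \<partial>lborel) \<partial>lborel)"
    by (rule lborel_pair.Fubini') measurable
  also have "\<dots> = (\<integral>\<^sup>+y. (\<integral>\<^sup>+t. indicator A (y - T t) * indicator B (T t) \<partial>lborel) \<partial>lborel)"
  proof (rule nn_integral_cong)
    fix y
    have "(\<lambda>x. indicator A (T x) * indicator B (y - T x) :: ennreal) \<in> borel_measurable borel"
      by measurable
    from nn_integral_lborel_measure_preserving[OF refl_pt lborel_distr_reflect_point this, of "T y"]
    show "(\<integral>\<^sup>+x. indicator A (T x) * indicator B (y - T x) \<partial>lborel)
        = (\<integral>\<^sup>+t. indicator A (y - T t) * indicator B (T t) \<partial>(lborel :: 'a measure) :: ennreal)"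
      by (simp add: Tdiff)
  qed
  also have "\<dots> = (\<integral>\<^sup>+t. (\<integral>\<^sup>+y. indicator A (y - T t) * indicator B (T t) \<partial>lborel) \<partial>lborel)"
    by (rule lborel_pair.Fubini'[symmetric]) measurable
  also have "\<dots> = (\<integral>\<^sup>+t. indicator B (T t) * (\<integral>\<^sup>+y. indicator A (y - T t) \<partial>lborel) \<partial>lborel)"
    by (simp add: nn_integral_cmult[symmetric] mult.commute)
  also have "\<dots> = (\<integral>\<^sup>+t. indicator B t * (\<integral>\<^sup>+y. indicator A y \<partial>lborel) \<partial>lborel)"
  proof -
    have "indicator B (T t) = (indicator B t :: ennreal)" for t by (simp add: B_def indicator_def iso)
    then show ?thesis by (simp add: shift)
  qed
  also have "\<dots> = emeasure lborel A * emeasure lborel B"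
    by (simp add: nn_integral_multc mult.commute)
  finally show "emeasure (distr lborel borel T) A = emeasure lborel A"
    using volB by (metis ennreal_mult_cancel_left infinity_ennreal_def mult.commute)
qed simp

section \<open>The kernel\<close>

definition kern :: "real \<Rightarrow> 'a::euclidean_space \<Rightarrow> real" where
  "kern s h = 1 / norm h powr (real DIM('a) + 2 * s)"

lemma kern_nonneg [simp]: "0 \<le> kern s h" by (simp add: kern_def)

lemma kern_measurable [measurable]: "kern s \<in> borel_measurable borel"
  unfolding kern_def by measurable

lemma kern_norm_cong: "norm h = norm h' \<Longrightarrow> kern s h = kern s h'" for h h' :: "'a::euclidean_space"
  by (simp add: kern_def)

lemma kern_minus [simp]: "kern s (- h) = kern s h" by (rule kern_norm_cong) simp

lemma kern_le:
  fixes h :: "'a::euclidean_space"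
  assumes "0 < r" "r \<le> norm h" "0 \<le> s"
  shows "kern s h \<le> r powr - (real DIM('a) + 2 * s)"
proof -
  have "r powr (real DIM('a) + 2 * s) \<le> norm h powr (real DIM('a) + 2 * s)"
    using assms by (intro powr_mono2) auto
  then show ?thesis
    using assms unfolding kern_def powr_minus_divide by (intro divide_left_mono mult_pos_pos) auto
qed

text \<open>Finiteness by dyadic annuli, with \<open>r k\<close> of the form \<open>2 ^ k\<close> or \<open>(1/2) ^ k\<close> in mind: it is enough that the bounds on
the annuli, weighted by the volumes of the balls around them, are summable.\<close>

lemma nn_integral_finite_dyadic:
  fixes F :: "'a::euclidean_space \<Rightarrow> real"
  assumes F: "\<And>h. F h \<noteq> 0 \<Longrightarrow> \<exists>k. norm h < 2 * r k \<and> F h \<le> M k"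
    and r: "\<And>k. 0 < r k" and M: "\<And>k. 0 \<le> M k"
    and sm: "summable (\<lambda>k::nat. M k * r k ^ DIM('a))"
  shows "(\<integral>\<^sup>+h. ennreal (F h) \<partial>lborel) < \<infinity>"
proof -
  have "(\<integral>\<^sup>+h. ennreal (F h) \<partial>lborel) \<le> (\<integral>\<^sup>+h. (\<Sum>k. ennreal (M k) * indicator (cball 0 (2 * r k)) h) \<partial>(lborel :: 'a measure))"
  proof (rule nn_integral_mono)
    fix h :: 'a
    show "ennreal (F h) \<le> (\<Sum>k. ennreal (M k) * indicator (cball 0 (2 * r k)) h)"
    proof (cases "F h = 0")
      case False
      then obtain k where k: "norm h < 2 * r k" "F h \<le> M k" using F by blast
      have "ennreal (F h) \<le> ennreal (M k) * indicator (cball 0 (2 * r k)) h"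
        using k by (simp add: ennreal_leI)
      also have "\<dots> \<le> (\<Sum>k. ennreal (M k) * indicator (cball 0 (2 * r k)) h)"
        using sum_le_suminf[of "\<lambda>k. ennreal (M k) * indicator (cball 0 (2 * r k)) h" "{k}"]
        by (simp del: sum_mult_indicator)
      finally show ?thesis .
    qed simp
  qed
  also have "\<dots> = (\<Sum>k. ennreal (M k) * emeasure lborel (cball 0 (2 * r k) :: 'a set))"
    by (subst nn_integral_suminf)
      (auto simp: nn_integral_cmult_indicator intro!: borel_measurable_times_ennreal borel_measurable_indicator)
  also have "\<dots> = (\<Sum>k. ennreal (unit_ball_vol (real DIM('a)) * 2 ^ DIM('a) * (M k * r k ^ DIM('a))))"
    using r M by (intro suminf_cong) (simp add: emeasure_cball less_imp_le ennreal_mult'[symmetric] power_mult_distrib mult_ac)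
  also have "\<dots> < \<infinity>"
    using summable_mult[OF sm] r M
    by (subst suminf_ennreal2) (auto simp: less_imp_le)
  finally show ?thesis .
qed

lemma kern_tail_integrable:
  assumes \<rho>: "0 < \<rho>" and s: "0 < s"
  shows "integrable lborel (\<lambda>h::'a::euclidean_space. indicator {h. \<rho> < norm h} h * kern s h)"
proof (rule integrableI_bounded)
  let ?b = "real DIM('a) + 2 * s"
  define r where "r k = 2 ^ k * \<rho>" for k :: nat
  have r: "0 < r k" for k using \<rho> by (simp add: r_def)
  have pw: "r k powr - ?b * r k ^ DIM('a) = \<rho> powr - (2 * s) * (2 powr - (2 * s)) ^ k" for k
  proof -
    have "r k powr - ?b * r k ^ DIM('a) = r k powr (- (2 * s))"
      using r[of k] by (simp add: powr_realpow[symmetric] powr_add[symmetric])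
    also have "\<dots> = (2 ^ k) powr - (2 * s) * \<rho> powr - (2 * s)"
      using \<rho> by (simp add: r_def powr_mult)
    also have "(2 ^ k :: real) powr - (2 * s) = (2 powr - (2 * s)) ^ k"
      by (simp add: powr_realpow[symmetric] powr_powr mult.commute)
    finally show ?thesis by (simp add: mult.commute)
  qed
  have "(2::real) powr - (2 * s) < 1" using s by (simp add: powr_less_one)
  then have "summable (\<lambda>k. r k powr - ?b * r k ^ DIM('a))"
    unfolding pw by (intro summable_mult summable_geometric) simp
  moreover have "\<exists>k. norm h < 2 * r k \<and> indicator {h. \<rho> < norm h} h * kern s h \<le> r k powr - ?b"
    if "indicator {h. \<rho> < norm h} h * kern s h \<noteq> 0" for h :: 'a
  proof -
    have h: "\<rho> < norm h" using that by (auto simp: indicator_def split: if_splits)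
    \<comment> \<open>The annulus containing \<open>h\<close> has the least index whose outer radius exceeds \<open>norm h\<close>.\<close>
    define P where "P k \<longleftrightarrow> norm h < r (Suc k)" for k
    obtain k0 :: nat where "norm h / \<rho> < 2 ^ k0" using real_arch_pow[of 2 "norm h / \<rho>"] by auto
    then have "norm h < r k0" using \<rho> by (simp add: r_def field_simps)
    then have ex: "P k0" using r[of k0] by (simp add: P_def r_def)
    define k where "k = (LEAST k. P k)"
    have Pk: "P k" unfolding k_def by (rule LeastI[of P, OF ex])
    have "r k \<le> norm h"
    proof (cases k)
      case 0 then show ?thesis using h by (simp add: r_def)
    next
      case (Suc j)
      then have "\<not> P j" unfolding k_def by (metis lessI not_less_Least)
      then show ?thesis using Suc by (simp add: P_def)
    qed
    moreover have "norm h < 2 * r k" using Pk by (simp add: P_def r_def)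
    ultimately show ?thesis using kern_le[OF r, of k h s] s h by auto
  qed
  ultimately have "(\<integral>\<^sup>+h. ennreal (indicator {h. \<rho> < norm h} h * kern s (h::'a)) \<partial>lborel) < \<infinity>"
    by (intro nn_integral_finite_dyadic[where r = r and M = "\<lambda>k. r k powr - ?b"]) (auto simp: r)
  then show "(\<integral>\<^sup>+h. ennreal (norm (indicator {h. \<rho> < norm h} h * kern s (h::'a))) \<partial>lborel) < \<infinity>"
    by simp
qed measurable

text \<open>The singularity at the origin is compensated by a factor \<open>(norm h)\<^sup>2\<close> since \<open>s < 1\<close>, as the tail in
\<open>kern_tail_integrable\<close> is integrable since \<open>s > 0\<close>. These are the two convergent geometric series
behind all later integrals.\<close>

lemma kern_moment_integrable:
  assumes s: "0 < s" "s < 1"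
  shows "integrable lborel (\<lambda>h::'a::euclidean_space. indicator {h. norm h < 1} h * ((norm h)\<^sup>2 * kern s h))"
proof (rule integrableI_bounded)
  let ?b = "real DIM('a) + 2 * s"
  define r :: "nat \<Rightarrow> real" where "r k = (1/2) ^ Suc k" for k :: nat
  have r: "0 < r k" for k by (simp add: r_def)
  define M where "M k = (2 * r k)\<^sup>2 * r k powr - ?b" for k
  have pw: "M k * r k ^ DIM('a) = 4 * (1/2) powr (2 - 2 * s) * ((1/2) powr (2 - 2 * s)) ^ k" for k
  proof -
    have "M k * r k ^ DIM('a) = 4 * (r k powr 2 * r k powr - ?b * r k powr (real DIM('a)))"
      using r[of k] by (simp add: M_def powr_realpow power_mult_distrib)
    also have "\<dots> = 4 * r k powr (2 - 2 * s)"
      by (simp add: powr_add[symmetric])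
    also have "r k powr (2 - 2 * s) = ((1/2) powr (2 - 2 * s)) ^ Suc k"
      unfolding r_def by (subst powr_realpow[symmetric, of "1/2"]) (simp_all add: powr_realpow[symmetric] powr_powr powr_add[symmetric] algebra_simps)
    finally show ?thesis by simp
  qed
  have "(1/2::real) powr (2 - 2 * s) < 1" using s by (simp add: powr_def mult_pos_neg)
  then have "summable (\<lambda>k. M k * r k ^ DIM('a))"
    unfolding pw by (intro summable_mult summable_geometric) simp
  moreover have "\<exists>k. norm h < 2 * r k \<and> indicator {h. norm h < 1} h * ((norm h)\<^sup>2 * kern s h) \<le> M k"
    if nz: "indicator {h. norm h < 1} h * ((norm h)\<^sup>2 * kern s h) \<noteq> 0" for h :: 'a
  proof -
    have h: "norm h < 1" "0 < norm h" using nz by (auto simp: indicator_def split: if_splits)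
    define P where "P k \<longleftrightarrow> r k \<le> norm h" for k
    obtain k0 :: nat where "(1/2) ^ k0 < norm h" using real_arch_pow_inv[of "norm h" "1/2"] h by auto
    moreover have "r k0 \<le> (1/2) ^ k0" by (simp add: r_def)
    ultimately have ex: "P k0" by (simp add: P_def)
    define k where "k = (LEAST k. P k)"
    have Pk: "P k" unfolding k_def by (rule LeastI[of P, OF ex])
    have up: "norm h < 2 * r k"
    proof (cases k)
      case 0 then show ?thesis using h by (simp add: r_def)
    next
      case (Suc j)
      then have "\<not> P j" unfolding k_def by (metis lessI not_less_Least)
      then show ?thesis using Suc by (simp add: P_def r_def)
    qed
    have "(norm h)\<^sup>2 * kern s h \<le> M k"
      unfolding M_def using up kern_le[OF r, of k h s] Pk s
      by (intro mult_mono power_mono) (auto simp: P_def)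
    then show ?thesis using up h by auto
  qed
  ultimately have "(\<integral>\<^sup>+h. ennreal (indicator {h. norm h < 1} h * ((norm h)\<^sup>2 * kern s (h::'a))) \<partial>lborel) < \<infinity>"
    by (intro nn_integral_finite_dyadic[where r = r and M = M]) (auto simp: r M_def)
  then show "(\<integral>\<^sup>+h. ennreal (norm (indicator {h. norm h < 1} h * ((norm h)\<^sup>2 * kern s (h::'a)))) \<partial>lborel) < \<infinity>"
    by simp
qed measurable

lemma kern_min_integrable:
  assumes s: "0 < s" "s < 1" and AB: "0 \<le> A" "0 \<le> B"
  shows "integrable lborel (\<lambda>h::'a::euclidean_space. min A (B * (norm h)\<^sup>2) * kern s h)"
proof (rule Bochner_Integration.integrable_bound)
  show "integrable lborel (\<lambda>h::'a. A * (indicator {h. 1/2 < norm h} h * kern s h)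
      + B * (indicator {h. norm h < 1} h * ((norm h)\<^sup>2 * kern s h)))"
    by (intro Bochner_Integration.integrable_add integrable_mult_right kern_tail_integrable kern_moment_integrable s) simp
  show "AE h in lborel. norm (min A (B * (norm (h::'a))\<^sup>2) * kern s h) \<le> norm (A * (indicator {h. 1/2 < norm h} h * kern s h)
      + B * (indicator {h. norm h < 1} h * ((norm h)\<^sup>2 * kern s h)))"
  proof (intro AE_I2)
    fix h :: 'a
    have *: "min A (B * (norm h)\<^sup>2) * kern s h \<le> A * kern s h" 
      "min A (B * (norm h)\<^sup>2) * kern s h \<le> B * ((norm h)\<^sup>2 * kern s h)"
      by (simp_all add: mult_right_mono flip: mult.assoc)
    have nn: "0 \<le> min A (B * (norm h)\<^sup>2) * kern s h" "0 \<le> A * kern s h" "0 \<le> B * ((norm h)\<^sup>2 * kern s h)"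
      using AB by simp_all
    have "min A (B * (norm h)\<^sup>2) * kern s h \<le> A * (indicator {h. 1/2 < norm h} h * kern s h)
      + B * (indicator {h. norm h < 1} h * ((norm h)\<^sup>2 * kern s h))"
      using * nn by (cases "1/2 < norm h"; cases "norm h < 1") auto
    with nn(1) show "norm (min A (B * (norm h)\<^sup>2) * kern s h) \<le> norm (A * (indicator {h. 1/2 < norm h} h * kern s h)
      + B * (indicator {h. norm h < 1} h * ((norm h)\<^sup>2 * kern s h)))"
      by (simp only: real_norm_def abs_of_nonneg)
  qed
qed measurable

section \<open>Finite energy\<close>

lemma borel_measurable_fst_snd [measurable (raw)]:
  fixes f :: "'m \<Rightarrow> 'a::euclidean_space \<times> 'b::euclidean_space"
  assumes "f \<in> borel_measurable M"
  shows "(\<lambda>x. fst (f x)) \<in> borel_measurable M" and "(\<lambda>x. snd (f x)) \<in> borel_measurable M"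
  using assms by (auto intro!: borel_measurable_continuous_on[where f = fst] borel_measurable_continuous_on[where f = snd] continuous_intros)

lemma nn_integral_lborel_pair:
  fixes f :: "'a::euclidean_space \<times> 'b::euclidean_space \<Rightarrow> ennreal"
  assumes "f \<in> borel_measurable borel"
  shows "(\<integral>\<^sup>+p. f p \<partial>lborel) = (\<integral>\<^sup>+x. (\<integral>\<^sup>+y. f (x, y) \<partial>lborel) \<partial>lborel)"
    and "(\<integral>\<^sup>+p. f p \<partial>lborel) = (\<integral>\<^sup>+y. (\<integral>\<^sup>+x. f (x, y) \<partial>lborel) \<partial>lborel)"
proof -
  have f: "f \<in> borel_measurable (lborel \<Otimes>\<^sub>M lborel)" using assms by (simp add: lborel_prod)
  show 1: "(\<integral>\<^sup>+p. f p \<partial>lborel) = (\<integral>\<^sup>+x. (\<integral>\<^sup>+y. f (x, y) \<partial>lborel) \<partial>lborel)"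
    using lborel.nn_integral_fst[OF f] by (simp add: lborel_prod)
  show "(\<integral>\<^sup>+p. f p \<partial>lborel) = (\<integral>\<^sup>+y. (\<integral>\<^sup>+x. f (x, y) \<partial>lborel) \<partial>lborel)"
    unfolding 1 using lborel_pair.Fubini[OF f] by simp
qed

lemma nn_integral_lborel_diff:
  fixes f :: "'a::euclidean_space \<Rightarrow> ennreal"
  assumes "f \<in> borel_measurable borel"
  shows "(\<integral>\<^sup>+y. f (x - y) \<partial>lborel) = (\<integral>\<^sup>+y. f y \<partial>lborel)"
    and "(\<integral>\<^sup>+y. f (y - x) \<partial>lborel) = (\<integral>\<^sup>+y. f y \<partial>lborel)"
proof -
  show "(\<integral>\<^sup>+y. f (x - y) \<partial>lborel) = (\<integral>\<^sup>+y. f y \<partial>lborel)"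
    by (rule nn_integral_lborel_measure_preserving[OF _ lborel_distr_reflect_point assms]) measurable
  show "(\<integral>\<^sup>+y. f (y - x) \<partial>lborel) = (\<integral>\<^sup>+y. f y \<partial>lborel)"
    using nn_integral_lborel_measure_preserving[OF _ lborel_distr_plus assms, of "- x"] by simp
qed

text \<open>The difference \<open>\<phi> x - \<phi> y\<close> vanishes unless \<open>x\<close> or \<open>y\<close> is in the support, and its square is at most the
minimum of a constant and a multiple of \<open>(norm (x - y))\<^sup>2\<close>, so \<open>kern_min_integrable\<close> applies in the
other variable.\<close>

lemma lipschitz_energy_integrable:
  fixes \<phi> :: "'a::euclidean_space \<Rightarrow> real"
  assumes s: "0 < s" "s < 1"
    and meas[measurable]: "\<phi> \<in> borel_measurable borel"
    and lip: "\<And>x y. \<bar>\<phi> x - \<phi> y\<bar> \<le> L * norm (x - y)"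
    and bnd: "\<And>x. \<bar>\<phi> x\<bar> \<le> M"
    and supp: "\<And>x. R < norm x \<Longrightarrow> \<phi> x = 0"
  shows "integrable lborel (\<lambda>(x, y). (\<phi> x - \<phi> y)\<^sup>2 * kern s (x - y))"
proof (rule integrableI_bounded)
  define S where "S = (cball 0 R :: 'a set)"
  have [measurable]: "S \<in> sets borel" by (simp add: S_def)
  define k where "k h = min ((2 * M)\<^sup>2) (L\<^sup>2 * (norm h)\<^sup>2) * kern s (h :: 'a)" for h
  have [measurable]: "k \<in> borel_measurable borel" unfolding k_def by measurable
  have k0: "0 \<le> k h" for h by (simp add: k_def)
  have "integrable lborel k" unfolding k_def by (rule kern_min_integrable[OF s]) auto
  then have Ik: "(\<integral>\<^sup>+h. ennreal (k h) \<partial>lborel) < \<infinity>"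
    using k0 by (simp add: integrable_iff_bounded)
  have S: "emeasure lborel S < \<infinity>" unfolding S_def using emeasure_lborel_cball_finite by blast
  have ptw: "(\<phi> x - \<phi> y)\<^sup>2 * kern s (x - y) \<le> (indicator S x + indicator S y) * k (x - y)" for x y
  proof (cases "x \<in> S \<or> y \<in> S")
    case True
    have "(\<phi> x - \<phi> y)\<^sup>2 \<le> (L * norm (x - y))\<^sup>2"
      using lip[of x y] by (metis abs_ge_zero order_trans power2_abs power_mono)
    moreover have "(\<phi> x - \<phi> y)\<^sup>2 \<le> (2 * M)\<^sup>2"
    proof -
      have "\<bar>\<phi> x - \<phi> y\<bar> \<le> 2 * M" using bnd[of x] bnd[of y] by linarith
      then show ?thesis by (metis abs_ge_zero power2_abs power_mono)
    qed
    ultimately have "(\<phi> x - \<phi> y)\<^sup>2 * kern s (x - y) \<le> k (x - y)"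
      unfolding k_def by (intro mult_right_mono) (auto simp: power_mult_distrib)
    also have "\<dots> \<le> (indicator S x + indicator S y) * k (x - y)"
      using True k0[of "x - y"] by (auto simp: indicator_def algebra_simps)
    finally show ?thesis .
  next
    case False
    then have "\<phi> x = 0" "\<phi> y = 0" using supp by (auto simp: S_def not_le)
    then show ?thesis using k0 by simp
  qed
  have "(\<integral>\<^sup>+p. ennreal (norm (case p of (x, y) \<Rightarrow> (\<phi> x - \<phi> y)\<^sup>2 * kern s (x - y))) \<partial>lborel)
      \<le> (\<integral>\<^sup>+p. (indicator S (fst p) * ennreal (k (fst p - snd p)) + indicator S (snd p) * ennreal (k (fst p - snd p))) \<partial>lborel)"
    (is "?A \<le> ?B")
  proof (rule nn_integral_mono)
    fix p :: "'a \<times> 'a"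
    obtain x y where p: "p = (x, y)" by (cases p)
    have "ennreal ((\<phi> x - \<phi> y)\<^sup>2 * kern s (x - y)) \<le> ennreal ((indicator S x + indicator S y) * k (x - y))"
      by (rule ennreal_leI[OF ptw])
    also have "\<dots> = indicator S x * ennreal (k (x - y)) + indicator S y * ennreal (k (x - y))"
      using k0[of "x - y"] by (auto simp: indicator_def ennreal_plus[symmetric] simp del: ennreal_plus)
    finally show "ennreal (norm (case p of (x, y) \<Rightarrow> (\<phi> x - \<phi> y)\<^sup>2 * kern s (x - y)))
      \<le> indicator S (fst p) * ennreal (k (fst p - snd p)) + indicator S (snd p) * ennreal (k (fst p - snd p))"
      by (simp add: p)
  qed
  also have "?B = (\<integral>\<^sup>+p. indicator S (fst p) * ennreal (k (fst p - snd p)) \<partial>lborel)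
     + (\<integral>\<^sup>+p. indicator S (snd p) * ennreal (k (fst p - snd p)) \<partial>lborel)"
    by (rule nn_integral_add) simp_all
  also have "(\<integral>\<^sup>+p. indicator S (fst p) * ennreal (k (fst p - snd p)) \<partial>lborel)
     = emeasure lborel S * (\<integral>\<^sup>+h. ennreal (k h) \<partial>lborel)"
    using nn_integral_lborel_diff(1)[of "\<lambda>h. ennreal (k h)"]
    by (subst nn_integral_lborel_pair(1)) (simp_all add: nn_integral_cmult nn_integral_multc)
  also have "(\<integral>\<^sup>+p. indicator S (snd p) * ennreal (k (fst p - snd p)) \<partial>lborel)
     = emeasure lborel S * (\<integral>\<^sup>+h. ennreal (k h) \<partial>lborel)"
    using nn_integral_lborel_diff(2)[of "\<lambda>h. ennreal (k h)"]
    by (subst nn_integral_lborel_pair(2)) (simp_all add: nn_integral_cmult nn_integral_multc)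
  also have "emeasure lborel S * (\<integral>\<^sup>+h. ennreal (k h) \<partial>lborel) + emeasure lborel S * (\<integral>\<^sup>+h. ennreal (k h) \<partial>lborel) < \<infinity>"
    using S Ik by (simp add: ennreal_mult_less_top)
  finally show "?A < \<infinity>" .
qed (simp add: case_prod_beta', measurable)

text \<open>The directional derivatives of a test function are continuous with compact support, hence
bounded; finitely many directions bound the operator norm of the derivative.\<close>

lemma Cc_infinity_lipschitz:
  fixes \<phi> :: "'a::euclidean_space \<Rightarrow> real"
  assumes "\<phi> \<in> Cc_infinity U"
  shows "\<exists>L M R. (\<forall>x y. \<bar>\<phi> x - \<phi> y\<bar> \<le> L * norm (x - y)) \<and> (\<forall>x. \<bar>\<phi> x\<bar> \<le> M) \<and> (\<forall>x. R < norm x \<longrightarrow> \<phi> x = 0)"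
proof -
  define K where "K = closure {x. \<phi> x \<noteq> 0}"
  have K: "compact K" and Ck: "Ck k \<phi>" for k using assms by (auto simp: Cc_infinity_def K_def)
  have cont: "continuous_on UNIV \<phi>" using Ck[of 0] by simp
  have diff: "\<phi> differentiable (at x)" for x
    using Ck[of 1] by (simp add: differentiable_on_def)
  have der: "(\<phi> has_derivative frechet_derivative \<phi> (at x)) (at x)" for x
    using diff frechet_derivative_works by blast
  have dcont: "continuous_on UNIV (\<lambda>x. frechet_derivative \<phi> (at x) v)" for v
    using Ck[of 1] by simp
  have out: "\<phi> x = 0" if "x \<notin> K" for x using that closure_subset[of "{x. \<phi> x \<noteq> 0}"] by (auto simp: K_def)
  have dout: "frechet_derivative \<phi> (at x) = (\<lambda>_. 0)" if "x \<notin> K" for x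
  proof -
    have "open (- K)" using K by (simp add: compact_imp_closed open_Compl)
    then have "(\<phi> has_derivative (\<lambda>_. 0)) (at x)"
      using has_derivative_transform_within_open[OF has_derivative_const[of 0 "at x"], of "- K" \<phi>] that out by auto
    then show ?thesis by (rule frechet_derivative_at[symmetric])
  qed
  have "\<exists>C. \<forall>x. \<bar>frechet_derivative \<phi> (at x) v\<bar> \<le> C" for v
  proof -
    have "compact ((\<lambda>x. frechet_derivative \<phi> (at x) v) ` K)"
      using K dcont by (intro compact_continuous_image) (auto intro: continuous_on_subset)
    then have "bounded ((\<lambda>x. frechet_derivative \<phi> (at x) v) ` K)" by (rule compact_imp_bounded)
    then obtain C where C: "\<And>x. x \<in> K \<Longrightarrow> \<bar>frechet_derivative \<phi> (at x) v\<bar> \<le> C"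
      by (auto simp: bounded_iff)
    have "\<bar>frechet_derivative \<phi> (at x) v\<bar> \<le> max C 0" for x
      using C[of x] dout[of x] by (cases "x \<in> K") auto
    then show ?thesis by blast
  qed
  then obtain C where C: "\<And>x v. \<bar>frechet_derivative \<phi> (at x) v\<bar> \<le> C v" by metis
  define L where "L = (\<Sum>b\<in>Basis. C (b::'a))"
  have onorm: "onorm (frechet_derivative \<phi> (at x)) \<le> L" for x
  proof (rule onorm_le)
    fix v :: 'a
    interpret linear "frechet_derivative \<phi> (at x)" by (rule has_derivative_linear[OF der])
    have "frechet_derivative \<phi> (at x) v = frechet_derivative \<phi> (at x) (\<Sum>b\<in>Basis. (v \<bullet> b) *\<^sub>R b)"
      by (simp add: euclidean_representation)
    also have "\<dots> = (\<Sum>b\<in>Basis. (v \<bullet> b) * frechet_derivative \<phi> (at x) b)"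
      by (simp add: sum scale)
    also have "norm \<dots> \<le> (\<Sum>b\<in>Basis. norm v * C b)"
      by (intro sum_norm_le) (simp add: abs_mult C Basis_le_norm mult_mono)
    finally show "norm (frechet_derivative \<phi> (at x) v) \<le> L * norm v"
      by (simp add: L_def sum_distrib_left mult.commute)
  qed
  have lip: "\<bar>\<phi> x - \<phi> y\<bar> \<le> L * norm (x - y)" for x y
    using differentiable_bound[of UNIV \<phi> "\<lambda>x. frechet_derivative \<phi> (at x)" L x y] der onorm by simp
  have "compact (\<phi> ` K)" using K cont by (intro compact_continuous_image) (auto intro: continuous_on_subset)
  then have "bounded (\<phi> ` K)" by (rule compact_imp_bounded)
  then obtain M where M: "\<And>x. x \<in> K \<Longrightarrow> \<bar>\<phi> x\<bar> \<le> M"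
    by (auto simp: bounded_iff)
  have M': "\<bar>\<phi> x\<bar> \<le> max M 0" for x using M[of x] out[of x] by (cases "x \<in> K") auto
  obtain R where R: "\<And>x. x \<in> K \<Longrightarrow> norm x \<le> R" using K compact_imp_bounded bounded_iff by metis
  have "\<phi> x = 0" if "R < norm x" for x using that R[of x] out[of x] by force
  with lip M' show ?thesis by blast
qed

lemma Cc_infinity_continuous: "\<phi> \<in> Cc_infinity U \<Longrightarrow> continuous_on UNIV \<phi>"
  unfolding Cc_infinity_def using Ck.simps(1) by blast

lemma Cc_infinity_measurable: "\<phi> \<in> Cc_infinity U \<Longrightarrow> \<phi> \<in> borel_measurable borel"
  by (simp add: Cc_infinity_continuous borel_measurable_continuous_onI)

lemma Cc_infinity_integrable:
  assumes "\<phi> \<in> Cc_infinity U" shows "integrable lborel (\<phi> :: 'a::euclidean_space \<Rightarrow> real)"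
proof -
  obtain M R where M: "\<And>x. \<bar>\<phi> x\<bar> \<le> M" and R: "\<And>x. R < norm x \<Longrightarrow> \<phi> x = 0"
    using Cc_infinity_lipschitz[OF assms] by blast
  have [measurable]: "\<phi> \<in> borel_measurable borel" by (rule Cc_infinity_measurable[OF assms])
  have "emeasure lborel (cball (0::'a) R) < \<infinity>" using emeasure_lborel_cball_finite by blast
  then have "integrable lborel (\<lambda>x. M * indicator (cball (0::'a) R) x)"
    by (intro integrable_mult_right) (simp add: integrable_indicator_iff)
  then show ?thesis
    by (rule Bochner_Integration.integrable_bound)
      (use M R in \<open>auto simp: indicator_def not_le intro!: AE_I2 order_trans[OF M]\<close>)
qed

lemma Cc_infinity_diff_energy_integrable:
  fixes \<phi> \<psi> :: "'a::euclidean_space \<Rightarrow> real"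
  assumes s: "0 < s" "s < 1" and "\<phi> \<in> Cc_infinity U" "\<psi> \<in> Cc_infinity V"
  shows "integrable lborel (\<lambda>(x, y). ((\<phi> x - \<psi> x) - (\<phi> y - \<psi> y))\<^sup>2 * kern s (x - y))"
proof -
  obtain L1 M1 R1 where 1: "\<And>x y. \<bar>\<phi> x - \<phi> y\<bar> \<le> L1 * norm (x - y)" "\<And>x. \<bar>\<phi> x\<bar> \<le> M1" "\<And>x. R1 < norm x \<Longrightarrow> \<phi> x = 0"
    using Cc_infinity_lipschitz[OF assms(3)] by blast
  obtain L2 M2 R2 where 2: "\<And>x y. \<bar>\<psi> x - \<psi> y\<bar> \<le> L2 * norm (x - y)" "\<And>x. \<bar>\<psi> x\<bar> \<le> M2" "\<And>x. R2 < norm x \<Longrightarrow> \<psi> x = 0"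
    using Cc_infinity_lipschitz[OF assms(4)] by blast
  have [measurable]: "\<phi> \<in> borel_measurable borel" "\<psi> \<in> borel_measurable borel"
    using assms by (auto intro: Cc_infinity_measurable)
  show ?thesis
  proof (rule lipschitz_energy_integrable[OF s, where L = "L1 + L2" and M = "M1 + M2" and R = "max R1 R2"])
    show "\<bar>(\<phi> x - \<psi> x) - (\<phi> y - \<psi> y)\<bar> \<le> (L1 + L2) * norm (x - y)" for x y
      using 1(1)[of x y] 2(1)[of x y] by (simp add: algebra_simps)
    show "\<bar>\<phi> x - \<psi> x\<bar> \<le> M1 + M2" for x
      using 1(2)[of x] 2(2)[of x] by linarith
  qed (use 1 2 in auto)
qed

lemma zero_in_Cc_infinity: "(\<lambda>x :: 'a :: euclidean_space. 0) \<in> Cc_infinity U"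
proof -
  have "Ck k (\<lambda>x :: 'a :: euclidean_space. 0 :: real)" for k
    by (induction k) (simp_all add: frechet_derivative_const)
  then show ?thesis by (simp add: Cc_infinity_def)
qed

lemma Cc_infinity_energy_integrable:
  fixes \<phi> :: "'a::euclidean_space \<Rightarrow> real"
  assumes "0 < s" "s < 1" and "\<phi> \<in> Cc_infinity U"
  shows "integrable lborel (\<lambda>(x, y). (\<phi> x - \<phi> y)\<^sup>2 * kern s (x - y))"
  using Cc_infinity_diff_energy_integrable[OF assms zero_in_Cc_infinity] by simp

lemma energy_kern:
  "energy c s u v = c / 2 * (LINT (x, y)|lborel. (u x - u y) * (v x - v y) * kern s (x - y))"
  by (simp add: energy_def kern_def)

text \<open>A Cauchy sequence is bounded in energy relative to one of its members, and Fatou's lemma passes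
the bound to the almost everywhere limit. The default value of undefined integrals does no harm,
since energies of differences of test functions are genuine integrals.\<close>

lemma Ds_space_energy_integrable:
  fixes u :: "'a::euclidean_space \<Rightarrow> real"
  assumes s: "0 < s" "s < 1" and c: "0 < c" and u: "u \<in> Ds_space c s"
  shows "integrable lborel (\<lambda>(x, y). (u x - u y)\<^sup>2 * kern s (x - y))"
proof -
  obtain \<phi> where \<phi>: "\<And>n. \<phi> n \<in> Cc_infinity UNIV"
    and cau: "\<And>\<epsilon>. 0 < \<epsilon> \<Longrightarrow> \<exists>M. \<forall>m\<ge>M. \<forall>n\<ge>M. energy_norm c s (\<lambda>x. \<phi> m x - \<phi> n x) < \<epsilon>"
    and ae: "AE x in lborel. (\<lambda>n. \<phi> n x) \<longlonglongrightarrow> u x" and um[measurable]: "u \<in> borel_measurable borel"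
    using u by (auto simp: Ds_space_def)
  obtain M where M: "\<And>m. M \<le> m \<Longrightarrow> energy_norm c s (\<lambda>x. \<phi> m x - \<phi> M x) < 1"
    using cau[of 1] by auto
  \<comment> \<open>Work relative to \<open>\<phi> M\<close>: only differences of members of the sequence have controlled energy.\<close>
  define \<psi> where "\<psi> n x = \<phi> (n + M) x - \<phi> M x" for n x
  define v where "v x = u x - \<phi> M x" for x
  have \<phi>m[measurable]: "\<phi> n \<in> borel_measurable borel" for n using \<phi> by (rule Cc_infinity_measurable)
  have [measurable]: "\<psi> n \<in> borel_measurable borel" for n unfolding \<psi>_def by measurable
  have [measurable]: "v \<in> borel_measurable borel" unfolding v_def by measurable
  have int: "integrable lborel (\<lambda>(x, y). (\<psi> n x - \<psi> n y)\<^sup>2 * kern s (x - y))" for n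
    unfolding \<psi>_def by (rule Cc_infinity_diff_energy_integrable[OF s \<phi> \<phi>])
  have bnd: "(\<integral>\<^sup>+p. ennreal ((\<psi> n (fst p) - \<psi> n (snd p))\<^sup>2 * kern s (fst p - snd p)) \<partial>lborel) \<le> ennreal (2 / c)" for n
  proof -
    have "energy c s (\<psi> n) (\<psi> n) < 1"
      using M[of "n + M"] by (auto simp: energy_norm_def \<psi>_def[abs_def])
    then have "(LINT (x, y)|lborel. (\<psi> n x - \<psi> n y)\<^sup>2 * kern s (x - y)) \<le> 2 / c"
      using c by (simp add: energy_kern power2_eq_square field_simps)
    then show ?thesis
      using int[of n] by (subst nn_integral_eq_integral) (auto simp: case_prod_beta' intro!: ennreal_leI)
  qed
  have ae2: "AE p in lborel. (\<lambda>n. \<psi> n (fst p)) \<longlonglongrightarrow> v (fst p) \<and> (\<lambda>n. \<psi> n (snd p)) \<longlonglongrightarrow> v (snd p)"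
  proof -
    have conv: "AE x in lborel. (\<lambda>n. \<psi> n x) \<longlonglongrightarrow> v x"
      using ae
    proof eventually_elim
      case (elim x)
      show ?case unfolding \<psi>_def v_def by (intro tendsto_intros LIMSEQ_ignore_initial_segment elim)
    qed
    then obtain N where N: "{x \<in> space lborel. \<not> (\<lambda>n. \<psi> n x) \<longlonglongrightarrow> v x} \<subseteq> N" "N \<in> null_sets lborel"
      by (auto simp: eventually_ae_filter)
    have [measurable]: "N \<in> sets borel" using N(2) by auto
    have "AE p in lborel \<Otimes>\<^sub>M lborel. fst p \<notin> N \<and> snd p \<notin> N"
    proof (rule lborel_pair.AE_pair_measure)
      show "AE x in lborel. AE y in lborel. fst (x, y) \<notin> N \<and> snd (x, y) \<notin> N"
        using AE_not_in[OF N(2)] by eventually_elim (use AE_not_in[OF N(2)] in auto)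
    qed measurable
    then have "AE p in lborel \<Otimes>\<^sub>M lborel. (\<lambda>n. \<psi> n (fst p)) \<longlonglongrightarrow> v (fst p) \<and> (\<lambda>n. \<psi> n (snd p)) \<longlonglongrightarrow> v (snd p)"
      by eventually_elim (use N(1) in auto)
    then show ?thesis unfolding lborel_prod .
  qed
  define F where "F w p = ennreal ((w (fst p) - w (snd p))\<^sup>2 * kern s (fst p - snd p))" for w :: "'a \<Rightarrow> real" and p
  have "(\<integral>\<^sup>+p. F v p \<partial>lborel) = (\<integral>\<^sup>+p. liminf (\<lambda>n. F (\<psi> n) p) \<partial>lborel)"
  proof (rule nn_integral_cong_AE)
    show "AE p in lborel. F v p = liminf (\<lambda>n. F (\<psi> n) p)"
      using ae2
    proof eventually_elim
      case (elim p)
      then have "(\<lambda>n. F (\<psi> n) p) \<longlonglongrightarrow> F v p"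
        unfolding F_def by (intro tendsto_intros tendsto_ennrealI) auto
      then show ?case by (simp add: lim_imp_Liminf)
    qed
  qed
  also have "\<dots> \<le> liminf (\<lambda>n. \<integral>\<^sup>+p. F (\<psi> n) p \<partial>lborel)"
    by (rule nn_integral_liminf) (simp add: F_def)
  also have "\<dots> \<le> ennreal (2 / c)"
    using bnd by (intro Liminf_le) (simp_all add: F_def)
  finally have Fv: "(\<integral>\<^sup>+p. F v p \<partial>lborel) < \<infinity>" by (rule order_le_less_trans) simp
  have I1: "integrable lborel (\<lambda>p. (v (fst p) - v (snd p))\<^sup>2 * kern s (fst p - snd p))"
    using Fv by (intro integrableI_bounded) (simp_all add: F_def)
  have I2: "integrable lborel (\<lambda>p. (\<phi> M (fst p) - \<phi> M (snd p))\<^sup>2 * kern s (fst p - snd p))"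
    using Cc_infinity_energy_integrable[OF s \<phi>, of M] by (simp add: case_prod_beta')
  have "integrable lborel (\<lambda>p. (u (fst p) - u (snd p))\<^sup>2 * kern s (fst p - snd p))"
  proof (rule Bochner_Integration.integrable_bound)
    show "integrable lborel (\<lambda>p. 2 * ((v (fst p) - v (snd p))\<^sup>2 * kern s (fst p - snd p))
        + 2 * ((\<phi> M (fst p) - \<phi> M (snd p))\<^sup>2 * kern s (fst p - snd p)))"
      using I1 I2 by simp
    show "AE p in lborel. norm ((u (fst p) - u (snd p))\<^sup>2 * kern s (fst p - snd p))
      \<le> norm (2 * ((v (fst p) - v (snd p))\<^sup>2 * kern s (fst p - snd p))
        + 2 * ((\<phi> M (fst p) - \<phi> M (snd p))\<^sup>2 * kern s (fst p - snd p)))"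
    proof (rule AE_I2)
      fix p :: "'a \<times> 'a"
      define x y where "x = v (fst p) - v (snd p)" and "y = \<phi> M (fst p) - \<phi> M (snd p)"
      have "u (fst p) - u (snd p) = x + y" by (simp add: x_def y_def v_def)
      moreover have "(x + y)\<^sup>2 * kern s (fst p - snd p) \<le> (2 * x\<^sup>2 + 2 * y\<^sup>2) * kern s (fst p - snd p)"
        using sum_squares_bound[of x y] by (intro mult_right_mono) (auto simp: power2_sum)
      ultimately show "norm ((u (fst p) - u (snd p))\<^sup>2 * kern s (fst p - snd p))
      \<le> norm (2 * ((v (fst p) - v (snd p))\<^sup>2 * kern s (fst p - snd p))
        + 2 * ((\<phi> M (fst p) - \<phi> M (snd p))\<^sup>2 * kern s (fst p - snd p)))"
        by (simp add: x_def[symmetric] y_def[symmetric] algebra_simps)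
    qed
  qed measurable
  then show ?thesis by (simp add: case_prod_beta')
qed

section \<open>The truncated operator and the weak equation\<close>

definition tkern :: "real \<Rightarrow> nat \<Rightarrow> 'a::euclidean_space \<Rightarrow> real" where
  "tkern s n h = indicator {h. 1 / real (Suc n) < norm h} h * kern s h"

text \<open>The fractional Laplacian without its normalization and with the kernel cut off near the origin. The
cutoff makes the integral converge absolutely for every bounded function, and the limit
\<open>n \<rightarrow> \<infinity>\<close> is the principal value.\<close>

definition tlap :: "real \<Rightarrow> nat \<Rightarrow> ('a::euclidean_space \<Rightarrow> real) \<Rightarrow> 'a \<Rightarrow> real" where
  "tlap s n V z = (LINT h|lborel. tkern s n h * (V z - V (z + h)))"

definition mollify :: "('a::euclidean_space \<Rightarrow> real) \<Rightarrow> ('a \<Rightarrow> real) \<Rightarrow> 'a \<Rightarrow> real" where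
  "mollify \<eta> u z = (LINT x|lborel. \<eta> x * u (z + x))"

lemma tkern_nonneg [simp]: "0 \<le> tkern s n h" by (simp add: tkern_def)

lemma tkern_le_kern: "tkern s n h \<le> kern s h" by (simp add: tkern_def indicator_def)

lemma tkern_minus [simp]: "tkern s n (- h) = tkern s n h" by (simp add: tkern_def indicator_def)

lemma tkern_measurable [measurable]: "tkern s n \<in> borel_measurable borel"
  unfolding tkern_def by measurable

lemma tkern_integrable: "0 < s \<Longrightarrow> integrable lborel (tkern s n)"
  using kern_tail_integrable[of "1 / real (Suc n)" s] by (simp add: tkern_def[abs_def])

lemma tkern_LIMSEQ:
  assumes "h \<noteq> 0" shows "(\<lambda>n. tkern s n h) \<longlonglongrightarrow> kern s h"
proof (rule tendsto_eventually)
  obtain n0 where n0: "inverse (real (Suc n0)) < norm h" using reals_Archimedean[of "norm h"] assms by auto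
  have "tkern s n h = kern s h" if "n0 \<le> n" for n
  proof -
    have "1 / real (Suc n) \<le> 1 / real (Suc n0)" using that by (simp add: frac_le)
    then show ?thesis using n0 by (simp add: tkern_def inverse_eq_divide)
  qed
  then show "\<forall>\<^sub>F n in sequentially. tkern s n h = kern s h" by (auto simp: eventually_sequentially)
qed

lemma tensor_integrable:
  fixes f g :: "'a::euclidean_space \<Rightarrow> real"
  assumes f: "integrable lborel f" and g: "integrable lborel g"
  shows "integrable lborel (\<lambda>p. f (fst p) * g (snd p))"
proof (rule integrableI_bounded)
  have [measurable]: "f \<in> borel_measurable borel" "g \<in> borel_measurable borel" using f g by auto
  show "(\<lambda>p. f (fst p) * g (snd p)) \<in> borel_measurable lborel" by measurable
  have "(\<integral>\<^sup>+p. ennreal (norm (f (fst p) * g (snd p))) \<partial>lborel)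
     = (\<integral>\<^sup>+x. ennreal \<bar>f x\<bar> \<partial>lborel) * (\<integral>\<^sup>+y. ennreal \<bar>g y\<bar> \<partial>lborel)"
    by (subst nn_integral_lborel_pair(1)) (simp_all add: abs_mult ennreal_mult nn_integral_cmult nn_integral_multc)
  also have "\<dots> < \<infinity>" using f g by (simp add: integrable_iff_bounded ennreal_mult_less_top)
  finally show "(\<integral>\<^sup>+p. ennreal (norm (f (fst p) * g (snd p))) \<partial>lborel) < \<infinity>" .
qed

lemma integral_lborel_pair:
  fixes f :: "'a::euclidean_space \<Rightarrow> 'b::euclidean_space \<Rightarrow> real"
  assumes "integrable lborel (\<lambda>(x, y). f x y)"
  shows "(LINT (x, y)|lborel. f x y) = (LINT x|lborel. LINT y|lborel. f x y)"
    and "(LINT (x, y)|lborel. f x y) = (LINT y|lborel. LINT x|lborel. f x y)"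
proof -
  have f: "integrable (lborel \<Otimes>\<^sub>M lborel) (\<lambda>(x, y). f x y)" using assms by (simp add: lborel_prod)
  show "(LINT (x, y)|lborel. f x y) = (LINT x|lborel. LINT y|lborel. f x y)"
    using lborel_pair.integral_fst[OF f] by (simp add: lborel_prod)
  show "(LINT (x, y)|lborel. f x y) = (LINT y|lborel. LINT x|lborel. f x y)"
    using lborel_pair.integral_snd[OF f] by (simp add: lborel_prod)
qed

lemma integral_swap_lborel:
  fixes f :: "'a::euclidean_space \<Rightarrow> 'a \<Rightarrow> real"
  assumes "integrable lborel (\<lambda>(x, y). f x y)"
  shows "integrable lborel (\<lambda>(x, y). f y x)" and "(LINT (x, y)|lborel. f y x) = (LINT (x, y)|lborel. f x y)"
proof -
  have f: "integrable (lborel \<Otimes>\<^sub>M lborel) (\<lambda>(x, y). f x y)" using assms by (simp add: lborel_prod)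
  show "integrable lborel (\<lambda>(x, y). f y x)"
    using lborel_pair.integrable_product_swap[OF f] by (simp add: lborel_prod)
  show "(LINT (x, y)|lborel. f y x) = (LINT (x, y)|lborel. f x y)"
    using lborel_pair.integral_product_swap[of "\<lambda>(x, y). f x y"] f by (simp add: lborel_prod)
qed

lemma integral_lborel_shift:
  fixes f :: "'a::euclidean_space \<Rightarrow> real"
  assumes "f \<in> borel_measurable borel"
  shows "(LINT y|lborel. f (x + y)) = (LINT y|lborel. f y)"
    and "integrable lborel (\<lambda>y. f (x + y)) \<longleftrightarrow> integrable lborel f"
  by (rule integral_lborel_measure_preserving[OF _ lborel_distr_plus assms], measurable)+

text \<open>Summation by parts. With the truncated kernel the two halves of \<open>\<phi> x - \<phi> y\<close> can be
integrated separately, they contribute equally by symmetry in \<open>x\<close> and \<open>y\<close>, and Fubini moves the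
integration against \<open>\<phi>\<close> inside.\<close>

lemma truncated_energy:
  fixes u \<phi> :: "'a::euclidean_space \<Rightarrow> real"
  assumes s: "0 < s" and um[measurable]: "u \<in> borel_measurable borel" and B: "\<And>x. \<bar>u x\<bar> \<le> B"
    and \<phi>: "integrable lborel \<phi>"
  shows "(LINT (x, y)|lborel. (u x - u y) * (\<phi> x - \<phi> y) * tkern s n (x - y))
     = 2 * (LINT h|lborel. tkern s n h * (LINT x|lborel. \<phi> x * (u x - u (x + h))))"
proof -
  have \<phi>m[measurable]: "\<phi> \<in> borel_measurable borel" using \<phi> by auto
  define A where "A x y = (u x - u y) * \<phi> x * tkern s n (x - y)" for x y :: 'a
  define D where "D x h = tkern s n h * (\<phi> x * (u x - u (x + h)))" for x h :: 'a
  have Am[measurable]: "(\<lambda>p. A (fst p) (snd p)) \<in> borel_measurable borel" unfolding A_def by measurable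
  have B2: "\<bar>u x - u y\<bar> \<le> 2 * B" for x y using B[of x] B[of y] by linarith
  have D: "integrable lborel (\<lambda>(x, h). D x h)"
    unfolding case_prod_beta'
  proof (rule Bochner_Integration.integrable_bound)
    show "integrable lborel (\<lambda>p :: 'a \<times> 'a. 2 * B * (\<phi> (fst p) * tkern s n (snd p)))"
      using tensor_integrable[OF \<phi> tkern_integrable[OF s, of n]] by simp
    have "0 \<le> B" using B[of 0] by simp
    then have "\<bar>D x h\<bar> \<le> \<bar>2 * B * (\<phi> x * tkern s n h)\<bar>" for x h
      unfolding D_def abs_mult using mult_right_mono[OF B2[of x "x + h"], of "\<bar>\<phi> x\<bar> * \<bar>tkern s n h\<bar>"]
      by (simp add: mult_ac)
    then show "AE p in lborel. norm (D (fst p) (snd p)) \<le> norm (2 * B * (\<phi> (fst p) * tkern s n (snd p)))"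
      by simp
    show "(\<lambda>p. D (fst p) (snd p)) \<in> borel_measurable lborel" unfolding D_def by measurable
  qed
  have AD: "A x (x + h) = D x h" for x h by (simp add: A_def D_def)
  have A: "integrable lborel (\<lambda>(x, y). A x y)"
  proof (rule integrableI_bounded)
    have "(\<integral>\<^sup>+p. ennreal (norm (case p of (x, y) \<Rightarrow> A x y)) \<partial>lborel)
        = (\<integral>\<^sup>+x. (\<integral>\<^sup>+y. ennreal (norm (A x y)) \<partial>lborel) \<partial>lborel)"
      by (subst nn_integral_lborel_pair(1)) (simp_all add: case_prod_beta')
    also have "\<dots> = (\<integral>\<^sup>+x. (\<integral>\<^sup>+h. ennreal (norm (D x h)) \<partial>lborel) \<partial>lborel)"
    proof (rule nn_integral_cong)
      fix x :: 'a
      have "(\<lambda>y. ennreal (norm (A x y))) \<in> borel_measurable borel" unfolding A_def by measurable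
      from nn_integral_lborel_measure_preserving[OF _ lborel_distr_plus this, of x]
      show "(\<integral>\<^sup>+y. ennreal (norm (A x y)) \<partial>lborel) = (\<integral>\<^sup>+h. ennreal (norm (D x h)) \<partial>lborel)"
        by (simp add: AD)
    qed
    also have "\<dots> = (\<integral>\<^sup>+p. ennreal (norm (case p of (x, y) \<Rightarrow> D x y)) \<partial>lborel)"
      by (subst nn_integral_lborel_pair(1)) (simp_all add: case_prod_beta' D_def)
    also have "\<dots> < \<infinity>" using D by (simp add: integrable_iff_bounded)
    finally show "(\<integral>\<^sup>+p. ennreal (norm (case p of (x, y) \<Rightarrow> A x y)) \<partial>lborel) < \<infinity>" .
  qed (simp add: case_prod_beta')
  have "(LINT (x, y)|lborel. (u x - u y) * (\<phi> x - \<phi> y) * tkern s n (x - y))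
      = (LINT (x, y)|lborel. A x y + A y x)"
  proof -
    have "(u x - u y) * (\<phi> x - \<phi> y) * tkern s n (x - y) = A x y + A y x" for x y
      using tkern_minus[of s n "x - y"] by (simp add: A_def algebra_simps)
    then show ?thesis by simp
  qed
  also have "\<dots> = (LINT (x, y)|lborel. A x y) + (LINT (x, y)|lborel. A y x)"
    using Bochner_Integration.integral_add[OF A integral_swap_lborel(1)[OF A]] by (simp add: case_prod_beta')
  also have "\<dots> = 2 * (LINT (x, y)|lborel. A x y)"
    using integral_swap_lborel(2)[OF A] by simp
  also have "(LINT (x, y)|lborel. A x y) = (LINT x|lborel. LINT y|lborel. A x y)"
    by (rule integral_lborel_pair(1)[OF A])
  also have "\<dots> = (LINT x|lborel. LINT h|lborel. D x h)"
  proof (rule Bochner_Integration.integral_cong[OF refl])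
    fix x :: 'a
    have "A x \<in> borel_measurable borel" unfolding A_def by measurable
    from integral_lborel_shift(1)[OF this, of x]
    show "(LINT y|lborel. A x y) = (LINT h|lborel. D x h)" by (simp add: AD)
  qed
  also have "\<dots> = (LINT h|lborel. LINT x|lborel. D x h)"
    using integral_lborel_pair[OF D] by simp
  also have "\<dots> = (LINT h|lborel. tkern s n h * (LINT x|lborel. \<phi> x * (u x - u (x + h))))"
    by (simp add: D_def)
  finally show ?thesis .
qed

text \<open>The weak form tested with a translated mollifier is a pointwise principal value for the mollified
function. Removing the truncation is dominated convergence, with the two finite energies as
majorant.\<close>

lemma energy_eq_limit_tlap:
  fixes u \<eta> :: "'a::euclidean_space \<Rightarrow> real"
  assumes s: "0 < s" "s < 1" and c: "0 < c" and u: "u \<in> Ds_space c s"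
    and B: "\<And>x. \<bar>u x\<bar> \<le> B"
    and \<phi>: "(\<lambda>x. \<eta> (x - z)) \<in> Cc_infinity U"
  shows "(\<lambda>n. c * tlap s n (mollify \<eta> u) z) \<longlonglongrightarrow> energy c s u (\<lambda>x. \<eta> (x - z))"
proof -
  define \<phi> where "\<phi> x = \<eta> (x - z)" for x
  have \<phi>C: "\<phi> \<in> Cc_infinity U" using \<phi> by (simp add: \<phi>_def[abs_def])
  have [measurable]: "u \<in> borel_measurable borel" using u by (simp add: Ds_space_def)
  have [measurable]: "\<phi> \<in> borel_measurable borel" by (rule Cc_infinity_measurable[OF \<phi>C])
  have \<phi>I: "integrable lborel \<phi>" by (rule Cc_infinity_integrable[OF \<phi>C])
  define g where "g p = (u (fst p) - u (snd p)) * (\<phi> (fst p) - \<phi> (snd p)) * kern s (fst p - snd p)" for p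
  define gn where "gn n p = (u (fst p) - u (snd p)) * (\<phi> (fst p) - \<phi> (snd p)) * tkern s n (fst p - snd p)" for n p
  have dom: "integrable lborel (\<lambda>p. (u (fst p) - u (snd p))\<^sup>2 * kern s (fst p - snd p)
      + (\<phi> (fst p) - \<phi> (snd p))\<^sup>2 * kern s (fst p - snd p))"
    using Ds_space_energy_integrable[OF s c u] Cc_infinity_energy_integrable[OF s \<phi>C]
    by (simp add: case_prod_beta')
  have young: "\<bar>a * b * k\<bar> \<le> a\<^sup>2 * l + b\<^sup>2 * l" if "0 \<le> k" "k \<le> l" for a b k l :: real
  proof -
    have "\<bar>a * b\<bar> \<le> a\<^sup>2 + b\<^sup>2" using sum_squares_bound[of "\<bar>a\<bar>" "\<bar>b\<bar>"] mult_nonneg_nonneg[of "\<bar>a\<bar>" "\<bar>b\<bar>"]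
      by (simp add: abs_mult del: mult_nonneg_nonneg)
    then have "\<bar>a * b\<bar> * k \<le> (a\<^sup>2 + b\<^sup>2) * l" using that by (intro mult_mono) auto
    then show ?thesis using that by (simp add: abs_mult algebra_simps)
  qed
  have "(\<lambda>n. LINT p|lborel. gn n p) \<longlonglongrightarrow> (LINT p|lborel. g p)"
  proof (rule integral_dominated_convergence[OF _ _ dom])
    show "AE p in lborel. (\<lambda>n. gn n p) \<longlonglongrightarrow> g p"
    proof (rule AE_I2)
      fix p :: "'a \<times> 'a"
      show "(\<lambda>n. gn n p) \<longlonglongrightarrow> g p"
        unfolding gn_def g_def
        by (cases "fst p = snd p") (auto intro!: tendsto_intros tkern_LIMSEQ)
    qed
    show "AE p in lborel. norm (gn n p) \<le> (u (fst p) - u (snd p))\<^sup>2 * kern s (fst p - snd p)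
      + (\<phi> (fst p) - \<phi> (snd p))\<^sup>2 * kern s (fst p - snd p)" for n
      unfolding gn_def real_norm_def by (intro AE_I2 young tkern_nonneg tkern_le_kern)
  qed (unfold gn_def g_def, measurable)
  moreover have "c / 2 * (LINT p|lborel. gn n p) = c * tlap s n (mollify \<eta> u) z" for n
  proof -
    have "(LINT x|lborel. \<phi> x * (u x - u (x + h))) = mollify \<eta> u z - mollify \<eta> u (z + h)" for h
    proof -
      have "(LINT x|lborel. \<phi> x * (u x - u (x + h))) = (LINT x|lborel. \<phi> x * u x) - (LINT x|lborel. \<phi> x * u (x + h))"
      proof -
        have *: "integrable lborel (\<lambda>x. \<phi> x * w x)" if [measurable]: "w \<in> borel_measurable borel" and w: "\<And>x. \<bar>w x\<bar> \<le> B" for w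
        proof (rule Bochner_Integration.integrable_bound)
          show "integrable lborel (\<lambda>x. B * \<phi> x)" using \<phi>I by simp
          show "AE x in lborel. norm (\<phi> x * w x) \<le> norm (B * \<phi> x)"
            using w by (intro AE_I2) (auto simp: abs_mult mult.commute[of "\<bar>\<phi> _\<bar>"] intro!: mult_right_mono order_trans[OF w])
        qed measurable
        show ?thesis
          unfolding right_diff_distrib by (intro Bochner_Integration.integral_diff *) (auto simp: B)
      qed
      moreover have "(LINT x|lborel. \<phi> x * u (x + k)) = mollify \<eta> u (z + k)" for k
      proof -
        have "(\<lambda>x. \<phi> x * u (x + k)) \<in> borel_measurable borel" by measurable
        from integral_lborel_shift(1)[OF this, of z] show ?thesis
          by (simp add: mollify_def \<phi>_def add_ac)
      qed
      from this[of 0] this[of h] calculation show ?thesis by simp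
    qed
    then show ?thesis
      using truncated_energy[where n = n and u = u, OF s(1) _ B \<phi>I] by (simp add: gn_def tlap_def case_prod_beta')
  qed
  ultimately have "(\<lambda>n. c * tlap s n (mollify \<eta> u) z) \<longlonglongrightarrow> c / 2 * (LINT p|lborel. g p)"
    using tendsto_mult_left[of "\<lambda>n. LINT p|lborel. gn n p" _ sequentially "c / 2"] by (simp only:)
  then show ?thesis by (simp add: energy_kern g_def \<phi>_def case_prod_beta')
qed

section \<open>Smooth mollifiers\<close>

lemma Ck_SucI:
  assumes "\<And>x. (f has_derivative f' x) (at x)" and "\<And>v. Ck k (\<lambda>x. f' x v)"
  shows "Ck (Suc k) f"
proof -
  have "frechet_derivative f (at x) = f' x" for x
    using assms(1) frechet_derivative_at by metis
  moreover have "f differentiable_on UNIV"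
    using assms(1) by (auto simp: differentiable_on_def differentiable_def)
  ultimately show ?thesis using assms(2) by simp
qed

lemma Ck_SucD: "Ck (Suc k) f \<Longrightarrow> Ck k f"
proof (induction k arbitrary: f)
  case 0 then show ?case by (simp add: differentiable_imp_continuous_on)
next
  case (Suc k) then show ?case by (metis Ck.simps(2))
qed

lemma Ck_const: "Ck k (\<lambda>x :: 'a::euclidean_space. a)"
proof (induction k arbitrary: a)
  case (Suc k) show ?case by (rule Ck_SucI[OF has_derivative_const Suc])
qed simp

lemma Ck_has_derivative:
  assumes "Ck (Suc k) f" shows "(f has_derivative frechet_derivative f (at x)) (at x)"
  using assms frechet_derivative_works by (auto simp: differentiable_on_def)

lemma Ck_add: "Ck k f \<Longrightarrow> Ck k g \<Longrightarrow> Ck k (\<lambda>x. f x + g x)"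
proof (induction k arbitrary: f g)
  case 0 then show ?case by (simp add: continuous_on_add)
next
  case (Suc k)
  show ?case
    by (rule Ck_SucI[OF has_derivative_add[OF Ck_has_derivative[OF Suc.prems(1)] Ck_has_derivative[OF Suc.prems(2)]]])
      (use Suc in simp)
qed

lemma Ck_mult: "Ck k f \<Longrightarrow> Ck k g \<Longrightarrow> Ck k (\<lambda>x. f x * g x)"
proof (induction k arbitrary: f g)
  case 0 then show ?case by (simp add: continuous_on_mult)
next
  case (Suc k)
  show ?case
    by (rule Ck_SucI[OF has_derivative_mult[OF Ck_has_derivative[OF Suc.prems(1)] Ck_has_derivative[OF Suc.prems(2)]]])
      (intro Ck_add Suc.IH; use Suc.prems Ck_SucD in auto)
qed

lemma Ck_inner: "Ck k (\<lambda>x :: 'a::euclidean_space. (x - z) \<bullet> v)"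
proof (cases k)
  case (Suc j)
  have "((\<lambda>x. (x - z) \<bullet> v) has_derivative (\<lambda>h. h \<bullet> v)) (at x)" for x
    by (auto intro!: derivative_eq_intros)
  then show ?thesis unfolding Suc by (rule Ck_SucI) (rule Ck_const)
qed (auto intro!: continuous_intros)

text \<open>The classical flat function \<open>exp (-1/t)\<close> together with its multiples by negative powers of \<open>t\<close>: a family
whose derivatives are combinations of its members, so smoothness follows by induction.\<close>

definition flat_exp :: "nat \<Rightarrow> real \<Rightarrow> real" where
  "flat_exp k t = (if 0 < t then exp (- (1 / t)) / t ^ k else 0)"

lemma flat_exp_nonneg: "0 \<le> flat_exp k t" by (simp add: flat_exp_def)

lemma flat_exp_tendsto_0: "flat_exp k \<midarrow>0\<rightarrow> 0"
proof -
  have "(((\<lambda>x. x ^ k / exp x) \<circ> inverse) \<longlongrightarrow> (0::real)) (at_right 0)"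
    unfolding comp_def by (rule filterlim_compose[OF tendsto_power_div_exp_0 filterlim_inverse_at_top_right])
  moreover have "\<forall>\<^sub>F t in at_right 0. ((\<lambda>x. x ^ k / exp x) \<circ> inverse) t = flat_exp k t"
    using eventually_at_right_less[of "0::real"]
    by eventually_elim (simp add: flat_exp_def exp_minus field_simps)
  ultimately have r: "(flat_exp k \<longlongrightarrow> 0) (at_right 0)" using tendsto_cong by fast
  have "\<forall>\<^sub>F t in at_left 0. flat_exp k t = 0"
    using eventually_at_left_real[of "-1" "0::real"] by (auto simp: flat_exp_def elim: eventually_mono)
  then have l: "(flat_exp k \<longlongrightarrow> 0) (at_left 0)" by (rule tendsto_eventually)
  show ?thesis using l r by (rule filterlim_split_at_real)
qed

lemma flat_exp_derivative:
  "(flat_exp k has_real_derivative (flat_exp (k + 2) t - real k * flat_exp (k + 1) t)) (at t)"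
proof -
  consider "t < 0" | "0 < t" | "t = 0" by linarith
  then show ?thesis
  proof cases
    case 1
    have "((\<lambda>_. 0) has_real_derivative 0) (at t)" by simp
    then have "(flat_exp k has_real_derivative 0) (at t)"
      by (rule DERIV_cong_ev[THEN iffD1, rotated -1, OF _ refl _ refl])
        (use eventually_nhds_in_open[of "{..<0}" t] 1 in \<open>auto simp: flat_exp_def elim!: eventually_mono\<close>)
    then show ?thesis using 1 by (simp add: flat_exp_def)
  next
    case 2
    have "((\<lambda>t. exp (- (1 / t)) / t ^ k) has_real_derivative
        ((exp (- (1 / t)) * (1 / t\<^sup>2)) * t ^ k - exp (- (1 / t)) * (real k * t ^ (k - 1))) / (t ^ k * t ^ k)) (at t)"
      using 2 by (auto intro!: derivative_eq_intros simp: power2_eq_square)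
    also have "((exp (- (1 / t)) * (1 / t\<^sup>2)) * t ^ k - exp (- (1 / t)) * (real k * t ^ (k - 1))) / (t ^ k * t ^ k)
        = flat_exp (k + 2) t - real k * flat_exp (k + 1) t"
      using 2 by (cases k) (simp_all add: flat_exp_def field_simps power2_eq_square)
    finally have "((\<lambda>t. exp (- (1 / t)) / t ^ k) has_real_derivative flat_exp (k + 2) t - real k * flat_exp (k + 1) t) (at t)" .
    then show ?thesis
      by (rule DERIV_cong_ev[THEN iffD1, rotated -1, OF _ refl _ refl])
        (use eventually_nhds_in_open[of "{0<..}" t] 2 in \<open>auto simp: flat_exp_def elim!: eventually_mono\<close>)
  next
    case 3
    have "(\<lambda>h. (flat_exp k (0 + h) - flat_exp k 0) / h) = flat_exp (k + 1)"
      by (auto simp: flat_exp_def fun_eq_iff)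
    then have "(flat_exp k has_real_derivative 0) (at 0)"
      using flat_exp_tendsto_0[of "k + 1"] by (simp add: DERIV_def)
    then show ?thesis using 3 by (simp add: flat_exp_def)
  qed
qed

definition bump :: "real \<Rightarrow> 'a::euclidean_space \<Rightarrow> real" where
  "bump r x = flat_exp 0 (1 - (norm x / r)\<^sup>2)"

lemma Ck_flat_exp_quadratic:
  "Ck n (\<lambda>x :: 'a::euclidean_space. flat_exp k (1 - (norm (x - z) / r)\<^sup>2))"
proof (induction n arbitrary: k)
  case 0
  have "continuous_on UNIV (flat_exp k)"
    using flat_exp_derivative DERIV_isCont continuous_at_imp_continuous_on by blast
  then have "continuous_on UNIV (\<lambda>x :: 'a. flat_exp k (1 - ((norm (x - z)) / r)\<^sup>2))"
    by (rule continuous_on_compose2) (cases "r = 0"; auto intro!: continuous_intros)+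
  then show ?case by simp
next
  case (Suc n)
  define q where "q x = 1 - (norm (x - z) / r)\<^sup>2" for x
  define c where "c = 1 / r\<^sup>2"
  have q: "(q has_derivative (\<lambda>v. - 2 * c * ((x - z) \<bullet> v))) (at x)" for x
  proof -
    have "((\<lambda>x. 1 - c * ((x - z) \<bullet> (x - z))) has_derivative (\<lambda>v. - 2 * c * ((x - z) \<bullet> v))) (at x)"
      by (auto intro!: derivative_eq_intros simp: inner_commute algebra_simps)
    moreover have "(\<lambda>x. 1 - c * ((x - z) \<bullet> (x - z))) = q"
      by (auto simp: q_def c_def fun_eq_iff power_divide dot_square_norm)
    ultimately show ?thesis by simp
  qed
  have "((\<lambda>x. flat_exp k (q x)) has_derivative
      (\<lambda>v. (flat_exp (k + 2) (q x) + (- real k) * flat_exp (k + 1) (q x)) * (- 2 * c * ((x - z) \<bullet> v)))) (at x)" for x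
    using has_derivative_compose[OF q flat_exp_derivative[unfolded has_field_derivative_def]] by simp
  then have "Ck (Suc n) (\<lambda>x. flat_exp k (q x))"
  proof (rule Ck_SucI)
    fix v :: 'a
    show "Ck n (\<lambda>x. (flat_exp (k + 2) (q x) + (- real k) * flat_exp (k + 1) (q x)) * (- 2 * c * ((x - z) \<bullet> v)))"
      unfolding q_def by (intro Ck_mult Ck_add Ck_const Ck_inner Suc)
  qed
  then show ?case by (simp add: q_def)
qed

lemma mollifier_exists:
  assumes r: "0 < r"
  shows "\<exists>\<eta> :: 'a::euclidean_space \<Rightarrow> real. (\<forall>x. 0 \<le> \<eta> x) \<and> (\<forall>x. r \<le> norm x \<longrightarrow> \<eta> x = 0) \<and>
    integrable lborel \<eta> \<and> (LINT x|lborel. \<eta> x) = 1 \<and>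
    (\<forall>z U. cball z r \<subseteq> U \<longrightarrow> (\<lambda>x. \<eta> (x - z)) \<in> Cc_infinity U)"
proof -
  have bump0: "bump r x = 0" if "r \<le> norm x" for x :: 'a
  proof -
    have "1 \<le> (norm x / r)\<^sup>2" using that r by (simp add: one_le_power)
    then show ?thesis by (simp add: bump_def flat_exp_def)
  qed
  have smooth: "(\<lambda>x. a * bump r (x - z)) \<in> Cc_infinity U" if "cball z r \<subseteq> U" for a and z :: 'a and U
  proof -
    have sub: "{x. a * bump r (x - z) \<noteq> 0} \<subseteq> cball z r"
      using bump0 by (auto simp: dist_norm norm_minus_commute) (meson linear)
    then have "closure {x. a * bump r (x - z) \<noteq> 0} \<subseteq> cball z r"
      by (simp add: closure_minimal)
    moreover from this have "compact (closure {x. a * bump r (x - z) \<noteq> 0})"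
      by (meson bounded_cball bounded_subset closed_closure compact_eq_bounded_closed)
    moreover have "Ck k (\<lambda>x. a * bump r (x - z))" for k
      unfolding bump_def by (intro Ck_mult Ck_const Ck_flat_exp_quadratic)
    ultimately show ?thesis using that by (auto simp: Cc_infinity_def)
  qed
  have int: "integrable lborel (bump r :: 'a \<Rightarrow> real)"
    using Cc_infinity_integrable[OF smooth[of 0 UNIV 1]] by simp
  have nn: "0 \<le> bump r x" for x :: 'a by (simp add: bump_def flat_exp_nonneg)
  define I where "I = (LINT x|lborel. bump r (x :: 'a))"
  have "0 < exp (- (4 / 3)) * measure lborel (cball (0::'a) (r / 2))"
    using r content_cball_gt_0_iff[of "0::'a" "r/2"] by (simp add: measure_completion)
  also have "\<dots> = (LINT x|lborel. exp (- (4 / 3)) * indicator (cball (0::'a) (r / 2)) x)"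
    by simp
  also have "\<dots> \<le> I"
    unfolding I_def
  proof (rule integral_mono)
    show "integrable lborel (\<lambda>x. exp (- (4 / 3)) * indicator (cball (0::'a) (r / 2)) x :: real)"
      using emeasure_lborel_cball_finite[of "0::'a" "r/2"] by (intro integrable_mult_right) (simp add: integrable_indicator_iff)
    show "exp (- (4 / 3)) * indicator (cball (0::'a) (r / 2)) x \<le> bump r x" for x
    proof (cases "x \<in> cball 0 (r / 2)")
      case True
      then have "norm x / r \<le> 1 / 2" using r by (simp add: field_simps)
      then have "(norm x / r)\<^sup>2 \<le> (1 / 2)\<^sup>2" using r by (intro power_mono) auto
      then have *: "3 / 4 \<le> 1 - (norm x / r)\<^sup>2" by (simp add: power2_eq_square)
      then have "1 / (1 - (norm x / r)\<^sup>2) \<le> 1 / (3 / 4)" by (intro frac_le) auto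
      then show ?thesis using * True by (simp add: bump_def flat_exp_def)
    qed (simp add: nn)
  qed (rule int)
  finally have I: "0 < I" .
  have "(\<lambda>x. (1 / I) * bump r (x - z)) \<in> Cc_infinity U" if "cball z r \<subseteq> U" for z :: 'a and U
    by (rule smooth[OF that])
  then show ?thesis
    using I nn bump0 int by (intro exI[of _ "\<lambda>x. (1 / I) * bump r x"]) (auto simp: I_def[symmetric])
qed

section \<open>Reflections and half-spaces\<close>

definition hrefl :: "'a::euclidean_space \<Rightarrow> real \<Rightarrow> 'a \<Rightarrow> 'a" where
  "hrefl e l x = x + (2 * (l - x \<bullet> e)) *\<^sub>R e"

lemma hrefl_inner: "norm e = 1 \<Longrightarrow> hrefl e l x \<bullet> e = 2 * l - x \<bullet> e"
  by (simp add: hrefl_def inner_simps dot_square_norm)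

lemma hrefl_hrefl [simp]: "norm e = 1 \<Longrightarrow> hrefl e l (hrefl e l x) = x"
  by (simp add: hrefl_def[of e l "hrefl e l x"] hrefl_inner) (simp add: hrefl_def algebra_simps flip: scaleR_add_left)

lemma hrefl_continuous [continuous_intros]:
  "continuous_on A f \<Longrightarrow> continuous_on A (\<lambda>x. hrefl e l (f x))"
  unfolding hrefl_def by (intro continuous_intros)

lemma hrefl_measurable [measurable]: "hrefl e l \<in> borel_measurable borel"
  by (intro borel_measurable_continuous_onI continuous_intros)

lemma hrefl_shift: "hrefl e l (x + h) = hrefl e l x + hrefl e 0 h"
  by (simp add: hrefl_def algebra_simps inner_simps)

text \<open>For \<open>x\<close> and \<open>y\<close> on the same side, the reflected point is farther away, by an amount controlled by the
two distances to the plane.\<close>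

lemma norm_hrefl_diff_sq:
  assumes "norm e = 1"
  shows "(norm (hrefl e l y - x))\<^sup>2 = (norm (y - x))\<^sup>2 + 4 * ((l - x \<bullet> e) * (l - y \<bullet> e))"
proof -
  have ee: "e \<bullet> e = 1" using assms by (simp add: dot_square_norm)
  show ?thesis
    unfolding power2_norm_eq_inner hrefl_def
    by (simp add: inner_simps ee inner_commute algebra_simps power2_eq_square)
qed

lemma norm_hrefl0 [simp]: "norm e = 1 \<Longrightarrow> norm (hrefl e 0 h) = norm h"
  using norm_hrefl_diff_sq[of e 0 h 0] by simp

lemma hrefl_change_level: "hrefl e l x - hrefl e l' x = (2 * (l - l')) *\<^sub>R e"
  by (simp add: hrefl_def algebra_simps)

lemma lborel_distr_hrefl:
  assumes e: "norm e = 1"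
  shows "distr lborel borel (hrefl e l) = lborel"
proof -
  have 0: "distr lborel borel (hrefl e 0) = lborel"
  proof (rule lborel_distr_isometric_involution)
    show "linear (hrefl e 0)" by (rule linearI) (simp_all add: hrefl_def algebra_simps inner_simps)
  qed (use e in auto)
  have "hrefl e l = (+) ((2 * l) *\<^sub>R e) \<circ> hrefl e 0"
    by (simp add: hrefl_def fun_eq_iff algebra_simps)
  then have "distr lborel borel (hrefl e l) = distr (distr lborel borel (hrefl e 0)) borel ((+) ((2 * l) *\<^sub>R e))"
    by (subst distr_distr) auto
  then show ?thesis by (simp add: 0 lborel_distr_plus)
qed

lemma tlap_hrefl:
  assumes e: "norm e = 1" and [measurable]: "V \<in> borel_measurable borel"
  shows "tlap s n (\<lambda>x. V (hrefl e l x)) z = tlap s n V (hrefl e l z)"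
proof -
  have tk: "tkern s n (hrefl e 0 h) = tkern s n h" for h
    using e kern_norm_cong[of "hrefl e 0 h" h] by (simp add: tkern_def indicator_def)
  have "(\<lambda>h. tkern s n h * (V (hrefl e l z) - V (hrefl e l z + h))) \<in> borel_measurable borel" by measurable
  from integral_lborel_measure_preserving(1)[OF hrefl_measurable lborel_distr_hrefl[OF e] this, of 0]
  show ?thesis by (simp add: tlap_def hrefl_shift tk)
qed

lemma tlap_integrable:
  fixes V :: "'a::euclidean_space \<Rightarrow> real"
  assumes s: "0 < s" and [measurable]: "V \<in> borel_measurable borel" and V: "\<And>x. \<bar>V x\<bar> \<le> M"
  shows "integrable lborel (\<lambda>h. tkern s n h * (V z - V (z + h)))"
proof (rule Bochner_Integration.integrable_bound)
  show "integrable lborel (\<lambda>h::'a. (2 * M) * tkern s n h)"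
    by (intro integrable_mult_right tkern_integrable s)
  have "\<bar>V z - V (z + h)\<bar> \<le> 2 * M" for h using V[of z] V[of "z + h"] by linarith
  then show "AE h in lborel. norm (tkern s n h * (V z - V (z + h))) \<le> norm (2 * M * tkern s n h)"
    using V[of z] by (intro AE_I2) (auto simp: abs_mult mult.commute intro!: mult_left_mono)
qed measurable

lemma tlap_diff:
  assumes s: "0 < s"
    and "V \<in> borel_measurable borel" "\<And>x. \<bar>V x\<bar> \<le> M"
    and "W \<in> borel_measurable borel" "\<And>x. \<bar>W x\<bar> \<le> M'"
  shows "tlap s n (\<lambda>x. V x - W x) z = tlap s n V z - tlap s n W z"
proof -
  have "tlap s n V z - tlap s n W z
     = (LINT h|lborel. tkern s n h * (V z - V (z + h)) - tkern s n h * (W z - W (z + h)))"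
    unfolding tlap_def
    using tlap_integrable[OF s assms(2,3)] tlap_integrable[OF s assms(4,5)]
    by (rule Bochner_Integration.integral_diff[symmetric])
  then show ?thesis by (simp add: tlap_def algebra_simps)
qed

lemma tlap_cmult: "tlap s n (\<lambda>x. k * V x) z = k * tlap s n V z"
proof -
  have "tlap s n (\<lambda>x. k * V x) z = (LINT h|lborel. k * (tkern s n h * (V z - V (z + h))))"
    by (simp add: tlap_def algebra_simps)
  then show ?thesis by (simp add: tlap_def)
qed

text \<open>Needed to cut the space into two open half-spaces without caring about the plane between them.\<close>

lemma AE_not_hyperplane:
  assumes "norm e = 1" shows "AE y in lborel. y \<bullet> e \<noteq> l"
proof -
  have "e \<noteq> 0" using assms by auto
  then have "negligible {y. e \<bullet> y = l}" by (intro negligible_hyperplane) simp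
  moreover have "{y. e \<bullet> y = l} \<in> sets borel" by measurable
  ultimately have "{y. e \<bullet> y = l} \<in> null_sets lborel"
    by (simp add: null_sets_completion_iff negligible_iff_null_sets)
  from AE_not_in[OF this] show ?thesis by (simp add: inner_commute)
qed

lemma integral_half_space_fold:
  fixes F :: "'a::euclidean_space \<Rightarrow> real"
  assumes e: "norm e = 1" and F: "integrable lborel F"
  shows "integrable lborel (\<lambda>y. indicator {y. y \<bullet> e < l} y * (F y + F (hrefl e l y)))"
    and "(LINT y|lborel. F y) = (LINT y|lborel. indicator {y. y \<bullet> e < l} y * (F y + F (hrefl e l y)))"
proof -
  let ?S = "{y. y \<bullet> e < l}" and ?T = "{y. l < y \<bullet> e}"
  have [measurable]: "F \<in> borel_measurable borel" using F by auto
  have IS: "integrable lborel (\<lambda>y. indicator A y * F y)" if [measurable]: "A \<in> sets borel" for A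
    using F by (rule Bochner_Integration.integrable_bound) (auto simp: indicator_def intro!: AE_I2)
  have S[measurable]: "?S \<in> sets borel" and T[measurable]: "?T \<in> sets borel" by measurable
  have ind: "indicator ?T (hrefl e l y) = (indicator ?S y :: real)" for y
    using e by (auto simp: indicator_def hrefl_inner)
  have Tm: "(\<lambda>y. indicator ?T y * F y) \<in> borel_measurable borel" by measurable
  note mp = integral_lborel_measure_preserving[OF hrefl_measurable lborel_distr_hrefl[OF e] Tm, of l]
  have I2: "integrable lborel (\<lambda>y. indicator ?S y * F (hrefl e l y))"
    using mp(2) IS[OF T] by (simp add: ind)
  show "integrable lborel (\<lambda>y. indicator ?S y * (F y + F (hrefl e l y)))"
    using Bochner_Integration.integrable_add[OF IS[OF S] I2] by (simp add: algebra_simps)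
  have "(LINT y|lborel. F y) = (LINT y|lborel. indicator ?S y * F y + indicator ?T y * F y)"
  proof (rule integral_cong_AE)
    show "AE y in lborel. F y = indicator ?S y * F y + indicator ?T y * F y"
      using AE_not_hyperplane[OF e, of l] by eventually_elim (auto simp: indicator_def)
  qed measurable
  also have "\<dots> = (LINT y|lborel. indicator ?S y * F y) + (LINT y|lborel. indicator ?T y * F y)"
    by (rule Bochner_Integration.integral_add[OF IS[OF S] IS[OF T]])
  also have "(LINT y|lborel. indicator ?T y * F y) = (LINT y|lborel. indicator ?S y * F (hrefl e l y))"
    using mp(1) by (simp add: ind)
  also have "(LINT y|lborel. indicator ?S y * F y) + (LINT y|lborel. indicator ?S y * F (hrefl e l y))
     = (LINT y|lborel. indicator ?S y * (F y + F (hrefl e l y)))"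
    using Bochner_Integration.integral_add[OF IS[OF S] I2] by (simp add: algebra_simps)
  finally show "(LINT y|lborel. F y) = (LINT y|lborel. indicator ?S y * (F y + F (hrefl e l y)))" .
qed

text \<open>A lower bound for \<open>kern s (y - z) - kern s (hrefl e l y - z)\<close> that depends on the points only through a
bound \<open>M\<close> on their distance and a lower bound \<open>\<nu>\<close> on the product of their distances to the plane. It
therefore survives passage to the limit in \<open>z\<close> and in the plane. The type argument carries the dimension.\<close>

definition gap :: "real \<Rightarrow> 'a::euclidean_space itself \<Rightarrow> real \<Rightarrow> real \<Rightarrow> real" where
  "gap s T M \<nu> = M powr - (real DIM('a) + 2 * s) * (1 - (M\<^sup>2 / (M\<^sup>2 + 4 * \<nu>)) powr ((real DIM('a) + 2 * s) / 2))"

lemma gap_pos: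
  assumes "0 < s" "0 < M" "0 < \<nu>" shows "0 < gap s TYPE('a::euclidean_space) M \<nu>"
proof -
  have q: "0 < M\<^sup>2 / (M\<^sup>2 + 4 * \<nu>)" "M\<^sup>2 / (M\<^sup>2 + 4 * \<nu>) < 1" using assms by (auto simp: add_pos_pos)
  have "(M\<^sup>2 / (M\<^sup>2 + 4 * \<nu>)) powr ((real DIM('a) + 2 * s) / 2) < 1 powr ((real DIM('a) + 2 * s) / 2)"
    using q assms by (intro powr_less_mono2) (auto intro: add_nonneg_pos)
  then show ?thesis using assms by (simp add: gap_def)
qed

text \<open>With \<open>D\<close> and \<open>E\<close> the squared distances of \<open>z\<close> from \<open>y\<close> and its mirror image, the quotient of the kernel values is
a power of \<open>D / E\<close>. As \<open>E\<close> is at least \<open>D + 4 * \<nu>\<close>, the resulting bound on it is largest, and \<open>kern s (y - z)\<close> smallest, when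
\<open>D\<close> has its greatest value \<open>M\<^sup>2\<close>.\<close>

lemma kern_gap:
  fixes y z :: "'a::euclidean_space"
  assumes e: "norm e = 1" and s: "0 < s" and M: "norm (y - z) \<le> M" and \<nu>: "0 < \<nu>" "\<nu> \<le> (l - z \<bullet> e) * (l - y \<bullet> e)"
    and ne: "y \<noteq> z"
  shows "gap s TYPE('a) M \<nu> \<le> kern s (y - z) - kern s (hrefl e l y - z)"
proof -
  let ?b = "real DIM('a) + 2 * s"
  define D where "D = (norm (y - z))\<^sup>2"
  define E where "E = (norm (hrefl e l y - z))\<^sup>2"
  have D: "0 < D" using ne by (simp add: D_def)
  have M0: "0 < M" using M ne by (meson less_le_trans right_minus_eq zero_less_norm_iff)
  have E: "D + 4 * \<nu> \<le> E" using \<nu> by (simp add: E_def D_def norm_hrefl_diff_sq[OF e])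
  have E0: "0 < E" using D E \<nu> by linarith
  have DM: "D \<le> M\<^sup>2" unfolding D_def using M by (intro power_mono) auto
  have half: "2 * - (t / 2) = - t" for t :: real by simp
  have kD: "kern s x = ((norm x)\<^sup>2) powr - (?b / 2)" if "x \<noteq> 0" for x :: 'a
  proof -
    have "((norm x)\<^sup>2) powr - (?b / 2) = (norm x powr 2) powr - (?b / 2)" using that by simp
    also have "\<dots> = norm x powr - ?b" unfolding powr_powr half ..
    finally show ?thesis unfolding kern_def powr_minus_divide[symmetric] by (rule sym)
  qed
  have refl_ne: "hrefl e l y - z \<noteq> 0" using E0 by (auto simp: E_def)
  have b: "0 \<le> ?b / 2" using s by auto
  have "kern s (hrefl e l y - z) = D powr - (?b / 2) * (D / E) powr (?b / 2)"
    using D E0 kD[OF refl_ne] by (simp add: E_def[symmetric] powr_divide powr_minus field_simps)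
  also have "\<dots> \<le> D powr - (?b / 2) * (M\<^sup>2 / (M\<^sup>2 + 4 * \<nu>)) powr (?b / 2)"
  proof (intro mult_left_mono powr_mono2 b)
    have "D * M\<^sup>2 + D * (4 * \<nu>) \<le> M\<^sup>2 * D + M\<^sup>2 * (4 * \<nu>)"
      using DM \<nu> by (intro add_mono mult_right_mono) auto
    also have "\<dots> \<le> M\<^sup>2 * E" using E by (simp add: mult_left_mono flip: distrib_left)
    finally have "D * (M\<^sup>2 + 4 * \<nu>) \<le> M\<^sup>2 * E" by (simp add: distrib_left)
    moreover have "0 < M\<^sup>2 + 4 * \<nu>" using M0 \<nu> by (auto simp: add_pos_pos)
    ultimately show "D / E \<le> M\<^sup>2 / (M\<^sup>2 + 4 * \<nu>)" using E0 by (simp add: divide_simps mult.commute)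
  qed (use D E0 in auto)
  finally have 1: "kern s (hrefl e l y - z) \<le> D powr - (?b / 2) * (M\<^sup>2 / (M\<^sup>2 + 4 * \<nu>)) powr (?b / 2)" .
  have 2: "kern s (y - z) = D powr - (?b / 2)" using kD[of "y - z"] ne by (simp add: D_def)
  have "M powr - ?b = (M powr 2) powr - (?b / 2)" unfolding powr_powr half ..
  also have "\<dots> = (M\<^sup>2) powr - (?b / 2)" using M0 by simp
  also have "\<dots> \<le> D powr - (?b / 2)" using D DM b by (intro powr_mono2') auto
  finally have 3: "M powr - ?b \<le> D powr - (?b / 2)" .
  have "gap s TYPE('a) M \<nu> \<le> D powr - (?b / 2) * (1 - (M\<^sup>2 / (M\<^sup>2 + 4 * \<nu>)) powr (?b / 2))"
    unfolding gap_def
  proof (intro mult_right_mono 3)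
    have "(M\<^sup>2 / (M\<^sup>2 + 4 * \<nu>)) powr (?b / 2) \<le> 1"
      using M0 \<nu> b by (intro powr_le1) (auto simp: divide_simps add_pos_pos)
    then show "0 \<le> 1 - (M\<^sup>2 / (M\<^sup>2 + 4 * \<nu>)) powr (?b / 2)" by simp
  qed
  then show ?thesis using 1 2 by (simp add: algebra_simps)
qed

text \<open>At distance \<open>d\<close> from a plane, the kernel has mass at least \<open>half_space_const\<close> times \<open>d powr - (2 * s)\<close> on the
other side: the ball of radius \<open>d\<close> centred \<open>2 * d\<close> away in the normal direction lies there, and its points
are at distance at most \<open>3 * d\<close>.\<close>

definition half_space_const :: "real \<Rightarrow> 'a::euclidean_space itself \<Rightarrow> real" where
  "half_space_const s T = 3 powr - (real DIM('a) + 2 * s) * unit_ball_vol (real DIM('a))"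

lemma half_space_const_pos: "0 < half_space_const s TYPE('a::euclidean_space)"
  by (simp add: half_space_const_def)

text \<open>The folded form of the operator at a minimum point \<open>z\<close> of an antisymmetric function \<open>V\<close> over the
half-space. For \<open>y\<close> in the half-space, the values at \<open>y\<close> and at its mirror image add up to
\<open>2 * V z * J' - (V y - V z) * (J - J')\<close>, with \<open>J\<close> and \<open>J'\<close> the truncated kernels at the two points. The first part is
estimated on a ball beyond the plane, the second on \<open>S\<close>. The sign of \<open>J - J'\<close> is wrong only where
the cutoff removes \<open>J\<close>, and this small ball around \<open>z\<close> is the error term.\<close>

lemma antisym_min_tlap_le:
  fixes V :: "'a::euclidean_space \<Rightarrow> real"
  assumes e: "norm e = 1" and s: "0 < s"
    and Vm[measurable]: "V \<in> borel_measurable borel" and VB: "\<And>x. \<bar>V x\<bar> \<le> B"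
    and anti: "\<And>x. V (hrefl e l x) = - V x"
    and z: "z \<bullet> e < l" and min: "\<And>y. y \<bullet> e < l \<Longrightarrow> V z \<le> V y" and neg: "V z \<le> 0"
    and S[measurable]: "S \<in> sets borel" "emeasure lborel S < \<infinity>" "\<And>y. y \<in> S \<Longrightarrow> y \<bullet> e < l"
    and th: "0 < \<theta>" "\<And>y. y \<in> S \<Longrightarrow> \<theta> \<le> V y - V z"
    and M: "\<And>y. y \<in> S \<Longrightarrow> norm (y - z) \<le> M"
    and \<nu>: "0 < \<nu>" "\<And>y. y \<in> S \<Longrightarrow> \<nu> \<le> (l - z \<bullet> e) * (l - y \<bullet> e)"
    and n: "1 / real (Suc n) < l - z \<bullet> e"
  shows "tlap s n V z \<le> 2 * V z * (half_space_const s TYPE('a) * (l - z \<bullet> e) powr - (2 * s))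
     - \<theta> * gap s TYPE('a) M \<nu> * measure lborel S
     + (2 * B * (l - z \<bullet> e) powr - (real DIM('a) + 2 * s) + \<theta> * \<bar>gap s TYPE('a) M \<nu>\<bar>)
        * measure lborel (cball z (1 / real (Suc n)))"
proof -
  let ?b = "real DIM('a) + 2 * s" and ?\<Sigma> = "{y. y \<bullet> e < l}"
  define d where "d = l - z \<bullet> e"
  define \<rho> where "\<rho> = 1 / real (Suc n)"
  define g where "g = gap s TYPE('a) M \<nu>"
  define Q where "Q = ball (z + (2 * d) *\<^sub>R e) d"
  define E where "E = 2 * B * d powr - ?b + \<theta> * \<bar>g\<bar>"
  have d: "0 < d" "\<rho> < d" using z n by (auto simp: d_def \<rho>_def)
  have [measurable]: "Q \<in> sets borel" by (simp add: Q_def)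
  define F where "F y = tkern s n (y - z) * (V z - V y)" for y
  have FI: "integrable lborel F" and Feq: "tlap s n V z = (LINT y|lborel. F y)"
  proof -
    have Fm: "F \<in> borel_measurable borel" unfolding F_def by measurable
    show "integrable lborel F"
      using integral_lborel_shift(2)[OF Fm, of z] tlap_integrable[OF s Vm VB, of n z] by (simp add: F_def)
    show "tlap s n V z = (LINT y|lborel. F y)"
      using integral_lborel_shift(1)[OF Fm, of z] by (simp add: F_def tlap_def)
  qed
  have B0: "0 \<le> B" using VB[of z] by simp
  define G where "G y = 2 * V z * ((3 * d) powr - ?b) * indicator Q (hrefl e l y)
      - \<theta> * g * indicator S y + E * indicator (cball z \<rho>) y" for y
  have refl_far: "d < norm (hrefl e l y - z)" "norm (y - z) \<le> norm (hrefl e l y - z)" if y: "y \<bullet> e < l" for y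
  proof -
    have "d < (hrefl e l y - z) \<bullet> e" using y e by (simp add: d_def hrefl_inner inner_diff_left)
    also have "\<dots> \<le> norm (hrefl e l y - z)" using norm_cauchy_schwarz[of "hrefl e l y - z" e] e by simp
    finally show "d < norm (hrefl e l y - z)" .
    have "(norm (y - z))\<^sup>2 \<le> (norm (hrefl e l y - z))\<^sup>2"
      using y z by (simp add: norm_hrefl_diff_sq[OF e])
    then show "norm (y - z) \<le> norm (hrefl e l y - z)" by (rule power2_le_imp_le) simp
  qed
  have ptw: "F y + F (hrefl e l y) \<le> G y" if y: "y \<bullet> e < l" for y
  proof -
    define J where "J = tkern s n (y - z)"
    define J' where "J' = tkern s n (hrefl e l y - z)"
    have J'k: "J' = kern s (hrefl e l y - z)"
      using refl_far(1)[OF y] d by (simp add: J'_def tkern_def \<rho>_def)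
    have FJ: "F y + F (hrefl e l y) = 2 * V z * J' - (V y - V z) * (J - J')"
      by (simp add: F_def J_def[symmetric] J'_def[symmetric] anti algebra_simps)
    have a: "2 * V z * J' \<le> 2 * V z * ((3 * d) powr - ?b) * indicator Q (hrefl e l y)"
    proof (cases "hrefl e l y \<in> Q")
      case True
      have "norm (hrefl e l y - z) \<le> norm ((2 * d) *\<^sub>R e) + norm (hrefl e l y - z - (2 * d) *\<^sub>R e)"
        by (metis add.commute diff_add_cancel norm_triangle_ineq)
      also have "\<dots> \<le> 3 * d" using True d e by (simp add: Q_def dist_norm algebra_simps norm_minus_commute)
      finally have "norm (hrefl e l y - z) powr ?b \<le> (3 * d) powr ?b" using s by (intro powr_mono2) auto
      moreover have "0 < norm (hrefl e l y - z)" using refl_far(1)[OF y] d by linarith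
      ultimately have "(3 * d) powr - ?b \<le> J'"
        unfolding J'k kern_def powr_minus_divide using d by (intro divide_left_mono mult_pos_pos) auto
      then show ?thesis using True neg by (simp add: mult_left_mono_neg)
    next
      case False
      then show ?thesis using neg by (simp add: J'_def mult_nonpos_nonneg)
    qed
    have b: "- ((V y - V z) * (J - J')) \<le> - \<theta> * g * indicator S y + E * indicator (cball z \<rho>) y"
    proof (cases "y \<in> cball z \<rho>")
      case True
      then have "J = 0" by (simp add: J_def tkern_def \<rho>_def dist_norm norm_minus_commute)
      moreover have "J' \<le> d powr - ?b"
        unfolding J'k using refl_far(1)[OF y] d s by (intro kern_le) auto
      moreover have "V y - V z \<le> 2 * B" using VB[of y] VB[of z] by linarith
      ultimately have "- ((V y - V z) * (J - J')) \<le> 2 * B * d powr - ?b"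
        using B0 by (auto simp: J'_def intro!: mult_mono)
      also have "\<dots> \<le> - \<theta> * g * indicator S y + E"
        using th(1) abs_ge_self[of "\<theta> * g"] abs_ge_zero[of "\<theta> * g"] by (auto simp: E_def indicator_def abs_mult)
      finally show ?thesis using True by simp
    next
      case False
      then have far: "\<rho> < norm (y - z)" by (simp add: dist_norm norm_minus_commute)
      then have Jk: "J = kern s (y - z)" by (simp add: J_def tkern_def \<rho>_def)
      have yz: "y \<noteq> z" "0 < norm (y - z)" using far by (auto simp: \<rho>_def)
      have "J' \<le> J"
        unfolding J'k Jk kern_def using refl_far(2)[OF y] yz s
        by (intro divide_left_mono powr_mono2 mult_pos_pos) (auto simp: powr_gt_zero)
      then have nn: "0 \<le> (V y - V z) * (J - J')" using min[OF y] by simp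
      show ?thesis
      proof (cases "y \<in> S")
        case True
        have "g \<le> J - J'" unfolding g_def J'k Jk
          by (rule kern_gap[OF e s M[OF True] \<nu>(1) \<nu>(2)[OF True] yz(1)])
        then have "\<theta> * g \<le> (V y - V z) * (J - J')"
          using th(1) th(2)[OF True] \<open>J' \<le> J\<close> min[OF y]
          by (meson diff_ge_0_iff_ge less_imp_le mult_left_mono mult_right_mono order_trans)
        then show ?thesis using True False by simp
      qed (use nn False in simp)
    qed
    show ?thesis unfolding FJ G_def using a b by linarith
  qed
  \<comment> \<open>Integrate the pointwise bound; off the half-space all three indicators in \<open>G\<close> vanish.\<close>
  have fin: "emeasure lborel Q < \<infinity>" "emeasure lborel (cball z \<rho>) < \<infinity>"
    using emeasure_lborel_ball_finite emeasure_lborel_cball_finite by (auto simp: Q_def)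
  have iQ: "integrable lborel (indicator Q :: 'a \<Rightarrow> real)" using fin by (simp add: integrable_indicator_iff)
  have iQm: "(indicator Q :: 'a \<Rightarrow> real) \<in> borel_measurable borel" by measurable
  note mp = integral_lborel_measure_preserving[OF hrefl_measurable lborel_distr_hrefl[OF e] iQm, of l]
  have i1: "integrable lborel (\<lambda>y. indicator Q (hrefl e l y) :: real)" using mp(2) iQ by simp
  have i2: "integrable lborel (indicator S :: 'a \<Rightarrow> real)" using S by (simp add: integrable_indicator_iff)
  have i3: "integrable lborel (indicator (cball z \<rho>) :: 'a \<Rightarrow> real)" using fin by (simp add: integrable_indicator_iff)
  have GI: "integrable lborel G" unfolding G_def using i1 i2 i3 by simp
  have "(LINT y|lborel. F y) = (LINT y|lborel. indicator ?\<Sigma> y * (F y + F (hrefl e l y)))"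
    by (rule integral_half_space_fold(2)[OF e FI])
  also have "\<dots> \<le> (LINT y|lborel. G y + (E * indicator (cball z \<rho>) y - E * indicator (cball z \<rho>) y))"
  proof (rule integral_mono[OF integral_half_space_fold(1)[OF e FI]])
    show "integrable lborel (\<lambda>y. G y + (E * indicator (cball z \<rho>) y - E * indicator (cball z \<rho>) y))" using GI by simp
    fix y
    show "indicator ?\<Sigma> y * (F y + F (hrefl e l y)) \<le> G y + (E * indicator (cball z \<rho>) y - E * indicator (cball z \<rho>) y)"
    proof (cases "y \<bullet> e < l")
      case True then show ?thesis using ptw by simp
    next
      case False
      have "hrefl e l y \<notin> Q"
      proof
        assume "hrefl e l y \<in> Q"
        then have "norm (hrefl e l y - z - (2 * d) *\<^sub>R e) < d" by (simp add: Q_def dist_norm norm_minus_commute algebra_simps)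
        then have "- d < (hrefl e l y - z - (2 * d) *\<^sub>R e) \<bullet> e"
          using Cauchy_Schwarz_ineq2[of "hrefl e l y - z - (2 * d) *\<^sub>R e" e] e by (simp add: abs_if split: if_splits)
        then have "d < hrefl e l y \<bullet> e - z \<bullet> e" using e by (simp add: inner_diff_left dot_square_norm)
        then show False using False e by (simp add: hrefl_inner d_def)
      qed
      moreover have "y \<notin> cball z \<rho>"
      proof
        assume "y \<in> cball z \<rho>"
        then have "(y - z) \<bullet> e \<le> \<rho>" using norm_cauchy_schwarz[of "y - z" e] e by (simp add: dist_norm norm_minus_commute)
        then show False using False d by (simp add: inner_diff_left d_def)
      qed
      moreover have "y \<notin> S" using False S(3) by blast
      ultimately show ?thesis using False by (simp add: G_def)
    qed
  qed
  also have "\<dots> = (LINT y|lborel. G y)" by simp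
  also have "\<dots> = 2 * V z * ((3 * d) powr - ?b) * measure lborel Q - \<theta> * g * measure lborel S + E * measure lborel (cball z \<rho>)"
    unfolding G_def using i1 i2 i3 mp(1) by simp
  also have "measure lborel Q = unit_ball_vol (real DIM('a)) * d ^ DIM('a)"
    unfolding Q_def using emeasure_ball[of d "z + (2 * d) *\<^sub>R e"] d by (simp add: measure_def)
  also have "2 * V z * ((3 * d) powr - ?b) * (unit_ball_vol (real DIM('a)) * d ^ DIM('a))
      = 2 * V z * (half_space_const s TYPE('a) * d powr - (2 * s))"
  proof -
    have "(3 * d) powr - ?b * d ^ DIM('a) = 3 powr - ?b * (d powr - ?b * d powr real DIM('a))"
      using d by (simp add: powr_mult powr_realpow)
    also have "d powr - ?b * d powr real DIM('a) = d powr - (2 * s)"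
      by (simp add: powr_add[symmetric])
    finally show ?thesis by (simp add: half_space_const_def algebra_simps)
  qed
  finally show ?thesis
    unfolding Feq E_def g_def \<rho>_def d_def .
qed

section \<open>Regularizing the equation\<close>

text \<open>A negative infimum over an open half-space is attained, as the function vanishes on the boundary and
is too large outside a ball.\<close>

lemma half_space_min_attained:
  fixes g :: "'a::euclidean_space \<Rightarrow> real"
  assumes g: "continuous_on UNIV g" and H: "\<And>x. x \<bullet> e = l \<Longrightarrow> g x = 0"
    and q: "q \<bullet> e < l" "g q < - \<mu>" and \<mu>: "0 \<le> \<mu>"
    and far: "\<And>x. x \<bullet> e < l \<Longrightarrow> K < norm x \<Longrightarrow> - \<mu> \<le> g x"
  shows "\<exists>p. p \<bullet> e < l \<and> norm p \<le> K \<and> (\<forall>y. y \<bullet> e < l \<longrightarrow> g p \<le> g y)"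
proof -
  define Z where "Z = cball 0 K \<inter> {x. x \<bullet> e \<le> l}"
  have "closed {x. x \<bullet> e \<le> l}" by (simp add: closed_halfspace_component_le closed_Collect_le continuous_intros)
  then have "compact Z" unfolding Z_def by (intro compact_Int_closed) auto
  moreover have qZ: "q \<in> Z" using q far[of q] by (force simp: Z_def)
  moreover have "continuous_on Z g" using g continuous_on_subset by blast
  ultimately obtain p where p: "p \<in> Z" "\<And>y. y \<in> Z \<Longrightarrow> g p \<le> g y"
    using continuous_attains_inf[of Z g] by blast
  have gp: "g p < - \<mu>" using p(2)[OF qZ] q by linarith
  have "p \<bullet> e \<noteq> l" using gp H[of p] \<mu> by auto
  then have "p \<bullet> e < l" "norm p \<le> K" using p(1) by (auto simp: Z_def)
  moreover have "g p \<le> g y" if "y \<bullet> e < l" for y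
    using p(2)[of y] far[of y] gp that by (cases "norm y \<le> K") (auto simp: Z_def)
  ultimately show ?thesis by blast
qed

lemma mollify_uniform_approx:
  fixes \<eta> w :: "'a::euclidean_space \<Rightarrow> real"
  assumes \<eta>: "\<And>x. 0 \<le> \<eta> x" "\<And>x. r \<le> norm x \<Longrightarrow> \<eta> x = 0" "integrable lborel \<eta>" "(LINT x|lborel. \<eta> x) = 1"
    and w: "w \<in> borel_measurable borel" "\<And>x. \<bar>w x\<bar> \<le> B"
  shows "integrable lborel (\<lambda>x. \<eta> x * w (z + x))"
    and "\<bar>mollify \<eta> w z\<bar> \<le> B"
    and "(\<And>x. norm x < r \<Longrightarrow> \<bar>w (z + x) - t\<bar> \<le> \<epsilon>) \<Longrightarrow> \<bar>mollify \<eta> w z - t\<bar> \<le> \<epsilon>"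
    and "(\<And>x. \<bar>w (z + x) - w (z' + x)\<bar> \<le> \<epsilon>) \<Longrightarrow> \<bar>mollify \<eta> w z - mollify \<eta> w z'\<bar> \<le> \<epsilon>"
proof -
  note [measurable] = w(1) borel_measurable_integrable[OF \<eta>(3)]
  show I: "integrable lborel (\<lambda>x. \<eta> x * w (z + x))" for z
  proof (rule Bochner_Integration.integrable_bound)
    show "integrable lborel (\<lambda>x. B * \<eta> x)" using \<eta>(3) by simp
    show "AE x in lborel. norm (\<eta> x * w (z + x)) \<le> norm (B * \<eta> x)"
    proof (rule AE_I2)
      fix x :: 'a
      have "\<bar>w (z + x)\<bar> \<le> \<bar>B\<bar>" using w(2)[of "z + x"] by linarith
      then have "\<bar>\<eta> x\<bar> * \<bar>w (z + x)\<bar> \<le> \<bar>\<eta> x\<bar> * \<bar>B\<bar>" by (intro mult_left_mono) auto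
      then show "norm (\<eta> x * w (z + x)) \<le> norm (B * \<eta> x)" by (simp add: abs_mult mult.commute)
    qed
  qed measurable
  have key: "\<bar>mollify \<eta> w z - (LINT x|lborel. \<eta> x * g x)\<bar> \<le> \<epsilon>"
    if g: "integrable lborel (\<lambda>x. \<eta> x * g x)" and le: "\<And>x. norm x < r \<Longrightarrow> \<bar>w (z + x) - g x\<bar> \<le> \<epsilon>" for g z \<epsilon>
  proof -
    have "mollify \<eta> w z - (LINT x|lborel. \<eta> x * g x) = (LINT x|lborel. \<eta> x * (w (z + x) - g x))"
      unfolding mollify_def right_diff_distrib using I g by (rule Bochner_Integration.integral_diff[symmetric])
    also have "\<bar>\<dots>\<bar> \<le> (LINT x|lborel. \<bar>\<eta> x * (w (z + x) - g x)\<bar>)"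
      by (rule integral_abs_bound)
    also have "\<dots> \<le> (LINT x|lborel. \<epsilon> * \<eta> x)"
    proof (rule integral_mono)
      show "integrable lborel (\<lambda>x. \<bar>\<eta> x * (w (z + x) - g x)\<bar>)"
        using Bochner_Integration.integrable_diff[OF I[of z] g] by (intro integrable_abs) (simp add: right_diff_distrib)
      show "\<bar>\<eta> x * (w (z + x) - g x)\<bar> \<le> \<epsilon> * \<eta> x" for x
        using \<eta>(1,2)[of x] le[of x] by (cases "norm x < r") (auto simp: abs_mult mult.commute[of \<epsilon>] intro!: mult_left_mono)
    qed (use \<eta>(3) in auto)
    also have "\<dots> = \<epsilon>" using \<eta>(4) by simp
    finally show ?thesis .
  qed
  show "\<bar>mollify \<eta> w z\<bar> \<le> B" using key[of "\<lambda>_. 0" z B] w(2) by simp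
  show "\<bar>mollify \<eta> w z - t\<bar> \<le> \<epsilon>" if "\<And>x. norm x < r \<Longrightarrow> \<bar>w (z + x) - t\<bar> \<le> \<epsilon>"
    using key[of "\<lambda>_. t" z \<epsilon>] that \<eta>(3,4) by simp
  show "\<bar>mollify \<eta> w z - mollify \<eta> w z'\<bar> \<le> \<epsilon>" if "\<And>x. \<bar>w (z + x) - w (z' + x)\<bar> \<le> \<epsilon>"
    using key[OF I[of z'], of z \<epsilon>] that by (simp add: mollify_def)
qed

lemma uniformly_continuous_vanishing_at_infinity:
  fixes u :: "'a::euclidean_space \<Rightarrow> real"
  assumes "continuous_on UNIV u" and "(u \<longlongrightarrow> 0) at_infinity"
  shows "uniformly_continuous_on UNIV u"
  unfolding uniformly_continuous_on_def
proof (intro allI impI)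
  fix \<epsilon> :: real assume \<epsilon>: "0 < \<epsilon>"
  obtain R where R: "\<And>x. R \<le> norm x \<Longrightarrow> \<bar>u x\<bar> < \<epsilon> / 2"
    using tendstoD[OF assms(2), of "\<epsilon> / 2"] \<epsilon> by (auto simp: eventually_at_infinity)
  have "uniformly_continuous_on (cball 0 (R + 1)) u"
    using assms(1) by (intro compact_uniformly_continuous) (auto intro: continuous_on_subset)
  then obtain d where d: "0 < d" "\<And>x y. norm x \<le> R + 1 \<Longrightarrow> norm y \<le> R + 1 \<Longrightarrow> dist y x < d \<Longrightarrow> dist (u y) (u x) < \<epsilon>"
    using \<epsilon> unfolding uniformly_continuous_on_def by (metis mem_cball_0)
  have "dist (u y) (u x) < \<epsilon>" if "dist y x < min d 1" for x y
  proof (cases "norm x \<le> R + 1 \<and> norm y \<le> R + 1")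
    case False
    have "norm x \<le> norm y + dist y x" "norm y \<le> norm x + dist y x"
      by (metis add.commute dist_norm norm_minus_commute norm_triangle_sub)+
    then have "R \<le> norm x" "R \<le> norm y" using False that by linarith+
    then show ?thesis using R[of x] R[of y] by (simp add: dist_real_def)
  qed (use d that in auto)
  then show "\<exists>d>0. \<forall>x\<in>UNIV. \<forall>x'\<in>UNIV. dist x' x < d \<longrightarrow> dist (u x') (u x) < \<epsilon>"
    using d(1) by (intro exI[of _ "min d 1"]) auto
qed

lemma locally_lipschitz_continuous:
  assumes "locally_lipschitz f" shows "continuous_on UNIV f"
proof (rule continuous_at_imp_continuous_on, rule ballI)
  fix t
  obtain r L where r: "0 < r" "L-lipschitz_on (cball t r) f"
    using assms unfolding locally_lipschitz_def by blast
  have "continuous_on (ball t r) f"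
    by (rule continuous_on_subset[OF lipschitz_on_continuous_on[OF r(2)]]) auto
  then show "isCont f t" using r(1) by (simp add: continuous_on_eq_continuous_at)
qed

text \<open>Here \<open>nonneg\<close> and \<open>le_peak\<close> hold at \<open>x\<^sub>0\<close> too, as \<open>0 < a\<close> is the value there.\<close>

locale decaying_solution =
  fixes s c a :: real and f :: "real \<Rightarrow> real" and u :: "'a::euclidean_space \<Rightarrow> real" and x\<^sub>0 :: 'a
  assumes s: "0 < s" "s < 1" and c: "0 < c" and a: "0 < a"
    and f_lip: "locally_lipschitz f"
    and sol: "weak_solution c s (UNIV - {x\<^sub>0}) (\<lambda>x. f (u x)) u"
    and cont: "continuous_on UNIV u"
    and peak: "u x\<^sub>0 = a"
    and nonneg: "0 \<le> u x" and le_peak: "u x \<le> a"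
    and decay: "(u \<longlongrightarrow> 0) at_infinity"
begin

lemma u_measurable [measurable]: "u \<in> borel_measurable borel"
  using cont by (rule borel_measurable_continuous_onI)

lemma u_uniform: "uniformly_continuous_on UNIV u"
  using cont decay by (rule uniformly_continuous_vanishing_at_infinity)

lemma f_cont: "continuous_on UNIV f"
  using f_lip by (rule locally_lipschitz_continuous)

lemma fu_cont: "continuous_on UNIV (\<lambda>x. f (u x))"
  using continuous_on_compose2[OF f_cont cont] by simp

lemma fu_uniform: "uniformly_continuous_on UNIV (\<lambda>x. f (u x))"
proof -
  have "uniformly_continuous_on {0..a} f"
    using f_cont by (intro compact_uniformly_continuous) (auto intro: continuous_on_subset)
  moreover have "range u \<subseteq> {0..a}" using nonneg le_peak by auto
  ultimately have "uniformly_continuous_on (range u) f"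
    unfolding uniformly_continuous_on_def by (meson subsetD)
  from uniformly_continuous_on_compose[OF u_uniform this] show ?thesis by simp
qed

lemma fu_bounded: obtains B where "\<And>x. \<bar>f (u x)\<bar> \<le> B"
proof -
  have "bounded (f ` {0..a})"
    using f_cont by (intro compact_imp_bounded compact_continuous_image) (auto intro: continuous_on_subset)
  then obtain B where "\<forall>t\<in>{0..a}. \<bar>f t\<bar> \<le> B" by (auto simp: bounded_iff)
  then have "\<bar>f (u x)\<bar> \<le> B" for x using nonneg le_peak by simp
  then show thesis by (rule that)
qed

lemma mollified_equation:
  assumes r: "norm (z - x\<^sub>0) > r" and \<eta>: "\<And>x. r \<le> norm x \<Longrightarrow> \<eta> x = 0"
    and smooth: "\<And>z U. cball z r \<subseteq> U \<Longrightarrow> (\<lambda>x. \<eta> (x - z)) \<in> Cc_infinity U"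
  shows "(\<lambda>n. c * tlap s n (mollify \<eta> u) z) \<longlonglongrightarrow> mollify \<eta> (\<lambda>x. f (u x)) z"
proof -
  have test: "(\<lambda>x. \<eta> (x - z)) \<in> Cc_infinity (UNIV - {x\<^sub>0})"
    using r by (intro smooth) (auto simp: dist_norm)
  have Ds: "u \<in> Ds_space c s" using sol by (simp add: weak_solution_def)
  have "energy c s u (\<lambda>x. \<eta> (x - z)) = (LINT x:UNIV - {x\<^sub>0}|lborel. f (u x) * \<eta> (x - z))"
    using sol test by (auto simp: weak_solution_def)
  also have "\<dots> = (LINT x|lborel. f (u x) * \<eta> (x - z))"
    unfolding set_lebesgue_integral_def
    using \<eta>[of "x\<^sub>0 - z"] r by (intro Bochner_Integration.integral_cong) (auto simp: indicator_def norm_minus_commute)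
  also have "\<dots> = mollify \<eta> (\<lambda>x. f (u x)) z"
  proof -
    have [measurable]: "(\<lambda>x. f (u x)) \<in> borel_measurable borel" "(\<lambda>x. \<eta> (x - z)) \<in> borel_measurable borel"
      using fu_cont test by (auto intro: borel_measurable_continuous_onI Cc_infinity_measurable)
    have "(\<lambda>x. f (u x) * \<eta> (x - z)) \<in> borel_measurable borel" by measurable
    from integral_lborel_shift(1)[OF this, of z] show ?thesis
      by (simp add: mollify_def mult.commute)
  qed
  finally have "energy c s u (\<lambda>x. \<eta> (x - z)) = mollify \<eta> (\<lambda>x. f (u x)) z" .
  moreover have "\<bar>u x\<bar> \<le> a" for x using nonneg le_peak by simp
  ultimately show ?thesis using energy_eq_limit_tlap[OF s c Ds _ test, of a] by simp
qed

text \<open>All that is used of the equation from here on: continuous approximations \<open>U k\<close> which satisfy a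
pointwise equation away from \<open>x\<^sub>0\<close>, with a right-hand side that converges uniformly.\<close>

lemma regularization:
  "\<exists>U F. uniform_limit UNIV U u sequentially \<and> uniform_limit UNIV F (\<lambda>x. f (u x)) sequentially \<and>
     (\<forall>k. continuous_on UNIV (U k)) \<and> (\<forall>k x. \<bar>U k x\<bar> \<le> a) \<and>
     (\<forall>k z. 1 / real (Suc k) < norm (z - x\<^sub>0) \<longrightarrow> (\<lambda>n. c * tlap s n (U k) z) \<longlonglongrightarrow> F k z)"
proof -
  have "\<forall>k. \<exists>\<eta> :: 'a \<Rightarrow> real. (\<forall>x. 0 \<le> \<eta> x) \<and> (\<forall>x. 1 / real (Suc k) \<le> norm x \<longrightarrow> \<eta> x = 0) \<and>
    integrable lborel \<eta> \<and> (LINT x|lborel. \<eta> x) = 1 \<and>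
    (\<forall>z U. cball z (1 / real (Suc k)) \<subseteq> U \<longrightarrow> (\<lambda>x. \<eta> (x - z)) \<in> Cc_infinity U)"
    by (intro allI mollifier_exists) simp
  then obtain \<eta> :: "nat \<Rightarrow> 'a \<Rightarrow> real" where \<eta>: "\<And>k x. 0 \<le> \<eta> k x" "\<And>k x. 1 / real (Suc k) \<le> norm x \<Longrightarrow> \<eta> k x = 0"
    "\<And>k. integrable lborel (\<eta> k)" "\<And>k. (LINT x|lborel. \<eta> k x) = 1"
    "\<And>k z U. cball z (1 / real (Suc k)) \<subseteq> U \<Longrightarrow> (\<lambda>x. \<eta> k (x - z)) \<in> Cc_infinity U"
    by metis
  have ub: "\<bar>u x\<bar> \<le> a" for x using nonneg le_peak by simp
  obtain B where B: "\<And>x. \<bar>f (u x)\<bar> \<le> B" using fu_bounded by blast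
  have lim: "uniform_limit UNIV (\<lambda>k. mollify (\<eta> k) w) w sequentially"
    if w: "uniformly_continuous_on UNIV w" "\<And>x. \<bar>w x\<bar> \<le> B" for w B
  proof (rule uniform_limitI)
    fix \<epsilon> :: real assume \<epsilon>: "0 < \<epsilon>"
    obtain d where d: "0 < d" "\<And>x y. dist x y < d \<Longrightarrow> dist (w x) (w y) < \<epsilon> / 2"
      using w(1) \<epsilon> unfolding uniformly_continuous_on_def by (metis UNIV_I half_gt_zero)
    have wm: "w \<in> borel_measurable borel"
      using w(1) by (intro borel_measurable_continuous_onI uniformly_continuous_imp_continuous)
    obtain k0 where k0: "inverse (real (Suc k0)) < d" using reals_Archimedean d(1) by blast
    have "dist (mollify (\<eta> k) w x) (w x) < \<epsilon>" if "k0 \<le> k" for k x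
    proof -
      have "1 / real (Suc k) \<le> 1 / real (Suc k0)" using that by (simp add: frac_le)
      then have kd: "1 / real (Suc k) < d" using k0 by (simp add: inverse_eq_divide)
      have "\<bar>mollify (\<eta> k) w x - w x\<bar> \<le> \<epsilon> / 2"
      proof (rule mollify_uniform_approx(3)[OF \<eta>(1-4) wm w(2)])
        fix h :: 'a assume "norm h < 1 / real (Suc k)"
        then have "dist (x + h) x < d" using kd by (simp add: dist_norm)
        from d(2)[OF this] show "\<bar>w (x + h) - w x\<bar> \<le> \<epsilon> / 2" by (simp add: dist_real_def)
      qed
      then show ?thesis using \<epsilon> by (simp add: dist_real_def)
    qed
    then show "\<forall>\<^sub>F k in sequentially. \<forall>x\<in>UNIV. dist (mollify (\<eta> k) w x) (w x) < \<epsilon>"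
      by (auto simp: eventually_sequentially)
  qed
  have mcont: "continuous_on UNIV (mollify (\<eta> k) u)" for k
    unfolding continuous_on_iff
  proof (intro ballI allI impI)
    fix x :: 'a and \<epsilon> :: real assume \<epsilon>: "0 < \<epsilon>"
    obtain d where d: "0 < d" "\<And>x y. dist x y < d \<Longrightarrow> dist (u x) (u y) < \<epsilon> / 2"
      using u_uniform \<epsilon> unfolding uniformly_continuous_on_def by (metis UNIV_I half_gt_zero)
    have "dist (mollify (\<eta> k) u y) (mollify (\<eta> k) u x) < \<epsilon>" if "dist y x < d" for y
    proof -
      have "\<bar>u (y + h) - u (x + h)\<bar> \<le> \<epsilon> / 2" for h
        using d(2)[of "y + h" "x + h"] that by (simp add: dist_real_def)
      then have "\<bar>mollify (\<eta> k) u y - mollify (\<eta> k) u x\<bar> \<le> \<epsilon> / 2"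
        by (intro mollify_uniform_approx(4)[OF \<eta>(1-4) u_measurable ub])
      then show ?thesis using \<epsilon> by (simp add: dist_real_def)
    qed
    then show "\<exists>d>0. \<forall>x'\<in>UNIV. dist x' x < d \<longrightarrow> dist (mollify (\<eta> k) u x') (mollify (\<eta> k) u x) < \<epsilon>"
      using d(1) by blast
  qed
  have "\<bar>mollify (\<eta> k) u x\<bar> \<le> a" for k x by (rule mollify_uniform_approx(2)[OF \<eta>(1-4) u_measurable ub])
  moreover have "(\<lambda>n. c * tlap s n (mollify (\<eta> k) u) z) \<longlonglongrightarrow> mollify (\<eta> k) (\<lambda>x. f (u x)) z"
    if "1 / real (Suc k) < norm (z - x\<^sub>0)" for k z
    by (rule mollified_equation[OF that \<eta>(2) \<eta>(5)])
  ultimately show ?thesis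
    using lim[OF u_uniform ub] lim[OF fu_uniform B] mcont
    by (intro exI[of _ "\<lambda>k. mollify (\<eta> k) u"] exI[of _ "\<lambda>k. mollify (\<eta> k) (\<lambda>x. f (u x))"]) blast
qed

end

section \<open>The inequality at a contact point\<close>

lemma measure_small_cball_tendsto_0:
  "(\<lambda>n. measure lborel (cball (z :: 'a::euclidean_space) (1 / real (Suc n)))) \<longlonglongrightarrow> 0"
proof -
  have "measure lborel (cball z (1 / real (Suc n))) = unit_ball_vol (real DIM('a)) * (1 / real (Suc n)) ^ DIM('a)" for n
    using emeasure_cball[of "1 / real (Suc n)" z] by (simp add: measure_def)
  moreover have "(\<lambda>n. unit_ball_vol (real DIM('a)) * (1 / real (Suc n)) ^ DIM('a)) \<longlonglongrightarrow> unit_ball_vol (real DIM('a)) * 0 ^ DIM('a)"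
    by (intro tendsto_intros LIMSEQ_Suc[OF lim_1_over_n])
  ultimately show ?thesis by (simp add: zero_power[OF DIM_positive])
qed

context decaying_solution
begin

definition refl_diff :: "'a \<Rightarrow> real \<Rightarrow> 'a \<Rightarrow> real" where
  "refl_diff e l x = u (hrefl e l x) - u x"

lemma refl_diff_continuous: "continuous_on UNIV (refl_diff e l)"
  unfolding refl_diff_def
  by (intro continuous_on_diff cont continuous_on_compose2[OF cont] hrefl_continuous continuous_on_id) auto

lemma refl_diff_hrefl: "norm e = 1 \<Longrightarrow> refl_diff e l (hrefl e l x) = - refl_diff e l x"
  by (simp add: refl_diff_def)

lemma norm_hrefl_ge: 
  assumes "norm e = 1" shows "norm x - 2 * \<bar>l\<bar> \<le> norm (hrefl e l x)"
proof -
  have "hrefl e l x = hrefl e 0 x + (2 * l) *\<^sub>R e" by (simp add: hrefl_def algebra_simps)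
  then have "norm (hrefl e 0 x) - norm ((2 * l) *\<^sub>R e) \<le> norm (hrefl e l x)"
    by (metis norm_diff_ineq)
  then show ?thesis using assms by (simp add: abs_mult)
qed

lemma refl_diff_decay:
  assumes e: "norm e = 1" shows "(refl_diff e l \<longlongrightarrow> 0) at_infinity"
proof -
  have "filterlim (hrefl e l) at_infinity at_infinity"
    unfolding filterlim_at_infinity[OF order_refl]
  proof (intro allI impI)
    fix r :: real
    have "r \<le> norm (hrefl e l x)" if "r + 2 * \<bar>l\<bar> \<le> norm x" for x :: 'a
      using norm_hrefl_ge[OF e, of x l] that by linarith
    then show "\<forall>\<^sub>F x in at_infinity. r \<le> norm (hrefl e l (x::'a))"
      by (auto simp: eventually_at_infinity)
  qed
  then have "((\<lambda>x. u (hrefl e l x)) \<longlongrightarrow> 0) at_infinity"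
    by (rule filterlim_compose[OF decay])
  then show ?thesis unfolding refl_diff_def using tendsto_diff[OF _ decay] by force
qed

text \<open>The inequality at a minimum point \<open>p\<close> of \<open>v\<close>, in a form made for limits: the integral over the
half-space is replaced by its lower bound on an arbitrary set \<open>S\<close> where \<open>v\<close> exceeds its minimum. The
factors \<open>2\<close> and the summand \<open>1\<close> leave room for replacing \<open>v\<close> and \<open>p\<close> by approximations.\<close>

definition contact_bound :: "'a \<Rightarrow> real \<Rightarrow> ('a \<Rightarrow> real) \<Rightarrow> 'a \<Rightarrow> real \<Rightarrow> bool" where
  "contact_bound e l v p D \<longleftrightarrow> (\<forall>S \<theta> M \<nu>. S \<in> sets borel \<longrightarrow> emeasure lborel S < \<infinity> \<longrightarrow> 0 < \<theta> \<longrightarrow> 0 < M \<longrightarrow> 0 < \<nu> \<longrightarrow>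
     (\<forall>y\<in>S. y \<bullet> e < l \<and> 2 * \<theta> \<le> v y - v p \<and> norm (y - p) + 1 \<le> M \<and> 2 * \<nu> \<le> (l - p \<bullet> e) * (l - y \<bullet> e)) \<longrightarrow>
     c * (- 2 * v p * (half_space_const s TYPE('a) * (l - p \<bullet> e) powr - (2 * s)) + \<theta> * gap s TYPE('a) M \<nu> * measure lborel S) \<le> D)"

lemma contact_boundD:
  assumes "contact_bound e l v p D" and "S \<in> sets borel" "emeasure lborel S < \<infinity>" "0 < \<theta>" "0 < M" "0 < \<nu>"
    and "\<And>y. y \<in> S \<Longrightarrow> y \<bullet> e < l" "\<And>y. y \<in> S \<Longrightarrow> 2 * \<theta> \<le> v y - v p" "\<And>y. y \<in> S \<Longrightarrow> norm (y - p) + 1 \<le> M"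
      "\<And>y. y \<in> S \<Longrightarrow> 2 * \<nu> \<le> (l - p \<bullet> e) * (l - y \<bullet> e)"
  shows "c * (- 2 * v p * (half_space_const s TYPE('a) * (l - p \<bullet> e) powr - (2 * s)) + \<theta> * gap s TYPE('a) M \<nu> * measure lborel S) \<le> D"
  using assms(1) unfolding contact_bound_def by (elim allE impE) (use assms in auto)

text \<open>The comparison function \<open>\<beta>\<close> touches \<open>refl_diff e l\<close> from below, up to a constant, at a negative minimum
of the difference. Each mollification of the difference has a minimum point over the half-space;
these points stay in a ball and accumulate at a minimum point \<open>p\<close> of \<open>v\<close>. As \<open>p\<close> differs from \<open>x\<^sub>0\<close> and
from its mirror image, the mollified equation holds at the approximating points and at their
reflections, where it is compared with \<open>antisym_min_tlap_le\<close>. The limits are taken first in the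
truncation and then in the mollification.\<close>

lemma touching_inequality:
  assumes e: "norm e = 1" and l: "l \<le> x\<^sub>0 \<bullet> e"
    and \<beta>: "continuous_on UNIV \<beta>" "\<And>x. \<bar>\<beta> x\<bar> \<le> B\<beta>" "(\<beta> \<longlongrightarrow> 0) at_infinity" "\<And>x. \<beta> (hrefl e l x) = - \<beta> x"
    and N: "open N" "\<And>z n. z \<in> N \<Longrightarrow> z \<bullet> e < l \<Longrightarrow> tlap s n \<beta> z \<le> C"
    and v: "\<And>x. v x = refl_diff e l x - \<beta> x"
    and neg: "q \<bullet> e < l" "v q < 0"
    and minN: "\<And>p. p \<bullet> e < l \<Longrightarrow> v p < 0 \<Longrightarrow> (\<And>y. y \<bullet> e < l \<Longrightarrow> v p \<le> v y) \<Longrightarrow> p \<in> N \<and> p \<noteq> hrefl e l x\<^sub>0"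
  shows "\<exists>p. p \<bullet> e < l \<and> v p < 0 \<and> (\<forall>y. y \<bullet> e < l \<longrightarrow> v p \<le> v y) \<and>
     contact_bound e l v p (f (u p) - f (u (hrefl e l p)) + c * C)"
proof -
  obtain U F where U: "uniform_limit UNIV U u sequentially" and F: "uniform_limit UNIV F (\<lambda>x. f (u x)) sequentially"
    and Uc: "\<And>k. continuous_on UNIV (U k)" and Ua: "\<And>k x. \<bar>U k x\<bar> \<le> a"
    and eq: "\<And>k z. 1 / real (Suc k) < norm (z - x\<^sub>0) \<Longrightarrow> (\<lambda>n. c * tlap s n (U k) z) \<longlonglongrightarrow> F k z"
    using regularization by blast
  define V where "V k x = U k (hrefl e l x) - U k x - \<beta> x" for k x
  have vdef: "v = (\<lambda>x. refl_diff e l x - \<beta> x)" using v by blast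
  have vc: "continuous_on UNIV v" unfolding vdef by (intro continuous_on_diff refl_diff_continuous \<beta>)
  have vlim: "(v \<longlongrightarrow> 0) at_infinity"
    unfolding vdef using tendsto_diff[OF refl_diff_decay[OF e] \<beta>(3)] by simp
  have Vc: "continuous_on UNIV (V k)" for k
    unfolding V_def by (intro continuous_on_diff \<beta> Uc continuous_on_compose2[OF Uc] hrefl_continuous continuous_on_id) auto
  \<comment> \<open>Antisymmetry makes \<open>v\<close> and all \<open>V k\<close> vanish on the plane, so minima stay off it.\<close>
  have fixH: "hrefl e l x = x" if "x \<bullet> e = l" for x using that by (simp add: hrefl_def)
  have V_anti: "V k (hrefl e l x) = - V k x" for k x using e \<beta>(4) by (simp add: V_def)
  have VH: "V k x = 0" if "x \<bullet> e = l" for k x using V_anti[of k x] fixH[OF that] by simp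
  have v_anti: "v (hrefl e l x) = - v x" for x using e \<beta>(4) refl_diff_hrefl by (simp add: v)
  have vH: "v x = 0" if "x \<bullet> e = l" for x using v_anti[of x] fixH[OF that] by simp
  have VB: "\<bar>V k x\<bar> \<le> 2 * a + B\<beta>" for k x
    using Ua[of k x] Ua[of k "hrefl e l x"] \<beta>(2)[of x] unfolding V_def by linarith
  have near: "\<forall>\<^sub>F k in sequentially. \<forall>x. \<bar>V k x - v x\<bar> < \<epsilon>" if "0 < \<epsilon>" for \<epsilon>
  proof -
    have "\<forall>\<^sub>F k in sequentially. \<forall>x. dist (U k x) (u x) < \<epsilon> / 2"
      using uniform_limitD[OF U, of "\<epsilon> / 2"] that by simp
    then show ?thesis
    proof eventually_elim
      case (elim k)
      show ?case
      proof
        fix x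
        show "\<bar>V k x - v x\<bar> < \<epsilon>"
          using elim[rule_format, of x] elim[rule_format, of "hrefl e l x"]
          unfolding V_def v refl_diff_def dist_real_def by linarith
      qed
    qed
  qed
  \<comment> \<open>A quarter of the depth at \<open>q\<close> separates the values near the minimum from those outside a ball, also for \<open>V k\<close>.\<close>
  define \<mu> where "\<mu> = - v q / 4"
  have \<mu>: "0 < \<mu>" using neg by (simp add: \<mu>_def)
  obtain K where K: "\<And>x. K \<le> norm x \<Longrightarrow> \<bar>v x\<bar> < \<mu>"
    using tendstoD[OF vlim \<mu>] by (auto simp: eventually_at_infinity)
  have "\<forall>\<^sub>F k in sequentially. \<exists>p. p \<bullet> e < l \<and> norm p \<le> K \<and> (\<forall>y. y \<bullet> e < l \<longrightarrow> V k p \<le> V k y)"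
    using near[OF \<mu>]
  proof eventually_elim
    case (elim k)
    show ?case
    proof (rule half_space_min_attained[OF Vc VH neg(1), where \<mu> = "2 * \<mu>"])
      show "V k q < - (2 * \<mu>)" using elim[rule_format, of q] \<mu> by (simp add: \<mu>_def abs_if split: if_splits)
      show "- (2 * \<mu>) \<le> V k x" if "K < norm x" for x
        using elim[rule_format, of x] K[of x] that by (simp add: abs_if split: if_splits)
    qed (use \<mu> in auto)
  qed
  then obtain k0 where k0: "\<And>k. k0 \<le> k \<Longrightarrow> \<exists>p. p \<bullet> e < l \<and> norm p \<le> K \<and> (\<forall>y. y \<bullet> e < l \<longrightarrow> V k p \<le> V k y)"
    by (auto simp: eventually_sequentially)
  then have "\<forall>k. \<exists>p. p \<bullet> e < l \<and> norm p \<le> K \<and> (\<forall>y. y \<bullet> e < l \<longrightarrow> V (k + k0) p \<le> V (k + k0) y)"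
    by simp
  then obtain P where P: "\<And>k. P k \<bullet> e < l" "\<And>k. norm (P k) \<le> K" "\<And>k y. y \<bullet> e < l \<Longrightarrow> V (k + k0) (P k) \<le> V (k + k0) y"
    by metis
  have "compact (cball (0::'a) K)" by simp
  moreover have "\<forall>k. P k \<in> cball 0 K" using P(2) by simp
  ultimately obtain p r where r: "strict_mono r" and Pr: "(P \<circ> r) \<longlonglongrightarrow> p"
    unfolding compact_def by blast
  define Q where "Q j = P (r j)" for j
  define \<sigma> where "\<sigma> j = r j + k0" for j
  have Qp: "Q \<longlonglongrightarrow> p" using Pr by (simp add: Q_def[abs_def] comp_def)
  have \<sigma>: "filterlim \<sigma> sequentially sequentially"
    unfolding \<sigma>_def[abs_def] by (rule filterlim_subseq) (use r in \<open>auto simp: strict_mono_def\<close>)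
  have Qm: "Q j \<bullet> e < l" "y \<bullet> e < l \<Longrightarrow> V (\<sigma> j) (Q j) \<le> V (\<sigma> j) y" for j y
    using P by (auto simp: Q_def \<sigma>_def)
  have near\<sigma>: "\<forall>\<^sub>F j in sequentially. \<forall>x. \<bar>V (\<sigma> j) x - v x\<bar> < \<epsilon>" if "0 < \<epsilon>" for \<epsilon>
    by (rule eventually_compose_filterlim[OF near[OF that] \<sigma>])
  have VQ: "(\<lambda>j. V (\<sigma> j) (Q j)) \<longlonglongrightarrow> v p"
  proof -
    have "(\<lambda>j. V (\<sigma> j) (Q j) - v (Q j)) \<longlonglongrightarrow> 0"
      unfolding tendsto_iff by (auto elim!: eventually_mono dest!: near\<sigma>)
    moreover have "(\<lambda>j. v (Q j)) \<longlonglongrightarrow> v p"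
      using vc Qp by (simp add: continuous_on_eq_continuous_at isCont_tendsto_compose)
    ultimately show ?thesis using tendsto_add by force
  qed
  have Vy: "(\<lambda>j. V (\<sigma> j) y) \<longlonglongrightarrow> v y" for y
    unfolding tendsto_iff dist_real_def by (auto elim!: eventually_mono dest!: near\<sigma>)
  have pmin: "v p \<le> v y" if "y \<bullet> e < l" for y
    by (rule LIMSEQ_le[OF VQ Vy]) (use Qm(2)[OF that] in auto)
  have pneg: "v p < 0" using pmin[OF neg(1)] neg(2) by linarith
  have "(\<lambda>j. Q j \<bullet> e) \<longlonglongrightarrow> p \<bullet> e" by (intro tendsto_intros Qp)
  then have "p \<bullet> e \<le> l" by (rule LIMSEQ_le_const2) (use Qm(1) in \<open>auto intro: less_imp_le\<close>)
  moreover have "p \<bullet> e \<noteq> l" using vH[of p] pneg by auto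
  ultimately have pl: "p \<bullet> e < l" by simp
  have pN: "p \<in> N" "p \<noteq> hrefl e l x\<^sub>0" using minN[OF pl pneg pmin] by auto
  have px: "p \<noteq> x\<^sub>0" using pl l by auto
  have Rpx: "hrefl e l p \<noteq> x\<^sub>0" using pN(2) e by auto
  have RQ: "(\<lambda>j. hrefl e l (Q j)) \<longlonglongrightarrow> hrefl e l p" unfolding hrefl_def by (intro tendsto_intros Qp)
  have Suc0: "(\<lambda>j. 1 / real (Suc (\<sigma> j))) \<longlonglongrightarrow> 0"
    by (rule filterlim_compose[OF LIMSEQ_Suc[OF lim_1_over_n] \<sigma>])
  have away: "\<forall>\<^sub>F j in sequentially. 1 / real (Suc (\<sigma> j)) < norm (Z j - x\<^sub>0)" if "Z \<longlonglongrightarrow> z" "z \<noteq> x\<^sub>0" for Z z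
  proof -
    have "(\<lambda>j. norm (Z j - x\<^sub>0) - 1 / real (Suc (\<sigma> j))) \<longlonglongrightarrow> norm (z - x\<^sub>0) - 0"
      by (intro tendsto_diff Suc0 tendsto_norm that tendsto_const)
    then have "\<forall>\<^sub>F j in sequentially. 0 < norm (Z j - x\<^sub>0) - 1 / real (Suc (\<sigma> j))"
      by (rule order_tendstoD(1)) (use that(2) in simp)
    then show ?thesis by eventually_elim simp
  qed
  have FQ: "(\<lambda>j. F (\<sigma> j) (Z j)) \<longlonglongrightarrow> f (u z)" if Z: "Z \<longlonglongrightarrow> z" for Z z
  proof -
    have "(\<lambda>j. F (\<sigma> j) (Z j) - f (u (Z j))) \<longlonglongrightarrow> 0"
      unfolding tendsto_iff
    proof (intro allI impI)
      fix \<epsilon> :: real assume "0 < \<epsilon>"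
      then have "\<forall>\<^sub>F k in sequentially. \<forall>x. dist (F k x) (f (u x)) < \<epsilon>"
        using uniform_limitD[OF F, of \<epsilon>] by simp
      then have "\<forall>\<^sub>F j in sequentially. \<forall>x. dist (F (\<sigma> j) x) (f (u x)) < \<epsilon>"
        by (rule eventually_compose_filterlim[OF _ \<sigma>])
      then show "\<forall>\<^sub>F j in sequentially. dist (F (\<sigma> j) (Z j) - f (u (Z j))) 0 < \<epsilon>"
        by eventually_elim (simp add: dist_real_def)
    qed
    moreover have "(\<lambda>j. f (u (Z j))) \<longlonglongrightarrow> f (u z)"
      using fu_cont Z by (simp add: continuous_on_eq_continuous_at isCont_tendsto_compose[of _ "\<lambda>x. f (u x)"])
    ultimately show ?thesis using tendsto_add by force
  qed
  have main: "c * (- 2 * v p * (half_space_const s TYPE('a) * (l - p \<bullet> e) powr - (2 * s)) + \<theta> * gap s TYPE('a) M \<nu> * measure lborel S)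
          \<le> f (u p) - f (u (hrefl e l p)) + c * C"
    if S: "S \<in> sets borel" "emeasure lborel S < \<infinity>" and pos: "0 < \<theta>" "0 < M" "0 < \<nu>"
      and Sy: "\<And>y. y \<in> S \<Longrightarrow> y \<bullet> e < l \<and> 2 * \<theta> \<le> v y - v p \<and> norm (y - p) + 1 \<le> M \<and> 2 * \<nu> \<le> (l - p \<bullet> e) * (l - y \<bullet> e)"
    for S \<theta> M \<nu>
  proof -
    define X where "X j = 2 * V (\<sigma> j) (Q j) * (half_space_const s TYPE('a) * (l - Q j \<bullet> e) powr - (2 * s)) - \<theta> * gap s TYPE('a) M \<nu> * measure lborel S" for j
    have Xlim: "X \<longlonglongrightarrow> 2 * v p * (half_space_const s TYPE('a) * (l - p \<bullet> e) powr - (2 * s)) - \<theta> * gap s TYPE('a) M \<nu> * measure lborel S"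
      unfolding X_def by (intro tendsto_intros VQ Qp) (use pl in auto)
    \<comment> \<open>Half of the slack in \<open>contact_bound\<close> absorbs the passage from \<open>v\<close>, \<open>p\<close> to their approximations.\<close>
    have e1: "\<forall>\<^sub>F j in sequentially. Q j \<in> N" using Qp N(1) pN(1) by (simp add: topological_tendstoD)
    have e2: "\<forall>\<^sub>F j in sequentially. dist (Q j) p < 1" using tendstoD[OF Qp, of 1] by simp
    have e3: "\<forall>\<^sub>F j in sequentially. (l - p \<bullet> e) / 2 < l - Q j \<bullet> e"
    proof -
      have "(\<lambda>j. l - Q j \<bullet> e) \<longlonglongrightarrow> l - p \<bullet> e" by (intro tendsto_intros Qp)
      then show ?thesis using pl by (intro order_tendstoD(1)) auto
    qed
    have e4: "\<forall>\<^sub>F j in sequentially. V (\<sigma> j) (Q j) < 0" using order_tendstoD(2)[OF VQ pneg] .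
    have e5: "\<forall>\<^sub>F j in sequentially. \<forall>x. \<bar>V (\<sigma> j) x - v x\<bar> < \<theta> / 2" using pos by (intro near\<sigma>) auto
    have "\<forall>\<^sub>F j in sequentially. F (\<sigma> j) (hrefl e l (Q j)) - F (\<sigma> j) (Q j) \<le> c * X j + c * C"
      using e1 e2 e3 e4 e5 away[OF Qp px] away[OF RQ Rpx]
    proof eventually_elim
      case (elim j)
      let ?z = "Q j" and ?V = "V (\<sigma> j)" and ?U = "U (\<sigma> j)"
      have Vm: "?V \<in> borel_measurable borel" and Um[measurable]: "?U \<in> borel_measurable borel" and \<beta>m: "\<beta> \<in> borel_measurable borel"
        using Vc Uc \<beta>(1) by (auto intro: borel_measurable_continuous_onI)
      have split: "tlap s n ?V ?z = tlap s n ?U (hrefl e l ?z) - tlap s n ?U ?z - tlap s n \<beta> ?z" for n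
      proof -
        have RUm: "(\<lambda>x. ?U (hrefl e l x)) \<in> borel_measurable borel" by measurable
        have "tlap s n ?V ?z = tlap s n (\<lambda>x. ?U (hrefl e l x) - ?U x) ?z - tlap s n \<beta> ?z"
          unfolding V_def
        proof (rule tlap_diff[OF s(1) _ _ \<beta>m \<beta>(2)])
          show "\<bar>?U (hrefl e l x) - ?U x\<bar> \<le> 2 * a" for x
            using Ua[of "\<sigma> j" x] Ua[of "\<sigma> j" "hrefl e l x"] by linarith
        qed measurable
        also have "tlap s n (\<lambda>x. ?U (hrefl e l x) - ?U x) ?z = tlap s n (\<lambda>x. ?U (hrefl e l x)) ?z - tlap s n ?U ?z"
          by (rule tlap_diff[OF s(1) RUm _ Um Ua]) (rule Ua)
        also have "tlap s n (\<lambda>x. ?U (hrefl e l x)) ?z = tlap s n ?U (hrefl e l ?z)" by (rule tlap_hrefl[OF e Um])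
        finally show ?thesis .
      qed
      define E where "E = 2 * (2 * a + B\<beta>) * (l - ?z \<bullet> e) powr - (real DIM('a) + 2 * s) + \<theta> * \<bar>gap s TYPE('a) M \<nu>\<bar>"
      have upper: "\<forall>\<^sub>F n in sequentially. c * tlap s n ?U (hrefl e l ?z) - c * tlap s n ?U ?z
          \<le> c * (X j + E * measure lborel (cball ?z (1 / real (Suc n))) + C)"
      proof -
        have "\<forall>\<^sub>F n in sequentially. 1 / real (Suc n) < l - ?z \<bullet> e"
          using order_tendstoD(2)[OF LIMSEQ_Suc[OF lim_1_over_n], of "l - ?z \<bullet> e"] Qm(1)[of j] by simp
        then show ?thesis
        proof eventually_elim
          case (elim n)
          have "tlap s n ?V ?z \<le> X j + E * measure lborel (cball ?z (1 / real (Suc n)))"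
            unfolding X_def E_def
          proof (rule antisym_min_tlap_le[OF e s(1) Vm VB V_anti Qm(1) Qm(2) _ S _ pos(1) _ _ pos(3) _ elim])
            fix y assume y: "y \<in> S"
            show "y \<bullet> e < l" using Sy[OF y] by blast
            have "?V ?z \<le> ?V p" by (rule Qm(2)[OF pl])
            then show "\<theta> \<le> ?V y - ?V ?z"
              using Sy[OF y] \<open>\<forall>x. \<bar>?V x - v x\<bar> < \<theta> / 2\<close>[rule_format, of y] \<open>\<forall>x. \<bar>?V x - v x\<bar> < \<theta> / 2\<close>[rule_format, of p]
              by linarith
            have "norm (y - ?z) \<le> norm (y - p) + norm (?z - p)"
              by (metis dist_norm dist_triangle2)
            then show "norm (y - ?z) \<le> M" using Sy[OF y] \<open>dist ?z p < 1\<close> by (simp add: dist_norm)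
            have "(l - p \<bullet> e) / 2 * (l - y \<bullet> e) \<le> (l - ?z \<bullet> e) * (l - y \<bullet> e)"
              using Sy[OF y] \<open>(l - p \<bullet> e) / 2 < l - ?z \<bullet> e\<close> by (intro mult_right_mono) auto
            moreover have "(l - p \<bullet> e) / 2 * (l - y \<bullet> e) = (l - p \<bullet> e) * (l - y \<bullet> e) / 2" by simp
            ultimately show "\<nu> \<le> (l - ?z \<bullet> e) * (l - y \<bullet> e)" using Sy[OF y] by linarith
          qed (use \<open>?V ?z < 0\<close> in auto)
          moreover have "tlap s n \<beta> ?z \<le> C" by (rule N(2)[OF \<open>?z \<in> N\<close> Qm(1)])
          ultimately have "tlap s n ?U (hrefl e l ?z) - tlap s n ?U ?z \<le> X j + E * measure lborel (cball ?z (1 / real (Suc n))) + C"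
            using split[of n] by linarith
          then show ?case using c by (simp add: right_diff_distrib[symmetric] del: of_nat_Suc)
        qed
      qed
      have L: "(\<lambda>n. c * tlap s n ?U (hrefl e l ?z) - c * tlap s n ?U ?z) \<longlonglongrightarrow> F (\<sigma> j) (hrefl e l ?z) - F (\<sigma> j) ?z"
        using elim by (intro tendsto_diff eq) auto
      have R: "(\<lambda>n. c * (X j + E * measure lborel (cball ?z (1 / real (Suc n))) + C)) \<longlonglongrightarrow> c * (X j + E * 0 + C)"
        by (intro tendsto_intros measure_small_cball_tendsto_0)
      have "F (\<sigma> j) (hrefl e l ?z) - F (\<sigma> j) ?z \<le> c * (X j + E * 0 + C)"
        by (rule tendsto_le[OF _ R L upper]) simp
      then show ?case by (simp add: algebra_simps)
    qed
    then have "f (u (hrefl e l p)) - f (u p) \<le> c * (2 * v p * (half_space_const s TYPE('a) * (l - p \<bullet> e) powr - (2 * s)) - \<theta> * gap s TYPE('a) M \<nu> * measure lborel S) + c * C"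
      by (intro tendsto_le[OF _ tendsto_add[OF tendsto_mult_left[OF Xlim] tendsto_const] tendsto_diff[OF FQ[OF RQ] FQ[OF Qp]]]) auto
    then show ?thesis by (simp add: algebra_simps)
  qed
  have "contact_bound e l v p (f (u p) - f (u (hrefl e l p)) + c * C)"
    unfolding contact_bound_def by (intro allI impI main) auto
  then show ?thesis using pl pneg pmin by blast
qed

end

section \<open>The strong maximum principle\<close>

text \<open>The truncation at \<open>0\<close> destroys smoothness but keeps semiconvexity, and only a bound from above on
the operator is needed.\<close>

definition paraboloid :: "'a::euclidean_space \<Rightarrow> real \<Rightarrow> 'a \<Rightarrow> real" where
  "paraboloid q r x = max 0 (1 - (norm (x - q) / r)\<^sup>2)"

lemma paraboloid_bounds: "0 \<le> paraboloid q r x" "paraboloid q r x \<le> 1" by (simp_all add: paraboloid_def)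

lemma paraboloid_eq_0: "0 < r \<Longrightarrow> r \<le> norm (x - q) \<Longrightarrow> paraboloid q r x = 0"
  by (simp add: paraboloid_def)

lemma paraboloid_continuous: "0 < r \<Longrightarrow> continuous_on UNIV (paraboloid q r)"
  unfolding paraboloid_def by (intro continuous_intros) auto

text \<open>Where the cap is positive, it agrees with the quadratic at the central point and dominates it at the
outer ones, so the parallelogram law gives the bound; where it is \<open>0\<close>, it has its minimum.\<close>

lemma paraboloid_semiconvex:
  assumes r: "0 < r"
  shows "2 * paraboloid q r z - paraboloid q r (z + h) - paraboloid q r (z - h) \<le> 2 * min 1 (1 / r\<^sup>2 * (norm h)\<^sup>2)"
proof -
  have "2 * paraboloid q r z - paraboloid q r (z + h) - paraboloid q r (z - h) \<le> 2 * (1 / r\<^sup>2 * (norm h)\<^sup>2)"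
  proof (cases "paraboloid q r z = 0")
    case True
    then show ?thesis using paraboloid_bounds(1)[of q r "z + h"] paraboloid_bounds(1)[of q r "z - h"]
      by (smt (verit) divide_nonneg_nonneg mult_nonneg_nonneg zero_le_power2)
  next
    case False
    then have z: "paraboloid q r z = 1 - (norm (z - q))\<^sup>2 / r\<^sup>2" by (auto simp: paraboloid_def max_def power_divide)
    have lower: "1 - (norm (x - q))\<^sup>2 / r\<^sup>2 \<le> paraboloid q r x" for x by (simp add: paraboloid_def power_divide)
    have "(norm (z + h - q))\<^sup>2 + (norm (z - h - q))\<^sup>2 = 2 * (norm (z - q))\<^sup>2 + 2 * (norm h)\<^sup>2"
      by (simp add: power2_norm_eq_inner inner_simps inner_commute)
    then have "(norm (z + h - q))\<^sup>2 / r\<^sup>2 + (norm (z - h - q))\<^sup>2 / r\<^sup>2 = 2 * ((norm (z - q))\<^sup>2 / r\<^sup>2) + 2 * (1 / r\<^sup>2 * (norm h)\<^sup>2)"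
      by (simp add: add_divide_distrib[symmetric])
    then show ?thesis using lower[of "z + h"] lower[of "z - h"] z by linarith
  qed
  moreover have "2 * paraboloid q r z - paraboloid q r (z + h) - paraboloid q r (z - h) \<le> 2"
    using paraboloid_bounds(1)[of q r "z + h"] paraboloid_bounds(1)[of q r "z - h"] paraboloid_bounds(2)[of q r z] by linarith
  ultimately show ?thesis by simp
qed

lemma tlap_paraboloid_le:
  fixes q :: "'a::euclidean_space"
  assumes s: "0 < s" "s < 1" and r: "0 < r"
  shows "tlap s n (paraboloid q r) z \<le> (LINT h|lborel. min 1 (1 / r\<^sup>2 * (norm (h::'a))\<^sup>2) * kern s h)"
proof -
  have bm[measurable]: "paraboloid q r \<in> borel_measurable borel"
    using paraboloid_continuous[OF r] by (rule borel_measurable_continuous_onI)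
  have bb: "\<bar>paraboloid q r x\<bar> \<le> 1" for x using paraboloid_bounds[of q r x] by simp
  define g where "g h = tkern s n h * (paraboloid q r z - paraboloid q r (z + h))" for h
  have gi: "integrable lborel g" unfolding g_def by (rule tlap_integrable[OF s(1) bm bb])
  have gm: "g \<in> borel_measurable borel" unfolding g_def by measurable
  have um: "(\<lambda>h::'a. 0 - h) \<in> borel_measurable borel" by measurable
  note mp = integral_lborel_measure_preserving[OF um lborel_distr_reflect_point gm]
  have "2 * tlap s n (paraboloid q r) z = (LINT h|lborel. g h) + (LINT h|lborel. g (0 - h))"
    using mp(1) by (simp add: tlap_def g_def)
  also have "\<dots> = (LINT h|lborel. g h + g (0 - h))"
    using gi mp(2) by (intro Bochner_Integration.integral_add[symmetric]) auto
  also have "\<dots> \<le> (LINT h|lborel. 2 * (min 1 (1 / r\<^sup>2 * (norm (h::'a))\<^sup>2) * kern s h))"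
  proof (rule integral_mono)
    show "integrable lborel (\<lambda>h. g h + g (0 - h))" using gi mp(2) by (intro Bochner_Integration.integrable_add) auto
    show "integrable lborel (\<lambda>h::'a. 2 * (min 1 (1 / r\<^sup>2 * (norm h)\<^sup>2) * kern s h))"
      by (intro integrable_mult_right kern_min_integrable s) auto
    fix h :: 'a
    have "g h + g (0 - h) = tkern s n h * (2 * paraboloid q r z - paraboloid q r (z + h) - paraboloid q r (z - h))"
      by (simp add: g_def algebra_simps)
    also have "\<dots> \<le> tkern s n h * (2 * min 1 (1 / r\<^sup>2 * (norm h)\<^sup>2))"
      by (intro mult_left_mono paraboloid_semiconvex r tkern_nonneg)
    also have "\<dots> \<le> kern s h * (2 * min 1 (1 / r\<^sup>2 * (norm h)\<^sup>2))"
      by (intro mult_right_mono tkern_le_kern) simp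
    finally show "g h + g (0 - h) \<le> 2 * (min 1 (1 / r\<^sup>2 * (norm h)\<^sup>2) * kern s h)"
      by (simp add: mult_ac)
  qed
  finally show ?thesis by simp
qed

text \<open>At a point away from the cap, only jumps of length at least \<open>d\<close> reach it. This controls the mirror
image of a cap, which enters with the opposite sign.\<close>

lemma tlap_paraboloid_ge_far:
  fixes q :: "'a::euclidean_space"
  assumes s: "0 < s" "s < 1" and r: "0 < r" and d: "0 < d" and far: "r + d \<le> norm (z - q)"
  shows "- tlap s n (paraboloid q r) z \<le> (LINT h|lborel. min 1 (1 / d\<^sup>2 * (norm (h::'a))\<^sup>2) * kern s h)"
proof -
  have bm[measurable]: "paraboloid q r \<in> borel_measurable borel"
    using paraboloid_continuous[OF r] by (rule borel_measurable_continuous_onI)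
  have bb: "\<bar>paraboloid q r x\<bar> \<le> 1" for x using paraboloid_bounds[of q r x] by simp
  have "- tlap s n (paraboloid q r) z = (LINT h|lborel. - (tkern s n h * (paraboloid q r z - paraboloid q r (z + h))))"
    by (simp add: tlap_def)
  also have "\<dots> \<le> (LINT h|lborel. min 1 (1 / d\<^sup>2 * (norm (h::'a))\<^sup>2) * kern s h)"
  proof (rule integral_mono)
    show "integrable lborel (\<lambda>h. - (tkern s n h * (paraboloid q r z - paraboloid q r (z + h))))"
      by (intro Bochner_Integration.integrable_minus tlap_integrable[OF s(1) bm bb])
    show "integrable lborel (\<lambda>h::'a. min 1 (1 / d\<^sup>2 * (norm h)\<^sup>2) * kern s h)"
      by (intro kern_min_integrable s) auto
    fix h :: 'a
    have z0: "paraboloid q r z = 0" using far d r by (intro paraboloid_eq_0) auto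
    have "paraboloid q r (z + h) \<le> min 1 (1 / d\<^sup>2 * (norm h)\<^sup>2)"
    proof (cases "d \<le> norm h")
      case True
      then have "d\<^sup>2 \<le> (norm h)\<^sup>2" using d by (intro power_mono) auto
      then show ?thesis using paraboloid_bounds(2)[of q r "z + h"] d by (simp add: divide_simps)
    next
      case False
      have "norm (z - q) \<le> norm (z + h - q) + norm h"
        using norm_triangle_ineq4[of "z + h - q" h] by (simp add: algebra_simps)
      then have "paraboloid q r (z + h) = 0" using far False r by (intro paraboloid_eq_0) auto
      then show ?thesis by simp
    qed
    then have "tkern s n h * paraboloid q r (z + h) \<le> kern s h * min 1 (1 / d\<^sup>2 * (norm h)\<^sup>2)"
      by (intro mult_mono tkern_le_kern) (auto simp: paraboloid_bounds)
    then show "- (tkern s n h * (paraboloid q r z - paraboloid q r (z + h))) \<le> min 1 (1 / d\<^sup>2 * (norm h)\<^sup>2) * kern s h"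
      using z0 by (simp add: mult.commute)
  qed
  finally show ?thesis .
qed

lemma positive_ball:
  fixes w :: "'a::euclidean_space \<Rightarrow> real"
  assumes "continuous_on UNIV w" "y0 \<bullet> e < l" "0 < w y0"
  shows "\<exists>\<epsilon>>0. \<forall>y\<in>ball y0 \<epsilon>. y \<bullet> e < l \<and> w y0 / 2 \<le> w y \<and> (l - y0 \<bullet> e) / 2 \<le> l - y \<bullet> e"
proof -
  have "open {y. w y0 / 2 < w y}" "open {y. (l - y0 \<bullet> e) / 2 < l - y \<bullet> e}"
    using assms(1) by (auto intro!: open_Collect_less continuous_intros)
  then have "open ({y. w y0 / 2 < w y} \<inter> {y. (l - y0 \<bullet> e) / 2 < l - y \<bullet> e})" by (rule open_Int)
  moreover have "y0 \<in> {y. w y0 / 2 < w y} \<inter> {y. (l - y0 \<bullet> e) / 2 < l - y \<bullet> e}" using assms by simp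
  ultimately obtain \<epsilon> where \<epsilon>: "0 < \<epsilon>" "ball y0 \<epsilon> \<subseteq> {y. w y0 / 2 < w y} \<inter> {y. (l - y0 \<bullet> e) / 2 < l - y \<bullet> e}"
    using openE by blast
  have "y \<bullet> e < l \<and> w y0 / 2 \<le> w y \<and> (l - y0 \<bullet> e) / 2 \<le> l - y \<bullet> e" if "y \<in> ball y0 \<epsilon>" for y
  proof -
    have "w y0 / 2 < w y" "(l - y0 \<bullet> e) / 2 < l - y \<bullet> e" using \<epsilon>(2) that by auto
    then show ?thesis using assms(2) by auto
  qed
  then show ?thesis using \<epsilon>(1) by blast
qed

lemma measure_ball_pos: "0 < \<epsilon> \<Longrightarrow> 0 < measure lborel (ball (y0 :: 'a::euclidean_space) \<epsilon>)"
  using emeasure_ball[of \<epsilon> y0] by (simp add: measure_def)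

context decaying_solution
begin

text \<open>Subtract \<open>\<kappa>\<close> times the cap \<open>b\<close> centred at \<open>q\<close>, made antisymmetric. Since \<open>refl_diff\<close> is nonnegative and
\<open>b < 1\<close> off \<open>q\<close>, the point \<open>q\<close> becomes the unique minimum point, with value \<open>- \<kappa>\<close>. There the right-hand side of
the inequality is \<open>O(\<kappa>)\<close>, while the left-hand side stays above a positive constant \<open>A\<close> if \<open>refl_diff\<close> is
positive somewhere. Letting \<open>\<kappa>\<close> tend to \<open>0\<close> gives a contradiction.\<close>

lemma strong_maximum_principle:
  assumes e: "norm e = 1" and l: "l \<le> x\<^sub>0 \<bullet> e"
    and w: "\<And>y. y \<bullet> e < l \<Longrightarrow> 0 \<le> refl_diff e l y"
    and q: "q \<bullet> e < l" "q \<noteq> hrefl e l x\<^sub>0" "refl_diff e l q = 0"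
    and y0: "y0 \<bullet> e < l"
  shows "refl_diff e l y0 = 0"
proof (rule ccontr)
  assume "refl_diff e l y0 \<noteq> 0"
  then have pos: "0 < refl_diff e l y0" using w[OF y0] by simp
  define r where "r = l - q \<bullet> e"
  have r: "0 < r" using q by (simp add: r_def)
  define b where "b = paraboloid q r"
  define C where "C = (LINT h|lborel. min 1 (1 / r\<^sup>2 * (norm (h::'a))\<^sup>2) * kern s h)
      + (LINT h|lborel. min 1 (1 / (r / 2)\<^sup>2 * (norm (h::'a))\<^sup>2) * kern s h)"
  have C0: "0 \<le> C" unfolding C_def by (intro add_nonneg_nonneg integral_nonneg_AE) auto
  have bm: "b \<in> borel_measurable borel" and bc: "continuous_on UNIV b"
    using paraboloid_continuous[OF r, of q] by (auto simp: b_def intro: borel_measurable_continuous_onI)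
  have b01: "0 \<le> b x" "b x \<le> 1" "\<bar>b x\<bar> \<le> 1" for x using paraboloid_bounds[of q r x] by (simp_all add: b_def)
  have bq: "b q = 1" by (simp add: b_def paraboloid_def)
  have b1: "x = q" if "1 \<le> b x" for x
    using that r by (auto simp: b_def paraboloid_def max_def split: if_splits)
  have inner_le: "x \<bullet> e - q \<bullet> e \<le> norm (x - q)" for x
    using norm_cauchy_schwarz[of "x - q" e] e by (simp add: inner_diff_left)
  have bR: "b (hrefl e l x) = 0" if "x \<bullet> e < l" for x
    unfolding b_def using r inner_le[of "hrefl e l x"] that e
    by (intro paraboloid_eq_0) (auto simp: hrefl_inner r_def)
  obtain \<epsilon> where \<epsilon>: "0 < \<epsilon>" "\<And>y. y \<in> ball y0 \<epsilon> \<Longrightarrow> y \<bullet> e < l \<and> refl_diff e l y0 / 2 \<le> refl_diff e l y \<and> (l - y0 \<bullet> e) / 2 \<le> l - y \<bullet> e"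
    using positive_ball[OF refl_diff_continuous y0, of e] pos by blast
  define \<theta> where "\<theta> = refl_diff e l y0 / 4"
  define M where "M = norm (y0 - q) + \<epsilon> + 1"
  define \<nu> where "\<nu> = r * (l - y0 \<bullet> e) / 4"
  have \<theta>: "0 < \<theta>" and M: "0 < M" and \<nu>: "0 < \<nu>"
    using pos \<epsilon>(1) r y0 by (auto simp: \<theta>_def M_def \<nu>_def add_nonneg_pos)
  define A where "A = \<theta> * gap s TYPE('a) M \<nu> * measure lborel (ball y0 \<epsilon>)"
  have A: "0 < A" unfolding A_def
    by (intro mult_pos_pos \<theta> gap_pos s M \<nu> measure_ball_pos \<epsilon>)
  have small: "A \<le> \<kappa> * C" if \<kappa>: "0 < \<kappa>" for \<kappa>
  proof -
    define \<beta> where "\<beta> x = \<kappa> * (b x - b (hrefl e l x))" for x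
    define v where "v x = refl_diff e l x - \<beta> x" for x
    have \<beta>eq: "\<beta> x = \<kappa> * b x" if "x \<bullet> e < l" for x using bR[OF that] by (simp add: \<beta>_def)
    have bRm: "(\<lambda>x. b (hrefl e l x)) \<in> borel_measurable borel" using bm by measurable
    have vq: "v q = - \<kappa>" using q \<beta>eq[OF q(1)] bq by (simp add: v_def)
    have only: "p = q" if p: "p \<bullet> e < l" "\<And>y. y \<bullet> e < l \<Longrightarrow> v p \<le> v y" for p
    proof -
      have "refl_diff e l p - \<kappa> * b p \<le> - \<kappa>" using p(2)[OF q(1)] vq \<beta>eq[OF p(1)] by (simp add: v_def)
      then have "\<kappa> * 1 \<le> \<kappa> * b p" using w[OF p(1)] by simp
      then show ?thesis using \<kappa> b1 by (metis mult_le_cancel_left_pos)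
    qed
    have b_dec: "(b \<longlongrightarrow> 0) at_infinity"
    proof (rule tendsto_eventually)
      have "b x = 0" if "norm q + r \<le> norm x" for x
        unfolding b_def using r norm_triangle_ineq2[of x q] that by (intro paraboloid_eq_0) auto
      then show "\<forall>\<^sub>F x in at_infinity. b x = 0" by (auto simp: eventually_at_infinity)
    qed
    have b_decR: "((\<lambda>x. b (hrefl e l x)) \<longlongrightarrow> 0) at_infinity"
    proof (rule tendsto_eventually)
      have "b (hrefl e l x) = 0" if "norm q + r + 2 * \<bar>l\<bar> \<le> norm x" for x
        unfolding b_def using r norm_triangle_ineq2[of "hrefl e l x" q] norm_hrefl_ge[OF e, of x l] that
        by (intro paraboloid_eq_0) auto
      then show "\<forall>\<^sub>F x in at_infinity. b (hrefl e l x) = 0" by (auto simp: eventually_at_infinity)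
    qed
    have "\<exists>p. p \<bullet> e < l \<and> v p < 0 \<and> (\<forall>y. y \<bullet> e < l \<longrightarrow> v p \<le> v y) \<and>
     contact_bound e l v p (f (u p) - f (u (hrefl e l p)) + c * (\<kappa> * C))"
    proof (rule touching_inequality[OF e l, where \<beta> = \<beta> and B\<beta> = "2 * \<kappa>" and N = "ball q (r / 2)" and q = q])
      show "continuous_on UNIV \<beta>"
        unfolding \<beta>_def by (intro continuous_on_mult continuous_on_const continuous_on_diff bc continuous_on_compose2[OF bc] hrefl_continuous continuous_on_id) auto
      show "\<bar>\<beta> x\<bar> \<le> 2 * \<kappa>" for x
        using b01[of x] b01[of "hrefl e l x"] \<kappa> by (simp add: \<beta>_def abs_mult)
      show "(\<beta> \<longlongrightarrow> 0) at_infinity"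
        unfolding \<beta>_def using tendsto_mult_left[OF tendsto_diff[OF b_dec b_decR], of \<kappa>] by simp
      show "\<beta> (hrefl e l x) = - \<beta> x" for x using e by (simp add: \<beta>_def algebra_simps)
      show "tlap s n \<beta> z \<le> \<kappa> * C" if z: "z \<in> ball q (r / 2)" "z \<bullet> e < l" for z n
      proof -
        have "tlap s n \<beta> z = \<kappa> * (tlap s n b z - tlap s n b (hrefl e l z))"
          unfolding \<beta>_def tlap_cmult
          using tlap_diff[OF s(1) bm b01(3) bRm b01(3)] tlap_hrefl[OF e bm] by simp
        moreover have "tlap s n b z \<le> (LINT h|lborel. min 1 (1 / r\<^sup>2 * (norm (h::'a))\<^sup>2) * kern s h)"
          unfolding b_def by (rule tlap_paraboloid_le[OF s r])
        moreover have "- tlap s n b (hrefl e l z) \<le> (LINT h|lborel. min 1 (1 / (r/2)\<^sup>2 * (norm (h::'a))\<^sup>2) * kern s h)"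
          unfolding b_def
        proof (rule tlap_paraboloid_ge_far[OF s r])
          have "z \<bullet> e - q \<bullet> e \<le> r / 2" using inner_le[of z] z by (simp add: dist_norm norm_minus_commute)
          then show "r + r / 2 \<le> norm (hrefl e l z - q)"
            using inner_le[of "hrefl e l z"] hrefl_inner[OF e, of l z] r_def by argo
        qed (use r in simp)
        ultimately show ?thesis using \<kappa> by (simp add: C_def mult_left_mono)
      qed
      show "v x = refl_diff e l x - \<beta> x" for x by (simp add: v_def)
      show "v q < 0" using vq \<kappa> by simp
      show "p \<in> ball q (r / 2) \<and> p \<noteq> hrefl e l x\<^sub>0"
        if "p \<bullet> e < l" "v p < 0" "\<And>y. y \<bullet> e < l \<Longrightarrow> v p \<le> v y" for p
        using only[OF that(1,3)] q r by simp
    qed (use q in auto)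
    then obtain p where p: "p \<bullet> e < l" "\<And>y. y \<bullet> e < l \<Longrightarrow> v p \<le> v y"
      and ineq: "contact_bound e l v p (f (u p) - f (u (hrefl e l p)) + c * (\<kappa> * C))"
      by blast
    have pq: "p = q" by (rule only[OF p])
    have "c * (- 2 * v q * (half_space_const s TYPE('a) * (l - q \<bullet> e) powr - (2 * s)) + A)
          \<le> f (u q) - f (u (hrefl e l q)) + c * (\<kappa> * C)"
      unfolding A_def pq[symmetric]
    proof (rule contact_boundD[OF ineq _ _ \<theta> M \<nu>])
      show "emeasure lborel (ball y0 \<epsilon>) < \<infinity>" using emeasure_lborel_ball_finite by blast
      fix y assume y: "y \<in> ball y0 \<epsilon>"
      show yl: "y \<bullet> e < l" using \<epsilon>(2)[OF y] by blast
      have "\<kappa> * b y \<le> \<kappa> * 1" using b01(2)[of y] \<kappa> by (intro mult_left_mono) auto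
      then show "2 * \<theta> \<le> v y - v p"
        using \<epsilon>(2)[OF y] \<beta>eq[OF yl] vq by (simp add: v_def pq \<theta>_def)
      have "norm (y - q) \<le> norm (y - y0) + norm (y0 - q)" by (metis dist_norm dist_triangle)
      then show "norm (y - p) + 1 \<le> M" using y by (simp add: M_def pq dist_norm norm_minus_commute)
      have "r * ((l - y0 \<bullet> e) / 2) \<le> r * (l - y \<bullet> e)"
        using \<epsilon>(2)[OF y] r by (intro mult_left_mono) auto
      then show "2 * \<nu> \<le> (l - p \<bullet> e) * (l - y \<bullet> e)" by (simp add: \<nu>_def pq r_def)
    qed simp
    moreover have "u (hrefl e l q) = u q" using q(3) by (simp add: refl_diff_def)
    ultimately have "c * (2 * \<kappa> * (half_space_const s TYPE('a) * (l - q \<bullet> e) powr - (2 * s)) + A) \<le> c * (\<kappa> * C)"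
      by (simp add: vq)
    then have "2 * \<kappa> * (half_space_const s TYPE('a) * (l - q \<bullet> e) powr - (2 * s)) + A \<le> \<kappa> * C"
      using c by simp
    moreover have "0 \<le> 2 * \<kappa> * (half_space_const s TYPE('a) * (l - q \<bullet> e) powr - (2 * s))"
      using \<kappa> half_space_const_pos[of s, where 'a = 'a] by simp
    ultimately show ?thesis by linarith
  qed
  \<comment> \<open>Any \<open>\<kappa>\<close> with \<open>\<kappa> * C < A\<close> would do.\<close>
  have "A \<le> A / (2 * (C + 1)) * C" using A C0 by (intro small) auto
  also have "\<dots> < A" using A C0 by (simp add: field_simps) (intro add_nonneg_pos, auto)
  finally show False by simp
qed

text \<open>The case \<open>\<beta> = 0\<close> of the inequality. The mirror image of \<open>x\<^sub>0\<close> is not a negative point since \<open>u\<close> does not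
exceed its value at \<open>x\<^sub>0\<close>.\<close>

lemma negative_minimum:
  assumes e: "norm e = 1" and l: "l \<le> x\<^sub>0 \<bullet> e" and q: "q \<bullet> e < l" "refl_diff e l q < 0"
  shows "\<exists>p. p \<bullet> e < l \<and> refl_diff e l p < 0 \<and> contact_bound e l (refl_diff e l) p (f (u p) - f (u (hrefl e l p)))"
proof -
  have "p \<noteq> hrefl e l x\<^sub>0" if "refl_diff e l p < 0" for p
    using that e le_peak[of "hrefl e l x\<^sub>0"] peak by (auto simp: refl_diff_def)
  then show ?thesis
    using touching_inequality[OF e l, where \<beta> = "\<lambda>_. 0" and B\<beta> = 0 and N = UNIV and v = "refl_diff e l" and q = q and C = 0] q
    by (simp add: tlap_def) blast
qed

text \<open>The composition of reflections in two parallel planes is a translation, so the peak value would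
recur arbitrarily far out.\<close>

lemma two_symmetry_planes_impossible:
  assumes e: "norm e = 1" and ne: "l \<noteq> m"
    and l: "\<And>y. y \<bullet> e < l \<Longrightarrow> refl_diff e l y = 0" and m: "\<And>y. y \<bullet> e < m \<Longrightarrow> refl_diff e m y = 0"
  shows False
proof -
  have sym: "u (hrefl e k x) = u x" if k: "\<And>y. y \<bullet> e < k \<Longrightarrow> refl_diff e k y = 0" for k x
  proof -
    consider "x \<bullet> e < k" | "x \<bullet> e = k" | "k < x \<bullet> e" by linarith
    then show ?thesis
    proof cases
      case 1 then show ?thesis using k by (simp add: refl_diff_def)
    next
      case 2 then show ?thesis by (simp add: hrefl_def)
    next
      case 3
      then have "hrefl e k x \<bullet> e < k" using e by (simp add: hrefl_inner)
      then show ?thesis using k e by (fastforce simp: refl_diff_def)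
    qed
  qed
  define t where "t = 2 * (l - m)"
  have per: "u (x + t *\<^sub>R e) = u x" for x
  proof -
    have "hrefl e l (hrefl e m x) = x + t *\<^sub>R e"
      using hrefl_change_level[of e l "hrefl e m x" m] e by (simp add: t_def algebra_simps)
    then show ?thesis using sym[OF l, of "hrefl e m x"] sym[OF m, of x] by simp
  qed
  have per': "u (x\<^sub>0 + (real k * t) *\<^sub>R e) = a" for k
  proof (induction k)
    case (Suc k)
    then show ?case using per[of "x\<^sub>0 + (real k * t) *\<^sub>R e"] by (simp add: algebra_simps)
  qed (simp add: peak)
  obtain R where R: "\<And>x. R \<le> norm x \<Longrightarrow> \<bar>u x\<bar> < a"
    using tendstoD[OF decay a] by (auto simp: eventually_at_infinity)
  have t: "0 < \<bar>t\<bar>" using ne by (simp add: t_def)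
  obtain k :: nat where k: "(R + norm x\<^sub>0) / \<bar>t\<bar> < real k" using reals_Archimedean2 by blast
  have "norm ((real k * t) *\<^sub>R e) - norm x\<^sub>0 \<le> norm (x\<^sub>0 + (real k * t) *\<^sub>R e)"
    by (metis add.commute norm_diff_ineq)
  moreover have "R + norm x\<^sub>0 < norm ((real k * t) *\<^sub>R e)"
    using k t e by (simp add: abs_mult divide_less_eq)
  ultimately have "\<bar>u (x\<^sub>0 + (real k * t) *\<^sub>R e)\<bar> < a" by (intro R) linarith
  then show False using per' by simp
qed

text \<open>At the mirror image \<open>x\<close> of the peak, \<open>u\<close> takes its maximal value, so \<open>refl_diff e m x\<close> is \<open>0\<close> also for every
level \<open>m\<close> strictly between \<open>x \<bullet> e\<close> and \<open>l\<close>. For such \<open>m\<close> the point \<open>x\<close> is no longer the mirror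
image of \<open>x\<^sub>0\<close>, and the strong maximum principle gives a second, parallel symmetry plane.\<close>

lemma symmetric_before_peak_impossible:
  assumes e: "norm e = 1" and l: "l < x\<^sub>0 \<bullet> e"
    and w: "\<And>m y. m \<le> l \<Longrightarrow> y \<bullet> e < m \<Longrightarrow> 0 \<le> refl_diff e m y"
    and 0: "\<And>y. y \<bullet> e < l \<Longrightarrow> refl_diff e l y = 0"
  shows False
proof -
  define x where "x = hrefl e l x\<^sub>0"
  define m where "m = (l + x \<bullet> e) / 2"
  have xl: "x \<bullet> e < l" using e l by (simp add: x_def hrefl_inner)
  have m: "x \<bullet> e < m" "m < l" using xl by (auto simp: m_def)
  have ux: "u x = a" using 0[OF xl] e peak by (simp add: refl_diff_def x_def)
  have wx: "refl_diff e m x = 0" using w[of m x] m le_peak[of "hrefl e m x"] ux by (simp add: refl_diff_def)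
  have ne: "x \<noteq> hrefl e m x\<^sub>0"
  proof
    assume "x = hrefl e m x\<^sub>0"
    then have "(2 * (l - m)) *\<^sub>R e = 0" using hrefl_change_level[of e l x\<^sub>0 m] by (simp add: x_def)
    then show False using m e by auto
  qed
  have "refl_diff e m y = 0" if "y \<bullet> e < m" for y
    by (rule strong_maximum_principle[OF e _ _ m(1) ne wx that]) (use m l w in auto)
  then show False using two_symmetry_planes_impossible[OF e _ 0, of m] m by blast
qed

end

section \<open>Moving planes\<close>

context decaying_solution
begin

lemma contact_bound_first_term:
  assumes "contact_bound e l v p D"
  shows "c * (- 2 * v p * (half_space_const s TYPE('a) * (l - p \<bullet> e) powr - (2 * s))) \<le> D"
  using contact_boundD[OF assms, of "{}" 1 1 1] by simp

text \<open>Otherwise both \<open>u p\<close> and the smaller value at the mirror image lie where \<open>f\<close> is nonincreasing, which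
makes the right-hand side of the inequality nonpositive, whereas its left-hand side is positive.\<close>

lemma negative_minimum_above_threshold:
  assumes t0: "antimono_on {0..t\<^sub>0} f"
    and neg: "p \<bullet> e < l" "refl_diff e l p < 0" "contact_bound e l (refl_diff e l) p (f (u p) - f (u (hrefl e l p)))"
  shows "t\<^sub>0 < u p"
proof (rule ccontr)
  assume "\<not> t\<^sub>0 < u p"
  moreover have "u (hrefl e l p) < u p" using neg(2) by (simp add: refl_diff_def)
  ultimately have "f (u p) \<le> f (u (hrefl e l p))"
    using monotone_onD[OF t0, of "u (hrefl e l p)" "u p"] nonneg[of "hrefl e l p"] nonneg[of p] by auto
  moreover have "0 < c * (- 2 * refl_diff e l p * (half_space_const s TYPE('a) * (l - p \<bullet> e) powr - (2 * s)))"
  proof -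
    have "0 < - 2 * refl_diff e l p" using neg(2) by simp
    then show ?thesis
      using c neg(1) half_space_const_pos[of s, where 'a = 'a]
      by (intro mult_pos_pos[OF c] mult_pos_pos[of "- 2 * refl_diff e l p"] mult_pos_pos[of "half_space_const s TYPE('a)"]) auto
  qed
  ultimately show False using contact_bound_first_term[OF neg(3)] by linarith
qed

lemma refl_diff_tendsto:
  assumes "L \<longlonglongrightarrow> l" "P \<longlonglongrightarrow> p"
  shows "(\<lambda>n. refl_diff e (L n) (P n)) \<longlonglongrightarrow> refl_diff e l p" and "(\<lambda>n. u (hrefl e (L n) (P n))) \<longlonglongrightarrow> u (hrefl e l p)"
    and "(\<lambda>n. u (P n)) \<longlonglongrightarrow> u p"
proof -
  have ucont: "(\<lambda>n. u (Z n)) \<longlonglongrightarrow> u z" if "Z \<longlonglongrightarrow> z" for Z z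
    using cont that by (simp add: continuous_on_eq_continuous_at isCont_tendsto_compose)
  have R: "(\<lambda>n. hrefl e (L n) (P n)) \<longlonglongrightarrow> hrefl e l p"
    unfolding hrefl_def by (intro tendsto_intros assms)
  show "(\<lambda>n. u (hrefl e (L n) (P n))) \<longlonglongrightarrow> u (hrefl e l p)" "(\<lambda>n. u (P n)) \<longlonglongrightarrow> u p"
    by (rule ucont[OF R], rule ucont[OF assms(2)])
  then show "(\<lambda>n. refl_diff e (L n) (P n)) \<longlonglongrightarrow> refl_diff e l p"
    unfolding refl_diff_def by (rule tendsto_diff)
qed

text \<open>At the limit level the negative minima have risen to \<open>0\<close>. The Lipschitz bound makes the
right-hand side of the inequality at most a multiple of the depth \<open>m n\<close> of the minimum. Dividing by
\<open>m n\<close> keeps the minimum points away from the plane; letting \<open>m n\<close> tend to \<open>0\<close> then leaves no room for a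
point where the limit is positive.\<close>

lemma symmetric_at_stopping_plane:
  assumes e: "norm e = 1"
    and good: "\<And>y. y \<bullet> e < l \<Longrightarrow> 0 \<le> refl_diff e l y"
    and L: "L \<longlonglongrightarrow> l" "\<And>n. l \<le> L n"
    and P: "P \<longlonglongrightarrow> p" "\<And>n. P n \<bullet> e < L n" "\<And>n. refl_diff e (L n) (P n) < 0"
      "\<And>n. contact_bound e (L n) (refl_diff e (L n)) (P n) (f (u (P n)) - f (u (hrefl e (L n) (P n))))"
    and y0: "y0 \<bullet> e < l"
  shows "refl_diff e l y0 = 0"
proof (rule ccontr)
  assume "refl_diff e l y0 \<noteq> 0"
  then have pos: "0 < refl_diff e l y0" using good[OF y0] by simp
  define m where "m n = - refl_diff e (L n) (P n)" for n
  define d where "d n = L n - P n \<bullet> e" for n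
  have m: "0 < m n" for n using P(3) by (simp add: m_def)
  have d: "0 < d n" for n using P(2) by (simp add: d_def)
  have dlim: "d \<longlonglongrightarrow> l - p \<bullet> e" unfolding d_def by (intro tendsto_intros L P)
  have mlim: "m \<longlonglongrightarrow> - refl_diff e l p" unfolding m_def by (intro tendsto_minus refl_diff_tendsto L P)
  have d0: "0 \<le> l - p \<bullet> e" by (rule LIMSEQ_le_const[OF dlim]) (use d in \<open>auto intro: less_imp_le\<close>)
  \<comment> \<open>Being a limit of negative values, it is nonpositive; \<open>good\<close> gives the other sign off the plane.\<close>
  have wp: "refl_diff e l p = 0"
  proof (cases "p \<bullet> e < l")
    case True
    have "0 \<le> - refl_diff e l p" by (rule LIMSEQ_le_const[OF mlim]) (use m in \<open>auto intro: less_imp_le\<close>)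
    then show ?thesis using good[OF True] by simp
  next
    case False
    then show ?thesis using d0 by (simp add: refl_diff_def hrefl_def)
  qed
  have m0: "m \<longlonglongrightarrow> 0" using mlim wp by simp
  obtain r \<Lambda> where r: "0 < r" "\<Lambda>-lipschitz_on (cball (u p) r) f"
    using f_lip unfolding locally_lipschitz_def by blast
  have \<Lambda>: "0 \<le> \<Lambda>" using r(2) by (rule lipschitz_on_nonneg)
  have "\<forall>\<^sub>F n in sequentially. dist (u (P n)) (u p) < r"
    using tendstoD[OF refl_diff_tendsto(3)[OF L(1) P(1)] r(1)] .
  moreover have "\<forall>\<^sub>F n in sequentially. dist (u (hrefl e (L n) (P n))) (u p) < r"
    using tendstoD[OF refl_diff_tendsto(2)[OF L(1) P(1), of e] r(1)] wp by (simp add: refl_diff_def)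
  ultimately have lip: "\<forall>\<^sub>F n in sequentially. f (u (P n)) - f (u (hrefl e (L n) (P n))) \<le> \<Lambda> * m n"
  proof eventually_elim
    case (elim n)
    have "dist (f (u (P n))) (f (u (hrefl e (L n) (P n)))) \<le> \<Lambda> * dist (u (P n)) (u (hrefl e (L n) (P n)))"
      using elim by (intro lipschitz_onD[OF r(2)]) (auto simp: dist_commute less_imp_le)
    also have "dist (u (P n)) (u (hrefl e (L n) (P n))) = m n"
      using m[of n] by (simp add: dist_real_def m_def refl_diff_def)
    finally show ?case by (simp add: dist_real_def)
  qed
  define h where "h = half_space_const s TYPE('a)"
  have h: "0 < h" by (simp add: h_def half_space_const_pos)
  \<comment> \<open>Minimum points at vanishing distance from the plane would make \<open>d n powr - (2 * s)\<close> unbounded.\<close>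
  have dpos: "0 < l - p \<bullet> e"
  proof (rule ccontr)
    assume "\<not> 0 < l - p \<bullet> e"
    then have dlim0: "d \<longlonglongrightarrow> 0" using d0 dlim by simp
    have "\<forall>\<^sub>F n in sequentially. 2 * c * h \<le> \<Lambda> * d n powr (2 * s)"
      using lip
    proof eventually_elim
      case (elim n)
      have "c * (2 * m n * (h * d n powr - (2 * s))) \<le> \<Lambda> * m n"
        using contact_bound_first_term[OF P(4), of n] elim by (simp add: m_def d_def h_def)
      then have "m n * (2 * c * h * d n powr - (2 * s)) \<le> m n * \<Lambda>" by (simp add: algebra_simps)
      then have "2 * c * h * d n powr - (2 * s) \<le> \<Lambda>" using m[of n] by simp
      then have "2 * c * h * d n powr - (2 * s) * d n powr (2 * s) \<le> \<Lambda> * d n powr (2 * s)"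
        by (intro mult_right_mono) auto
      moreover have "d n powr - (2 * s) * d n powr (2 * s) = 1"
        using d[of n] by (simp add: powr_add[symmetric])
      ultimately show ?case by (simp add: mult.assoc)
    qed
    moreover have "(\<lambda>n. \<Lambda> * d n powr (2 * s)) \<longlonglongrightarrow> \<Lambda> * 0"
      using d s by (intro tendsto_mult_left tendsto_zero_powrI[OF dlim0 tendsto_const]) (auto intro!: always_eventually less_imp_le)
    ultimately have "2 * c * h \<le> \<Lambda> * 0"
      by (intro tendsto_lowerbound) auto
    then show False using mult_pos_pos[OF c h] by simp
  qed
  obtain \<epsilon> where \<epsilon>: "0 < \<epsilon>" "\<And>y. y \<in> ball y0 \<epsilon> \<Longrightarrow> y \<bullet> e < l \<and> refl_diff e l y0 / 2 \<le> refl_diff e l y \<and> (l - y0 \<bullet> e) / 2 \<le> l - y \<bullet> e"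
    using positive_ball[OF refl_diff_continuous y0, of e] pos by blast
  define \<theta> where "\<theta> = refl_diff e l y0 / 8"
  define M where "M = norm (y0 - p) + \<epsilon> + 2"
  define \<nu> where "\<nu> = (l - p \<bullet> e) * (l - y0 \<bullet> e) / 8"
  have \<theta>: "0 < \<theta>" and M: "0 < M" and \<nu>: "0 < \<nu>"
    using pos \<epsilon>(1) dpos y0 by (auto simp: \<theta>_def M_def \<nu>_def add_nonneg_pos)
  define A where "A = \<theta> * gap s TYPE('a) M \<nu> * measure lborel (ball y0 \<epsilon>)"
  have A: "0 < A" unfolding A_def
    by (intro mult_pos_pos \<theta> gap_pos s M \<nu> measure_ball_pos \<epsilon>)
  obtain \<delta> where \<delta>: "0 < \<delta>" "\<And>x y. dist x y < \<delta> \<Longrightarrow> dist (u x) (u y) < \<theta>"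
    using u_uniform \<theta> unfolding uniformly_continuous_on_def by (metis UNIV_I)
  have "\<forall>\<^sub>F n in sequentially. dist (L n) l < \<delta> / 2" using tendstoD[OF L(1), of "\<delta> / 2"] \<delta>(1) by simp
  moreover have "\<forall>\<^sub>F n in sequentially. dist (P n) p < 1" using tendstoD[OF P(1), of 1] by simp
  moreover have "\<forall>\<^sub>F n in sequentially. (l - p \<bullet> e) / 2 < d n"
    using order_tendstoD(1)[OF dlim, of "(l - p \<bullet> e) / 2"] dpos by simp
  ultimately have "\<forall>\<^sub>F n in sequentially. c * A \<le> \<Lambda> * m n"
    using lip
  proof eventually_elim
    case (elim n)
    have "c * (- 2 * refl_diff e (L n) (P n) * (half_space_const s TYPE('a) * (L n - P n \<bullet> e) powr - (2 * s)) + A)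
      \<le> f (u (P n)) - f (u (hrefl e (L n) (P n)))"
      unfolding A_def
    proof (rule contact_boundD[OF P(4) _ _ \<theta> M \<nu>])
      show "emeasure lborel (ball y0 \<epsilon>) < \<infinity>" using emeasure_lborel_ball_finite by blast
      fix y assume y: "y \<in> ball y0 \<epsilon>"
      show "y \<bullet> e < L n" using \<epsilon>(2)[OF y] L(2)[of n] by linarith
      have "dist (hrefl e (L n) y) (hrefl e l y) = 2 * \<bar>L n - l\<bar>"
        by (simp only: dist_norm hrefl_change_level norm_scaleR e mult_1_right abs_mult abs_numeral)
      then have "dist (hrefl e (L n) y) (hrefl e l y) < \<delta>" using elim(1) by (simp add: dist_real_def)
      from \<delta>(2)[OF this] have "refl_diff e l y - \<theta> \<le> refl_diff e (L n) y"
        by (simp add: refl_diff_def dist_real_def abs_if split: if_splits)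
      then show "2 * \<theta> \<le> refl_diff e (L n) y - refl_diff e (L n) (P n)"
        using \<epsilon>(2)[OF y] P(3)[of n] \<theta> unfolding \<theta>_def by linarith
      have "norm (y - P n) \<le> norm (y - y0) + norm (y0 - p) + norm (P n - p)"
        by (smt (verit) dist_norm dist_triangle dist_triangle2)
      then show "norm (y - P n) + 1 \<le> M"
        using y elim(2) by (simp add: M_def dist_norm norm_minus_commute)
      have "(l - p \<bullet> e) / 2 * ((l - y0 \<bullet> e) / 2) \<le> (L n - P n \<bullet> e) * (L n - y \<bullet> e)"
        using elim(3) \<epsilon>(2)[OF y] L(2)[of n] dpos y0 d[of n] by (intro mult_mono) (auto simp: d_def)
      moreover have "(l - p \<bullet> e) / 2 * ((l - y0 \<bullet> e) / 2) = 2 * \<nu>" by (simp add: \<nu>_def)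
      ultimately show "2 * \<nu> \<le> (L n - P n \<bullet> e) * (L n - y \<bullet> e)" by (simp only:)
    qed simp
    moreover have "c * A \<le> c * (- 2 * refl_diff e (L n) (P n) * (half_space_const s TYPE('a) * (L n - P n \<bullet> e) powr - (2 * s)) + A)"
      using c P(3)[of n] h by (intro mult_left_mono) (auto simp: h_def[symmetric] mult_nonpos_nonneg)
    ultimately show ?case using elim(4) by linarith
  qed
  moreover have "(\<lambda>n. \<Lambda> * m n) \<longlonglongrightarrow> \<Lambda> * 0" by (intro tendsto_mult_left m0)
  ultimately have "c * A \<le> \<Lambda> * 0" by (intro tendsto_lowerbound) auto
  then show False using mult_pos_pos[OF c A] by simp
qed

text \<open>Bad levels have minimum points in a fixed ball, so they are bounded below. If bad levels tend to their
infimum, a subsequence of their minimum points converges, and \<open>symmetric_at_stopping_plane\<close>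
applies to the limit.\<close>

lemma moving_planes:
  assumes e: "norm e = 1" and t0: "0 < t\<^sub>0" "antimono_on {0..t\<^sub>0} f"
    and l: "l \<le> x\<^sub>0 \<bullet> e" and y: "y \<bullet> e < l"
  shows "0 \<le> refl_diff e l y"
proof (rule ccontr)
  assume contra: "\<not> 0 \<le> refl_diff e l y"
  define Bad where "Bad = {l. l \<le> x\<^sub>0 \<bullet> e \<and> (\<exists>q. q \<bullet> e < l \<and> refl_diff e l q < 0)}"
  \<comment> \<open>Let \<open>k\<close> below be the infimum of the bad levels. It is itself good, so bad levels approach it from above.\<close>
  have ne: "Bad \<noteq> {}" using contra l y unfolding Bad_def not_le by blast
  obtain K where K: "\<And>x. K \<le> norm x \<Longrightarrow> \<bar>u x\<bar> < t\<^sub>0"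
    using tendstoD[OF decay t0(1)] by (auto simp: eventually_at_infinity)
  have wit: "\<exists>p. p \<bullet> e < b \<and> norm p \<le> K \<and> refl_diff e b p < 0 \<and>
      contact_bound e b (refl_diff e b) p (f (u p) - f (u (hrefl e b p)))" if b: "b \<in> Bad" for b
  proof -
    obtain q where "b \<le> x\<^sub>0 \<bullet> e" "q \<bullet> e < b" "refl_diff e b q < 0" using b by (auto simp: Bad_def)
    from negative_minimum[OF e this] obtain p where p: "p \<bullet> e < b" "refl_diff e b p < 0"
      "contact_bound e b (refl_diff e b) p (f (u p) - f (u (hrefl e b p)))" by blast
    have "norm p \<le> K" using negative_minimum_above_threshold[OF t0(2) p] K[of p] by force
    then show ?thesis using p by blast
  qed
  have lower: "- K \<le> b" if b: "b \<in> Bad" for b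
  proof -
    obtain p where "p \<bullet> e < b" "norm p \<le> K" using wit[OF b] by blast
    moreover have "- norm p \<le> p \<bullet> e" using Cauchy_Schwarz_ineq2[of p e] e by (simp add: abs_le_iff)
    ultimately show ?thesis by linarith
  qed
  have bdd: "bdd_below Bad" using lower by (rule bdd_belowI)
  define k where "k = Inf Bad"
  have below: "k \<le> b" if "b \<in> Bad" for b unfolding k_def by (rule cInf_lower[OF that bdd])
  have "k \<le> x\<^sub>0 \<bullet> e" using ne below by (force simp: Bad_def)
  have good_lt: "0 \<le> refl_diff e m z" if "m < k" "z \<bullet> e < m" for m z
    using below[of m] that \<open>k \<le> x\<^sub>0 \<bullet> e\<close> by (force simp: Bad_def)
  have good: "0 \<le> refl_diff e k z" if z: "z \<bullet> e < k" for z
  proof -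
    define L where "L n = k - (k - z \<bullet> e) / real (Suc (Suc n))" for n
    have "(\<lambda>n. k - (k - z \<bullet> e) * (1 / real (Suc (Suc n)))) \<longlonglongrightarrow> k - (k - z \<bullet> e) * 0"
      by (intro tendsto_intros LIMSEQ_Suc[OF LIMSEQ_Suc[OF lim_1_over_n]])
    then have "L \<longlonglongrightarrow> k" by (simp add: L_def[abs_def])
    then have "(\<lambda>n. refl_diff e (L n) z) \<longlonglongrightarrow> refl_diff e k z" by (intro refl_diff_tendsto tendsto_const)
    moreover have "0 \<le> refl_diff e (L n) z" for n
    proof (rule good_lt)
      show "L n < k" using z by (simp add: L_def)
      have "(k - z \<bullet> e) / real (Suc (Suc n)) < (k - z \<bullet> e) / 1"
        using z by (intro divide_strict_left_mono) auto
      then show "z \<bullet> e < L n" by (simp add: L_def)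
    qed
    ultimately show ?thesis by (intro LIMSEQ_le_const) auto
  qed
  have notin: "k \<notin> Bad" using good by (force simp: Bad_def)
  have lt: "k < x\<^sub>0 \<bullet> e"
  proof -
    obtain b where b: "b \<in> Bad" using ne by blast
    then have "k < b" using below[OF b] notin by (cases "k = b") auto
    then show ?thesis using b by (simp add: Bad_def)
  qed
  have "k \<in> closure Bad" unfolding k_def by (rule closure_contains_Inf[OF ne bdd])
  then obtain B where B: "\<And>n. B n \<in> Bad" "B \<longlonglongrightarrow> k" by (auto simp: closure_sequential)
  obtain P where P: "\<And>n. P n \<bullet> e < B n" "\<And>n. norm (P n) \<le> K" "\<And>n. refl_diff e (B n) (P n) < 0"
      "\<And>n. contact_bound e (B n) (refl_diff e (B n)) (P n) (f (u (P n)) - f (u (hrefl e (B n) (P n))))"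
    using wit[OF B(1)] by metis
  have "compact (cball (0::'a) K)" by simp
  moreover have "\<forall>k. P k \<in> cball 0 K" using P(2) by simp
  ultimately obtain p r where r: "strict_mono r" and Pr: "(P \<circ> r) \<longlonglongrightarrow> p"
    unfolding compact_def by blast
  have Br: "(B \<circ> r) \<longlonglongrightarrow> k" by (rule LIMSEQ_subseq_LIMSEQ[OF B(2) r])
  have "refl_diff e k z = 0" if "z \<bullet> e < k" for z
    by (rule symmetric_at_stopping_plane[OF e good Br _ Pr _ _ _ that]) (use P B(1) below in \<open>auto\<close>)
  moreover have "0 \<le> refl_diff e m z" if "m \<le> k" "z \<bullet> e < m" for m z
    using good_lt[of m z] good[of z] that by (cases "m = k") auto
  ultimately show False using symmetric_before_peak_impossible[OF e lt] by blast
qed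

lemma symmetric_about_peak:
  assumes e: "norm e = 1" and t0: "0 < t\<^sub>0" "antimono_on {0..t\<^sub>0} f"
  shows "u (hrefl e (x\<^sub>0 \<bullet> e) x) = u x"
proof -
  let ?l = "x\<^sub>0 \<bullet> e"
  have left: "0 \<le> refl_diff e ?l y" if "y \<bullet> e < ?l" for y
    by (rule moving_planes[OF e t0 order_refl that])
  have right: "0 \<le> refl_diff e ?l y" if "?l < y \<bullet> e" for y
    using moving_planes[of "- e" t\<^sub>0 "x\<^sub>0 \<bullet> (- e)" y] e t0 that
    by (simp add: refl_diff_def hrefl_def algebra_simps)
  consider "x \<bullet> e < ?l" | "x \<bullet> e = ?l" | "?l < x \<bullet> e" by linarith
  then show ?thesis
  proof cases
    case 1
    then have "?l < hrefl e ?l x \<bullet> e" using e by (simp add: hrefl_inner)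
    from right[OF this] left[OF 1] show ?thesis using e by (simp add: refl_diff_def)
  next
    case 2 then show ?thesis by (simp add: hrefl_def)
  next
    case 3
    then have "hrefl e ?l x \<bullet> e < ?l" using e by (simp add: hrefl_inner)
    from left[OF this] right[OF 3] show ?thesis using e by (simp add: refl_diff_def)
  qed
qed

lemma radial:
  assumes t0: "0 < t\<^sub>0" "antimono_on {0..t\<^sub>0} f" and xy: "norm (x - x\<^sub>0) = norm (y - x\<^sub>0)"
  shows "u x = u y"
proof (cases "x = y")
  case False
  define n where "n = norm (x - y)"
  define e where "e = (1 / n) *\<^sub>R (x - y)"
  have n: "0 < n" using False by (simp add: n_def)
  have e: "norm e = 1" using n by (simp add: e_def n_def)
  have "2 * ((x\<^sub>0 - x) \<bullet> (x - y)) = - n\<^sup>2"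
  proof -
    have "(x - x\<^sub>0) \<bullet> (x - x\<^sub>0) = (y - x\<^sub>0) \<bullet> (y - x\<^sub>0)" using xy by (simp add: dot_square_norm)
    then show ?thesis by (simp add: n_def power2_norm_eq_inner inner_simps inner_commute)
  qed
  moreover have "x\<^sub>0 \<bullet> e - x \<bullet> e = ((x\<^sub>0 - x) \<bullet> (x - y)) / n"
    by (simp add: e_def inner_diff_left diff_divide_distrib)
  ultimately have "2 * (x\<^sub>0 \<bullet> e - x \<bullet> e) = - n"
    using n by (simp add: power2_eq_square)
  then have "hrefl e (x\<^sub>0 \<bullet> e) x = x - n *\<^sub>R e" by (simp add: hrefl_def)
  also have "\<dots> = y" using n by (simp add: e_def)
  finally show ?thesis using symmetric_about_peak[OF e t0, of x] by simp
qed simp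

text \<open>If \<open>u\<close> took the same value at two points of a ray, it would be constant between them, and the
perpendicular bisectors of many pairs of points would be symmetry planes. The nearer point of each
pair is chosen different from \<open>x\<^sub>0\<close>, so that the strong maximum principle applies.\<close>

lemma strictly_decreasing_along_rays:
  assumes t0: "0 < t\<^sub>0" "antimono_on {0..t\<^sub>0} f" and b: "norm b = 1" and t: "0 \<le> t1" "t1 < t2"
  shows "u (x\<^sub>0 + t2 *\<^sub>R b) < u (x\<^sub>0 + t1 *\<^sub>R b)"
proof (rule ccontr)
  assume contra: "\<not> u (x\<^sub>0 + t2 *\<^sub>R b) < u (x\<^sub>0 + t1 *\<^sub>R b)"
  define e where "e = - b"
  have e: "norm e = 1" using b by (simp add: e_def)
  have bb: "b \<bullet> b = 1" using b by (simp add: dot_square_norm)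
  define l where "l \<tau> = x\<^sub>0 \<bullet> e - (\<tau> + t2) / 2" for \<tau>
  \<comment> \<open>The plane at level \<open>l \<tau>\<close> bisects the points of the ray at distances \<open>\<tau>\<close> and \<open>t2\<close> from \<open>x\<^sub>0\<close>.\<close>
  have refl_ray: "hrefl e (l \<tau>) (x\<^sub>0 + t2 *\<^sub>R b) = x\<^sub>0 + \<tau> *\<^sub>R b" for \<tau>
    by (simp add: hrefl_def l_def e_def inner_simps bb algebra_simps flip: scaleR_add_left)
  have half: "(x\<^sub>0 + t2 *\<^sub>R b) \<bullet> e < l \<tau>" if "\<tau> < t2" for \<tau>
    using that by (simp add: l_def e_def inner_simps bb)
  have mono: "u (x\<^sub>0 + r2 *\<^sub>R b) \<le> u (x\<^sub>0 + r1 *\<^sub>R b)" if "0 \<le> r1" "r1 < r2" for r1 r2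
  proof -
    define k where "k = x\<^sub>0 \<bullet> e - (r1 + r2) / 2"
    have "(x\<^sub>0 + r2 *\<^sub>R b) \<bullet> e < k" "k \<le> x\<^sub>0 \<bullet> e" using that by (simp_all add: k_def e_def inner_simps bb)
    from moving_planes[OF e t0 this(2,1)]
    have "u (x\<^sub>0 + r2 *\<^sub>R b) \<le> u (hrefl e k (x\<^sub>0 + r2 *\<^sub>R b))" by (simp add: refl_diff_def)
    moreover have "hrefl e k (x\<^sub>0 + r2 *\<^sub>R b) = x\<^sub>0 + r1 *\<^sub>R b"
      by (simp add: hrefl_def k_def e_def inner_simps bb algebra_simps flip: scaleR_add_left)
    ultimately show ?thesis by simp
  qed
  have sym: "refl_diff e (l \<tau>) y = 0" if \<tau>: "t1 < \<tau>" "\<tau> < t2" and y: "y \<bullet> e < l \<tau>" for \<tau> y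
  proof (rule strong_maximum_principle[OF e _ _ half[OF \<tau>(2)] _ _ y])
    show le: "l \<tau> \<le> x\<^sub>0 \<bullet> e" using \<tau> t by (simp add: l_def)
    show "0 \<le> refl_diff e (l \<tau>) z" if "z \<bullet> e < l \<tau>" for z by (rule moving_planes[OF e t0 le that])
    show "x\<^sub>0 + t2 *\<^sub>R b \<noteq> hrefl e (l \<tau>) x\<^sub>0"
    proof
      assume "x\<^sub>0 + t2 *\<^sub>R b = hrefl e (l \<tau>) x\<^sub>0"
      then have "x\<^sub>0 + \<tau> *\<^sub>R b = x\<^sub>0" using refl_ray[of \<tau>] e by simp
      then show False using \<tau> t b by auto
    qed
    have "u (x\<^sub>0 + t2 *\<^sub>R b) = u (x\<^sub>0 + \<tau> *\<^sub>R b)"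
      using mono[of t1 \<tau>] mono[of \<tau> t2] \<tau> t contra by linarith
    then show "refl_diff e (l \<tau>) (x\<^sub>0 + t2 *\<^sub>R b) = 0" by (simp add: refl_diff_def refl_ray)
  qed
  \<comment> \<open>Two choices of the nearer point give two different parallel symmetry planes.\<close>
  obtain \<tau> where \<tau>: "t1 < \<tau>" "\<tau> < t2" using dense[OF t(2)] by blast
  obtain \<tau>' where \<tau>': "\<tau> < \<tau>'" "\<tau>' < t2" using dense[OF \<tau>(2)] by blast
  have "l \<tau> \<noteq> l \<tau>'" using \<tau>' by (simp add: l_def)
  then show False
    using two_symmetry_planes_impossible[OF e, of "l \<tau>" "l \<tau>'"] sym[of \<tau>] sym[of \<tau>'] \<tau> \<tau>' by force
qed

end

theorem theorem1p12:
  fixes x\<^sub>0 :: "'a::euclidean_space"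
    and u :: "'a \<Rightarrow> real"
    and f :: "real \<Rightarrow> real"
    and s a c :: real
  assumes "0 < s" and "s < 1"
    and "0 < c"
    and "0 < a"
    and "locally_lipschitz f"
    and "\<exists>t\<^sub>0>0. antimono_on {0..t\<^sub>0} f"
    and "weak_solution c s (UNIV - {x\<^sub>0}) (\<lambda>x. f (u x)) u"
    and "bounded (range u)"
    and "continuous_on UNIV u"
    and "u x\<^sub>0 = a"
    and "\<forall>x\<in>UNIV - {x\<^sub>0}. 0 \<le> u x \<and> u x \<le> a"
    and "(u \<longlongrightarrow> 0) at_infinity"
  shows "radially_symmetric x\<^sub>0 u \<and> radially_decreasing x\<^sub>0 u"
proof -
  interpret decaying_solution s c a f u x\<^sub>0
  proof
    show "0 \<le> u x" "u x \<le> a" for x using assms(4,10,11) by (cases "x = x\<^sub>0"; simp)+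
  qed (use assms in auto)
  obtain t\<^sub>0 where t0: "0 < t\<^sub>0" "antimono_on {0..t\<^sub>0} f" using assms(6) by blast
  have sym: "u x = u y" if "norm (x - x\<^sub>0) = norm (y - x\<^sub>0)" for x y
    by (rule radial[OF t0 that])
  obtain b :: 'a where b: "norm b = 1" using vector_choose_size[of 1] by auto
  define h where "h t = u (x\<^sub>0 + t *\<^sub>R b)" for t
  have "strict_antimono_on {0..} h"
    by (rule monotone_onI) (auto simp: h_def intro!: strictly_decreasing_along_rays[OF t0 b])
  moreover have "u x = h (norm (x - x\<^sub>0))" for x
    unfolding h_def using b by (intro sym) simp
  ultimately show ?thesis
    using sym unfolding radially_symmetric_def radially_decreasing_def by blast
qed

end
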